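(* Let $\mathcal G$ be a double category. The following statements are equivalent: (i) $\mathcal G$ is a double groupoid satisfying the filling condition. (ii) The bisimplicial set $\mathbf N\mathcal G$ (the double nerve of $\mathcal G$) satisfies the extension condition. (iii) The simplicial set $\mathrm{diag}\,\mathbf N\mathcal G$ is a Kan complex.
   Context: **Double groupoids.** A double category consists of sets $O$ (objects), $H$ (horizontal morphisms), $V$ (vertical morphisms), $C$ (squares) with four category structures $(H,O,s^h,t^h,I^h,\circ_h)$, $(V,O,s^v,t^v,I^v,\circ_v)$, $(C,V,s^h,t^h,I^h,\circ_h)$, $(C,H,s^v,t^v,I^v,\circ_v)$ (sources, targets, identities, compositions; $f\circ g$ is defined when source of $f$ = target of $g$) such that: (1) $s^hs^v=s^vs^h$, $t^ht^v=t^vt^h$, $s^ht^v=t^vs^h$, $s^vt^h=t^hs^v$ on squares; $s^hI^v=I^vs^h$, $t^hI^v=I^vt^h$, $s^vI^h=I^hs^v$, $t^vI^h=I^ht^v$; $I^hI^v=I^vI^h$ on objects; (2) $s^v,t^v$ on squares preserve $\circ_h$, $s^h,t^h$ on squares preserve $\circ_v$, $I^v(f\circ_hf')=I^vf\circ_hI^vf'$, $I^h(u\circ_vu')=I^hu\circ_vI^hu'$; (3) interchange: $(\alpha\circ_h\beta)\circ_v(\gamma\circ_h\delta)=(\alpha\circ_v\gamma)\circ_h(\beta\circ_v\delta)$ whenever defined. It is a double groupoid if all four categories are groupoids. Filling condition: for every horizontal $g$ and vertical $u$ with $s^hg=t^vu$ there is a square $\alpha$ with $s^h\alpha=u$, $t^v\alpha=g$.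 Double functors preserve all the structure. **Double nerve.** $\mathbf N\mathcal G$ is the bisimplicial set whose $(p,q)$-bisimplices are double functors $[p]\otimes[q]\to\mathcal G$. Here $[n]$ is the category with objects $0,\dots,n$ and exactly one arrow $j\to i$ when $i\le j$; for categories $\mathcal A,\mathcal B$, $\mathcal A\otimes\mathcal B$ is the double category with objects $(a,b)$, horizontal morphisms $(f,b)$, vertical morphisms $(a,u)$, and squares $(f,u)$ ($f:a\to c$ in $\mathcal A$, $u:b\to d$ in $\mathcal B$) with $s^h=(a,u)$, $t^h=(c,u)$, $s^v=(f,b)$, $t^v=(f,d)$. $\mathrm{diag}$ denotes the diagonal simplicial set $n\mapsto K_{n,n}$. **Extension condition.** For a bisimplicial set $K$, let $\Delta[p,q]$ be the representable bisimplicial set, and for $p,q\ge1$, $0\le k\le p$, $0\le l\le q$, let $\Lambda^{k,l}[p,q]\subset\Delta[p,q]$ be the bisimplicial subset generated by all horizontal faces with index $i\ne k$ and all vertical faces with index $j\neq l$. $K$ satisfies the extension condition if all simplicial sets $K_{p,*}$ and $K_{*,q}$ ($p,q\ge 0$) are Kan complexes and every bisimplicial map $\Lambda^{k,l}[p,q]\to K$ extends to $\Delta[p,q]$. *)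

theory Defs
  imports Main "HOL-Library.FuncSet"
begin

section \<open>Small categories and groupoids\<close>

record ('o, 'm) cat =
  obj :: "'o set"
  arr :: "'m set"
  src :: "'m \<Rightarrow> 'o"
  tgt :: "'m \<Rightarrow> 'o"
  idn :: "'o \<Rightarrow> 'm"
  cmp :: "'m \<Rightarrow> 'm \<Rightarrow> 'm"

text \<open>\<open>cmp A f g\<close> is the composite \<open>f \<circ> g\<close> (first \<open>g\<close>, then \<open>f\<close>). Nothing is required of the
  operations outside the carriers, or of composites with \<open>src A f \<noteq> tgt A g\<close>.\<close>

locale category =
  fixes A :: "('o, 'm) cat"
  assumes src_obj: "f \<in> arr A \<Longrightarrow> src A f \<in> obj A"
    and tgt_obj: "f \<in> arr A \<Longrightarrow> tgt A f \<in> obj A"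
    and idn_arr: "a \<in> obj A \<Longrightarrow> idn A a \<in> arr A"
    and src_idn: "a \<in> obj A \<Longrightarrow> src A (idn A a) = a"
    and tgt_idn: "a \<in> obj A \<Longrightarrow> tgt A (idn A a) = a"
    and cmp_arr: "\<lbrakk>f \<in> arr A; g \<in> arr A; src A f = tgt A g\<rbrakk> \<Longrightarrow> cmp A f g \<in> arr A"
    and src_cmp: "\<lbrakk>f \<in> arr A; g \<in> arr A; src A f = tgt A g\<rbrakk> \<Longrightarrow> src A (cmp A f g) = src A g"
    and tgt_cmp: "\<lbrakk>f \<in> arr A; g \<in> arr A; src A f = tgt A g\<rbrakk> \<Longrightarrow> tgt A (cmp A f g) = tgt A f"
    and cmp_idn_right: "f \<in> arr A \<Longrightarrow> cmp A f (idn A (src A f)) = f"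
    and cmp_idn_left: "f \<in> arr A \<Longrightarrow> cmp A (idn A (tgt A f)) f = f"
    and cmp_assoc: "\<lbrakk>f \<in> arr A; g \<in> arr A; h \<in> arr A; src A f = tgt A g; src A g = tgt A h\<rbrakk>
      \<Longrightarrow> cmp A (cmp A f g) h = cmp A f (cmp A g h)"

locale groupoid = category +
  assumes inverse_exists: "f \<in> arr A \<Longrightarrow>
    \<exists>g \<in> arr A. src A g = tgt A f \<and> tgt A g = src A f \<and>
      cmp A g f = idn A (src A f) \<and> cmp A f g = idn A (tgt A f)"

definition is_functor ::
  "('o, 'm) cat \<Rightarrow> ('p, 'n) cat \<Rightarrow> ('o \<Rightarrow> 'p) \<Rightarrow> ('m \<Rightarrow> 'n) \<Rightarrow> bool" where
  "is_functor A B F0 F1 \<longleftrightarrow>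
     (\<forall>a \<in> obj A. F0 a \<in> obj B) \<and>
     (\<forall>f \<in> arr A. F1 f \<in> arr B) \<and>
     (\<forall>f \<in> arr A. src B (F1 f) = F0 (src A f)) \<and>
     (\<forall>f \<in> arr A. tgt B (F1 f) = F0 (tgt A f)) \<and>
     (\<forall>a \<in> obj A. F1 (idn A a) = idn B (F0 a)) \<and>
     (\<forall>f \<in> arr A. \<forall>g \<in> arr A. src A f = tgt A g \<longrightarrow> F1 (cmp A f g) = cmp B (F1 f) (F1 g))"


section \<open>Double categories\<close>

text \<open>The four category structures \<open>(H,O)\<close>, \<open>(V,O)\<close>, \<open>(C,V)\<close>, \<open>(C,H)\<close>: \<open>sqh\<close> is the horizontal
  structure on squares, whose objects are the vertical morphisms, and \<open>sqv\<close> the vertical structure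
  on squares, whose objects are the horizontal morphisms.\<close>

record ('o, 'h, 'v, 'c) dcat =
  hor :: "('o, 'h) cat"
  ver :: "('o, 'v) cat"
  sqh :: "('v, 'c) cat"
  sqv :: "('h, 'c) cat"

abbreviation squares :: "('o, 'h, 'v, 'c) dcat \<Rightarrow> 'c set" where
  "squares G \<equiv> arr (sqh G)"

locale double_category =
  fixes G :: "('o, 'h, 'v, 'c) dcat"
  assumes category_hor: "category (hor G)"
    and category_ver: "category (ver G)"
    and category_sqh: "category (sqh G)"
    and category_sqv: "category (sqv G)"
    and obj_ver: "obj (ver G) = obj (hor G)"
    and obj_sqh: "obj (sqh G) = arr (ver G)"
    and obj_sqv: "obj (sqv G) = arr (hor G)"
    and arr_sqv: "arr (sqv G) = arr (sqh G)"
    and src_src: "\<alpha> \<in> squares G \<Longrightarrow> src (hor G) (src (sqv G) \<alpha>) = src (ver G) (src (sqh G) \<alpha>)"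
    and tgt_tgt: "\<alpha> \<in> squares G \<Longrightarrow> tgt (hor G) (tgt (sqv G) \<alpha>) = tgt (ver G) (tgt (sqh G) \<alpha>)"
    and src_tgt: "\<alpha> \<in> squares G \<Longrightarrow> src (hor G) (tgt (sqv G) \<alpha>) = tgt (ver G) (src (sqh G) \<alpha>)"
    and tgt_src: "\<alpha> \<in> squares G \<Longrightarrow> src (ver G) (tgt (sqh G) \<alpha>) = tgt (hor G) (src (sqv G) \<alpha>)"
    and srch_idnv: "f \<in> arr (hor G) \<Longrightarrow> src (sqh G) (idn (sqv G) f) = idn (ver G) (src (hor G) f)"
    and tgth_idnv: "f \<in> arr (hor G) \<Longrightarrow> tgt (sqh G) (idn (sqv G) f) = idn (ver G) (tgt (hor G) f)"
    and srcv_idnh: "u \<in> arr (ver G) \<Longrightarrow> src (sqv G) (idn (sqh G) u) = idn (hor G) (src (ver G) u)"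
    and tgtv_idnh: "u \<in> arr (ver G) \<Longrightarrow> tgt (sqv G) (idn (sqh G) u) = idn (hor G) (tgt (ver G) u)"
    and idn_idn: "a \<in> obj (hor G) \<Longrightarrow> idn (sqh G) (idn (ver G) a) = idn (sqv G) (idn (hor G) a)"
    and srcv_cmph: "\<lbrakk>\<alpha> \<in> squares G; \<beta> \<in> squares G; src (sqh G) \<alpha> = tgt (sqh G) \<beta>\<rbrakk>
      \<Longrightarrow> src (sqv G) (cmp (sqh G) \<alpha> \<beta>) = cmp (hor G) (src (sqv G) \<alpha>) (src (sqv G) \<beta>)"
    and tgtv_cmph: "\<lbrakk>\<alpha> \<in> squares G; \<beta> \<in> squares G; src (sqh G) \<alpha> = tgt (sqh G) \<beta>\<rbrakk>
      \<Longrightarrow> tgt (sqv G) (cmp (sqh G) \<alpha> \<beta>) = cmp (hor G) (tgt (sqv G) \<alpha>) (tgt (sqv G) \<beta>)"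
    and srch_cmpv: "\<lbrakk>\<alpha> \<in> squares G; \<beta> \<in> squares G; src (sqv G) \<alpha> = tgt (sqv G) \<beta>\<rbrakk>
      \<Longrightarrow> src (sqh G) (cmp (sqv G) \<alpha> \<beta>) = cmp (ver G) (src (sqh G) \<alpha>) (src (sqh G) \<beta>)"
    and tgth_cmpv: "\<lbrakk>\<alpha> \<in> squares G; \<beta> \<in> squares G; src (sqv G) \<alpha> = tgt (sqv G) \<beta>\<rbrakk>
      \<Longrightarrow> tgt (sqh G) (cmp (sqv G) \<alpha> \<beta>) = cmp (ver G) (tgt (sqh G) \<alpha>) (tgt (sqh G) \<beta>)"
    and idnv_cmph: "\<lbrakk>f \<in> arr (hor G); g \<in> arr (hor G); src (hor G) f = tgt (hor G) g\<rbrakk>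
      \<Longrightarrow> idn (sqv G) (cmp (hor G) f g) = cmp (sqh G) (idn (sqv G) f) (idn (sqv G) g)"
    and idnh_cmpv: "\<lbrakk>u \<in> arr (ver G); w \<in> arr (ver G); src (ver G) u = tgt (ver G) w\<rbrakk>
      \<Longrightarrow> idn (sqh G) (cmp (ver G) u w) = cmp (sqv G) (idn (sqh G) u) (idn (sqh G) w)"
    and interchange:
      "\<lbrakk>\<alpha> \<in> squares G; \<beta> \<in> squares G; \<gamma> \<in> squares G; \<delta> \<in> squares G;
        src (sqh G) \<alpha> = tgt (sqh G) \<beta>; src (sqh G) \<gamma> = tgt (sqh G) \<delta>;
        src (sqv G) \<alpha> = tgt (sqv G) \<gamma>; src (sqv G) \<beta> = tgt (sqv G) \<delta>\<rbrakk>
      \<Longrightarrow> cmp (sqv G) (cmp (sqh G) \<alpha> \<beta>) (cmp (sqh G) \<gamma> \<delta>) =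
          cmp (sqh G) (cmp (sqv G) \<alpha> \<gamma>) (cmp (sqv G) \<beta> \<delta>)"

locale double_groupoid = double_category +
  assumes groupoid_hor: "groupoid (hor G)"
    and groupoid_ver: "groupoid (ver G)"
    and groupoid_sqh: "groupoid (sqh G)"
    and groupoid_sqv: "groupoid (sqv G)"

definition filling_condition :: "('o, 'h, 'v, 'c) dcat \<Rightarrow> bool" where
  "filling_condition G \<longleftrightarrow>
     (\<forall>g \<in> arr (hor G). \<forall>u \<in> arr (ver G). src (hor G) g = tgt (ver G) u \<longrightarrow>
        (\<exists>\<alpha> \<in> squares G. src (sqh G) \<alpha> = u \<and> tgt (sqv G) \<alpha> = g))"

record ('o, 'h, 'v, 'c, 'p, 'i, 'w, 'd) dfun =
  on_obj :: "'o \<Rightarrow> 'p"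
  on_hor :: "'h \<Rightarrow> 'i"
  on_ver :: "'v \<Rightarrow> 'w"
  on_sq :: "'c \<Rightarrow> 'd"

text \<open>The components are required to be \<^const>\<open>undefined\<close> outside the carriers of the domain, so
  that equality of records is equality of double functors.\<close>

definition double_functors ::
  "('o, 'h, 'v, 'c) dcat \<Rightarrow> ('p, 'i, 'w, 'd) dcat \<Rightarrow> ('o, 'h, 'v, 'c, 'p, 'i, 'w, 'd) dfun set" where
  "double_functors D G = {F.
     on_obj F \<in> extensional (obj (hor D)) \<and>
     on_hor F \<in> extensional (arr (hor D)) \<and>
     on_ver F \<in> extensional (arr (ver D)) \<and>
     on_sq F \<in> extensional (squares D) \<and>
     is_functor (hor D) (hor G) (on_obj F) (on_hor F) \<and>
     is_functor (ver D) (ver G) (on_obj F) (on_ver F) \<and>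
     is_functor (sqh D) (sqh G) (on_ver F) (on_sq F) \<and>
     is_functor (sqv D) (sqv G) (on_hor F) (on_sq F)}"

text \<open>The composite \<open>F \<circ> E\<close>, where \<open>E\<close> has domain \<open>D\<close>.\<close>

definition dfun_compose ::
  "('o, 'h, 'v, 'c) dcat \<Rightarrow> ('p, 'i, 'w, 'd, 'q, 'j, 'x, 'e) dfun
    \<Rightarrow> ('o, 'h, 'v, 'c, 'p, 'i, 'w, 'd) dfun \<Rightarrow> ('o, 'h, 'v, 'c, 'q, 'j, 'x, 'e) dfun" where
  "dfun_compose D F E =
     \<lparr>on_obj = compose (obj (hor D)) (on_obj F) (on_obj E),
      on_hor = compose (arr (hor D)) (on_hor F) (on_hor E),
      on_ver = compose (arr (ver D)) (on_ver F) (on_ver E),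
      on_sq = compose (squares D) (on_sq F) (on_sq E)\<rparr>"


section \<open>The double categories \<open>A \<otimes> B\<close> and \<open>[p] \<otimes> [q]\<close>\<close>

definition cat_tensor ::
  "('a, 'm) cat \<Rightarrow> ('b, 'n) cat \<Rightarrow> ('a \<times> 'b, 'm \<times> 'b, 'a \<times> 'n, 'm \<times> 'n) dcat" where
  "cat_tensor A B =
     \<lparr>hor = \<lparr>obj = obj A \<times> obj B, arr = arr A \<times> obj B,
             src = (\<lambda>(f, b). (src A f, b)), tgt = (\<lambda>(f, b). (tgt A f, b)),
             idn = (\<lambda>(a, b). (idn A a, b)),
             cmp = (\<lambda>(f, b) (f', b'). (cmp A f f', b))\<rparr>,
      ver = \<lparr>obj = obj A \<times> obj B, arr = obj A \<times> arr B,
             src = (\<lambda>(a, u). (a, src B u)), tgt = (\<lambda>(a, u). (a, tgt B u)),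
             idn = (\<lambda>(a, b). (a, idn B b)),
             cmp = (\<lambda>(a, u) (a', u'). (a, cmp B u u'))\<rparr>,
      sqh = \<lparr>obj = obj A \<times> arr B, arr = arr A \<times> arr B,
             src = (\<lambda>(f, u). (src A f, u)), tgt = (\<lambda>(f, u). (tgt A f, u)),
             idn = (\<lambda>(a, u). (idn A a, u)),
             cmp = (\<lambda>(f, u) (f', u'). (cmp A f f', u))\<rparr>,
      sqv = \<lparr>obj = arr A \<times> obj B, arr = arr A \<times> arr B,
             src = (\<lambda>(f, u). (f, src B u)), tgt = (\<lambda>(f, u). (f, tgt B u)),
             idn = (\<lambda>(f, b). (f, idn B b)),
             cmp = (\<lambda>(f, u) (f', u'). (f, cmp B u u'))\<rparr>\<rparr>"

text \<open>The category \<open>[n]\<close>; the pair \<open>(j, i)\<close> with \<open>i \<le> j\<close> is the unique arrow \<open>j \<rightarrow> i\<close>.\<close>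

definition ord_cat :: "nat \<Rightarrow> (nat, nat \<times> nat) cat" where
  "ord_cat n =
     \<lparr>obj = {..n}, arr = {(j, i). i \<le> j \<and> j \<le> n},
      src = fst, tgt = snd, idn = (\<lambda>i. (i, i)),
      cmp = (\<lambda>f g. (fst g, snd f))\<rparr>"


section \<open>Simplicial sets\<close>

definition ord_maps :: "nat \<Rightarrow> nat \<Rightarrow> (nat \<Rightarrow> nat) set" where
  "ord_maps m n = {\<alpha> \<in> {..m} \<rightarrow>\<^sub>E {..n}. mono_on {..m} \<alpha>}"

definition ord_id :: "nat \<Rightarrow> nat \<Rightarrow> nat" where
  "ord_id n = restrict id {..n}"

definition ord_comp :: "nat \<Rightarrow> (nat \<Rightarrow> nat) \<Rightarrow> (nat \<Rightarrow> nat) \<Rightarrow> nat \<Rightarrow> nat" where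
  "ord_comp l \<alpha> \<beta> = compose {..l} \<alpha> \<beta>"

text \<open>The coface \<open>[n-1] \<rightarrow> [n]\<close> omitting the value \<open>i\<close>, for \<open>n \<ge> 1\<close>.\<close>

definition coface :: "nat \<Rightarrow> nat \<Rightarrow> nat \<Rightarrow> nat" where
  "coface n i = restrict (\<lambda>j. if j < i then j else Suc j) {..n - 1}"

text \<open>\<open>act K m n \<alpha>\<close> is the operator \<open>K\<^sub>n \<rightarrow> K\<^sub>m\<close> induced by \<open>\<alpha> : [m] \<rightarrow> [n]\<close>.\<close>

record 'x sset =
  simplices :: "nat \<Rightarrow> 'x set"
  act :: "nat \<Rightarrow> nat \<Rightarrow> (nat \<Rightarrow> nat) \<Rightarrow> 'x \<Rightarrow> 'x"

locale simplicial_set =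
  fixes K :: "'x sset"
  assumes act_closed: "\<lbrakk>\<alpha> \<in> ord_maps m n; x \<in> simplices K n\<rbrakk> \<Longrightarrow> act K m n \<alpha> x \<in> simplices K m"
    and act_id: "x \<in> simplices K n \<Longrightarrow> act K n n (ord_id n) x = x"
    and act_comp: "\<lbrakk>\<alpha> \<in> ord_maps m n; \<beta> \<in> ord_maps l m; x \<in> simplices K n\<rbrakk>
      \<Longrightarrow> act K l n (ord_comp l \<alpha> \<beta>) x = act K l m \<beta> (act K m n \<alpha> x)"

definition simplicial_map :: "'x sset \<Rightarrow> 'y sset \<Rightarrow> (nat \<Rightarrow> 'x \<Rightarrow> 'y) \<Rightarrow> bool" where
  "simplicial_map K L f \<longleftrightarrow>
     (\<forall>n. \<forall>x \<in> simplices K n. f n x \<in> simplices L n) \<and>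
     (\<forall>m n. \<forall>\<alpha> \<in> ord_maps m n. \<forall>x \<in> simplices K n. f m (act K m n \<alpha> x) = act L m n \<alpha> (f n x))"

definition std_simplex :: "nat \<Rightarrow> (nat \<Rightarrow> nat) sset" where
  "std_simplex n = \<lparr>simplices = (\<lambda>m. ord_maps m n), act = (\<lambda>l m \<alpha> x. ord_comp l x \<alpha>)\<rparr>"

text \<open>The simplicial subset generated by a family of simplices, each given with its dimension.\<close>

definition sset_generated :: "'x sset \<Rightarrow> (nat \<times> 'x) set \<Rightarrow> 'x sset" where
  "sset_generated K S =
     K\<lparr>simplices := (\<lambda>m. {act K m n \<alpha> x | n \<alpha> x. (n, x) \<in> S \<and> \<alpha> \<in> ord_maps m n})\<rparr>"

definition horn :: "nat \<Rightarrow> nat \<Rightarrow> (nat \<Rightarrow> nat) sset" where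
  "horn n k = sset_generated (std_simplex n) {(n - 1, coface n i) | i. i \<le> n \<and> i \<noteq> k}"

locale kan_complex = simplicial_set +
  assumes horn_filling: "\<lbrakk>1 \<le> n; k \<le> n; simplicial_map (horn n k) K f\<rbrakk>
    \<Longrightarrow> \<exists>g. simplicial_map (std_simplex n) K g \<and>
          (\<forall>m. \<forall>x \<in> simplices (horn n k) m. g m x = f m x)"


section \<open>Bisimplicial sets\<close>

text \<open>\<open>biact K m p n q \<alpha> \<beta>\<close> is the operator \<open>K\<^sub>p\<^sub>,\<^sub>q \<rightarrow> K\<^sub>m\<^sub>,\<^sub>n\<close> induced by
  \<open>\<alpha> : [m] \<rightarrow> [p]\<close> and \<open>\<beta> : [n] \<rightarrow> [q]\<close>; the first index is the horizontal one.\<close>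

record 'x bisset =
  bisimplices :: "nat \<Rightarrow> nat \<Rightarrow> 'x set"
  biact :: "nat \<Rightarrow> nat \<Rightarrow> nat \<Rightarrow> nat \<Rightarrow> (nat \<Rightarrow> nat) \<Rightarrow> (nat \<Rightarrow> nat) \<Rightarrow> 'x \<Rightarrow> 'x"

locale bisimplicial_set =
  fixes K :: "'x bisset"
  assumes biact_closed: "\<lbrakk>\<alpha> \<in> ord_maps m p; \<beta> \<in> ord_maps n q; x \<in> bisimplices K p q\<rbrakk>
      \<Longrightarrow> biact K m p n q \<alpha> \<beta> x \<in> bisimplices K m n"
    and biact_id: "x \<in> bisimplices K p q \<Longrightarrow> biact K p p q q (ord_id p) (ord_id q) x = x"
    and biact_comp:
      "\<lbrakk>\<alpha> \<in> ord_maps m p; \<beta> \<in> ord_maps n q; \<alpha>' \<in> ord_maps k m; \<beta>' \<in> ord_maps l n;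
        x \<in> bisimplices K p q\<rbrakk>
      \<Longrightarrow> biact K k p l q (ord_comp k \<alpha> \<alpha>') (ord_comp l \<beta> \<beta>') x =
          biact K k m l n \<alpha>' \<beta>' (biact K m p n q \<alpha> \<beta> x)"

definition bisimplicial_map :: "'x bisset \<Rightarrow> 'y bisset \<Rightarrow> (nat \<Rightarrow> nat \<Rightarrow> 'x \<Rightarrow> 'y) \<Rightarrow> bool" where
  "bisimplicial_map K L f \<longleftrightarrow>
     (\<forall>p q. \<forall>x \<in> bisimplices K p q. f p q x \<in> bisimplices L p q) \<and>
     (\<forall>m p n q. \<forall>\<alpha> \<in> ord_maps m p. \<forall>\<beta> \<in> ord_maps n q. \<forall>x \<in> bisimplices K p q.
        f m n (biact K m p n q \<alpha> \<beta> x) = biact L m p n q \<alpha> \<beta> (f p q x))"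

text \<open>The simplicial sets \<open>K\<^sub>p\<^sub>,\<^sub>*\<close>, \<open>K\<^sub>*\<^sub>,\<^sub>q\<close> and the diagonal.\<close>

definition fix_first :: "'x bisset \<Rightarrow> nat \<Rightarrow> 'x sset" where
  "fix_first K p =
     \<lparr>simplices = (\<lambda>n. bisimplices K p n), act = (\<lambda>m n \<beta>. biact K p p m n (ord_id p) \<beta>)\<rparr>"

definition fix_second :: "'x bisset \<Rightarrow> nat \<Rightarrow> 'x sset" where
  "fix_second K q =
     \<lparr>simplices = (\<lambda>n. bisimplices K n q), act = (\<lambda>m n \<alpha>. biact K m n q q \<alpha> (ord_id q))\<rparr>"

definition diag :: "'x bisset \<Rightarrow> 'x sset" where
  "diag K =
     \<lparr>simplices = (\<lambda>n. bisimplices K n n), act = (\<lambda>m n \<alpha>. biact K m n m n \<alpha> \<alpha>)\<rparr>"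

definition std_bisimplex :: "nat \<Rightarrow> nat \<Rightarrow> ((nat \<Rightarrow> nat) \<times> (nat \<Rightarrow> nat)) bisset" where
  "std_bisimplex p q =
     \<lparr>bisimplices = (\<lambda>m n. ord_maps m p \<times> ord_maps n q),
      biact = (\<lambda>k m l n \<alpha> \<beta> (x, y). (ord_comp k x \<alpha>, ord_comp l y \<beta>))\<rparr>"

definition bisset_generated :: "'x bisset \<Rightarrow> (nat \<times> nat \<times> 'x) set \<Rightarrow> 'x bisset" where
  "bisset_generated K S =
     K\<lparr>bisimplices := (\<lambda>m n. {biact K m p n q \<alpha> \<beta> x | p q \<alpha> \<beta> x.
        (p, q, x) \<in> S \<and> \<alpha> \<in> ord_maps m p \<and> \<beta> \<in> ord_maps n q})\<rparr>"

definition bihorn ::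
  "nat \<Rightarrow> nat \<Rightarrow> nat \<Rightarrow> nat \<Rightarrow> ((nat \<Rightarrow> nat) \<times> (nat \<Rightarrow> nat)) bisset" where
  "bihorn p q k l = bisset_generated (std_bisimplex p q)
     ({(p - 1, q, (coface p i, ord_id q)) | i. i \<le> p \<and> i \<noteq> k} \<union>
      {(p, q - 1, (ord_id p, coface q j)) | j. j \<le> q \<and> j \<noteq> l})"

locale extension_condition = bisimplicial_set +
  assumes kan_fix_first: "kan_complex (fix_first K p)"
    and kan_fix_second: "kan_complex (fix_second K q)"
    and bihorn_filling:
      "\<lbrakk>1 \<le> p; 1 \<le> q; k \<le> p; l \<le> q; bisimplicial_map (bihorn p q k l) K f\<rbrakk>
      \<Longrightarrow> \<exists>g. bisimplicial_map (std_bisimplex p q) K g \<and>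
            (\<forall>m n. \<forall>x \<in> bisimplices (bihorn p q k l) m n. g m n x = f m n x)"


section \<open>The double nerve\<close>

text \<open>The double functor \<open>\<alpha> \<otimes> \<beta> : [m] \<otimes> [n] \<rightarrow> [p] \<otimes> [q]\<close> induced by \<open>\<alpha> : [m] \<rightarrow> [p]\<close> and
  \<open>\<beta> : [n] \<rightarrow> [q]\<close>. Its values outside \<open>[m] \<otimes> [n]\<close> are irrelevant, since it is only used
  through \<^const>\<open>dfun_compose\<close>.\<close>

definition ord_tensor where
  "ord_tensor \<alpha> \<beta> =
     \<lparr>on_obj = map_prod \<alpha> \<beta>,
      on_hor = map_prod (map_prod \<alpha> \<alpha>) \<beta>,
      on_ver = map_prod \<alpha> (map_prod \<beta> \<beta>),
      on_sq = map_prod (map_prod \<alpha> \<alpha>) (map_prod \<beta> \<beta>)\<rparr>"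

definition double_nerve ::
  "('o, 'h, 'v, 'c) dcat \<Rightarrow>
    (nat \<times> nat, (nat \<times> nat) \<times> nat, nat \<times> (nat \<times> nat), (nat \<times> nat) \<times> (nat \<times> nat),
      'o, 'h, 'v, 'c) dfun bisset" where
  "double_nerve G =
     \<lparr>bisimplices = (\<lambda>p q. double_functors (cat_tensor (ord_cat p) (ord_cat q)) G),
      biact = (\<lambda>m p n q \<alpha> \<beta> F.
        dfun_compose (cat_tensor (ord_cat m) (ord_cat n)) F (ord_tensor \<alpha> \<beta>))\<rparr>"

end

theory Submission
  imports Defs
begin

text \<open>Double functors \<open>[p] \<otimes> [q] \<rightarrow> \<G>\<close> are grids of squares \<open>F a b c d\<close>, functorial in the columns \<open>b \<rightarrow> a\<close> and in
  the rows \<open>d \<rightarrow> c\<close>; all the extension properties say that compatible grids on certain rectangles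
  \<open>I \<times> J\<close> of indices extend to a grid on the full rectangle. All these rectangles contain a common base
  point \<open>(k, l)\<close>. In a double groupoid a grid extends to indices in any order, and it is then freely
  determined by the squares \<open>F k a l c\<close>, which only share the edges through the base point. So the
  squares lying in one of the given rectangles determine the extension, and the missing ones are
  supplied by the filling condition.

  Conversely, a horn in the bisimplicial direction directly yields right inverses. For the diagonal,
  inner 2-horns yield the filling condition and a 3-horn, one face of which comes from an outer 2-horn,
  yields right inverses.\<close>

section \<open>Chains in categories and groupoids\<close>

text \<open>With \<open>(\<le>)\<close> alone, a base point in the middle of \<open>{..p}\<close>
  meets arrows in both directions, and inner horns, outer horns and bihorns would each need their
  own argument. Once inverses are adjoined all indices are alike, and every family of rectangles
  through \<open>(k, l)\<close> is treated at once. The squares at the base point share only edges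
  through it, so these edges are chosen first and each missing square is then filled separately.

  Cofaces are injective, so a face can be indexed by the vertices it contains, and two faces have in
  common exactly the squares over the intersection of their rectangles. On the diagonal one operator
  acts on columns and rows at once, so it is not evident that compatible simplices agree square by
  square; \<open>edges_factor\<close> closes this gap.

  In the converse, a diagonal 2-horn carrying a square and an identity only makes a 2 by 2 block of
  cells compose to an identity, which inverts nothing. The 3-horn keeps columns \<open>0, 1\<close>
  and varies the rows among \<open>1, 2, 3\<close>, so that a purely vertical composite is
  controlled.\<close>

context category
begin

lemma cmp_idn_left': "f \<in> arr A \<Longrightarrow> tgt A f = a \<Longrightarrow> cmp A (idn A a) f = f"
  using cmp_idn_left by auto

lemma cmp_idn_right': "f \<in> arr A \<Longrightarrow> src A f = a \<Longrightarrow> cmp A f (idn A a) = f"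
  using cmp_idn_right by auto

text \<open>If \<open>h\<close> is a right inverse of a right inverse \<open>g\<close> of
  \<open>f\<close>, then \<open>h = (f g) h = f (g h) = f\<close>, so \<open>g\<close> is two-sided.
  Horns therefore have to supply right inverses only.\<close>

lemma groupoid_if_right_inverses:
  assumes "\<And>f. f \<in> arr A \<Longrightarrow>
    \<exists>g \<in> arr A. tgt A g = src A f \<and> cmp A f g = idn A (tgt A f)"
  shows "groupoid A"
proof
  fix f assume f: "f \<in> arr A"
  obtain g where g: "g \<in> arr A" "tgt A g = src A f" "cmp A f g = idn A (tgt A f)"
    using assms[OF f] by blast
  obtain h where h: "h \<in> arr A" "tgt A h = src A g" "cmp A g h = idn A (tgt A g)"
    using assms[OF g(1)] by blast
  \<comment> \<open>The hypothesis leaves the source of \<open>g\<close> open; it is read off the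
    composite \<open>f g\<close>, which is an identity.\<close>
  have sg: "src A g = tgt A f"
    using src_cmp[OF f g(1)] g src_idn tgt_obj f by metis
  have "h = cmp A (cmp A f g) h"
    using cmp_idn_left'[OF h(1)] h g sg by simp
  also have "\<dots> = cmp A f (cmp A g h)" using cmp_assoc[of f g h] f g h by simp
  also have "\<dots> = f" using cmp_idn_right'[OF f] g h by simp
  finally have "cmp A g f = idn A (src A f)" using h g by simp
  then show "\<exists>g \<in> arr A. src A g = tgt A f \<and> tgt A g = src A f \<and>
      cmp A g f = idn A (src A f) \<and> cmp A f g = idn A (tgt A f)"
    using g sg by blast
qed

end

definition ginv :: "('o, 'm) cat \<Rightarrow> 'm \<Rightarrow> 'm" where
  "ginv A f = (SOME g. g \<in> arr A \<and> src A g = tgt A f \<and> tgt A g = src A f \<and>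
      cmp A g f = idn A (src A f) \<and> cmp A f g = idn A (tgt A f))"

context groupoid
begin

lemma ginv:
  assumes "f \<in> arr A"
  shows ginv_arr: "ginv A f \<in> arr A" and src_ginv: "src A (ginv A f) = tgt A f"
    and tgt_ginv: "tgt A (ginv A f) = src A f"
    and ginv_cmp: "cmp A (ginv A f) f = idn A (src A f)"
    and cmp_ginv: "cmp A f (ginv A f) = idn A (tgt A f)"
proof -
  have "\<exists>g. g \<in> arr A \<and> src A g = tgt A f \<and> tgt A g = src A f \<and>
      cmp A g f = idn A (src A f) \<and> cmp A f g = idn A (tgt A f)"
    using inverse_exists[OF assms] by blast
  from someI_ex[OF this] show "ginv A f \<in> arr A" "src A (ginv A f) = tgt A f"
    "tgt A (ginv A f) = src A f" "cmp A (ginv A f) f = idn A (src A f)"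
    "cmp A f (ginv A f) = idn A (tgt A f)"
    unfolding ginv_def by auto
qed

lemma ginv_cmp_cancel:
  assumes "f \<in> arr A" "g \<in> arr A" "src A f = tgt A g"
  shows "cmp A (ginv A f) (cmp A f g) = g"
  using cmp_assoc[of "ginv A f" f g] assms ginv[OF assms(1)] cmp_idn_left' by simp

lemma cmp_ginv_cancel:
  assumes "f \<in> arr A" "g \<in> arr A" "tgt A f = tgt A g"
  shows "cmp A f (cmp A (ginv A f) g) = g"
  using cmp_assoc[of f "ginv A f" g] assms ginv[OF assms(1)] cmp_idn_left' by simp

lemma ginv_unique:
  assumes "f \<in> arr A" "g \<in> arr A" "tgt A g = src A f" "cmp A f g = idn A (tgt A f)"
  shows "g = ginv A f"
  using ginv_cmp_cancel[of f g] assms cmp_idn_right'[of "ginv A f"] ginv[OF assms(1)] by simp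

lemma ginv_ginv: "f \<in> arr A \<Longrightarrow> ginv A (ginv A f) = f"
  using ginv_unique[of "ginv A f" f] ginv by simp

end

text \<open>A \<open>chain\<close> is a functor to \<open>A\<close> from the category with objects \<open>I\<close> and exactly one arrow
  \<open>b \<rightarrow> a\<close> whenever \<open>R a b\<close>. Only \<open>(\<le>)\<close> and the everywhere relation are used as \<open>R\<close>.\<close>

definition chain :: "('o, 'm) cat \<Rightarrow> (nat \<Rightarrow> nat \<Rightarrow> bool) \<Rightarrow> nat set \<Rightarrow> (nat \<Rightarrow> nat \<Rightarrow> 'm) \<Rightarrow> bool" where
  "chain A R I f \<longleftrightarrow>
     (\<forall>a\<in>I. \<forall>b\<in>I. R a b \<longrightarrow> f a b \<in> arr A) \<and>
     (\<forall>a\<in>I. R a a \<longrightarrow> f a a = idn A (tgt A (f a a))) \<and>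
     (\<forall>a\<in>I. \<forall>b\<in>I. \<forall>c\<in>I. R a b \<longrightarrow> R b c \<longrightarrow>
        src A (f a b) = tgt A (f b c) \<and> f a c = cmp A (f a b) (f b c))"

abbreviation everywhere :: "nat \<Rightarrow> nat \<Rightarrow> bool" where "everywhere \<equiv> (\<lambda>_ _. True)"

lemma chainD:
  assumes "chain A R I f"
  shows chain_arr: "\<lbrakk>a \<in> I; b \<in> I; R a b\<rbrakk> \<Longrightarrow> f a b \<in> arr A"
    and chain_idn: "\<lbrakk>a \<in> I; R a a\<rbrakk> \<Longrightarrow> f a a = idn A (tgt A (f a a))"
    and chain_src: "\<lbrakk>a \<in> I; b \<in> I; c \<in> I; R a b; R b c\<rbrakk> \<Longrightarrow> src A (f a b) = tgt A (f b c)"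
    and chain_cmp: "\<lbrakk>a \<in> I; b \<in> I; c \<in> I; R a b; R b c\<rbrakk> \<Longrightarrow> f a c = cmp A (f a b) (f b c)"
  using assms unfolding chain_def by blast+

lemma chain_pullback:
  assumes "chain A R I f" "x \<in> I' \<rightarrow> I" "\<And>a b. \<lbrakk>a \<in> I'; b \<in> I'; R' a b\<rbrakk> \<Longrightarrow> R (x a) (x b)"
  shows "chain A R' I' (\<lambda>a b. f (x a) (x b))"
proof -
  have "x a \<in> I" if "a \<in> I'" for a using that assms(2) by auto
  then show ?thesis using assms(1,3) unfolding chain_def by (intro conjI ballI impI) blast+
qed

text \<open>Only the arrow part of a functor is given; its object part is hidden in the targets of
  the images of identities. This suits boundary maps, \<open>idn\<close> and \<open>ginv\<close>
  alike.\<close>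

lemma chain_map:
  assumes "chain A R I f"
    and "\<And>g. g \<in> arr A \<Longrightarrow> \<phi> g \<in> arr B"
    and "\<And>a. a \<in> obj A \<Longrightarrow> \<phi> (idn A a) = idn B (tgt B (\<phi> (idn A a)))"
    and "\<And>g h. \<lbrakk>g \<in> arr A; h \<in> arr A; src A g = tgt A h\<rbrakk> \<Longrightarrow>
      src B (\<phi> g) = tgt B (\<phi> h) \<and> \<phi> (cmp A g h) = cmp B (\<phi> g) (\<phi> h)"
    and "category A"
  shows "chain B R I (\<lambda>a b. \<phi> (f a b))"
proof -
  have "\<phi> (f a a) = idn B (tgt B (\<phi> (f a a)))" if "a \<in> I" "R a a" for a
    using assms(3)[of "tgt A (f a a)"] chain_idn[OF assms(1) that] chain_arr[OF assms(1)] that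
      category.tgt_obj[OF assms(5)] by metis
  moreover have "src B (\<phi> (f a b)) = tgt B (\<phi> (f b c)) \<and>
      \<phi> (f a c) = cmp B (\<phi> (f a b)) (\<phi> (f b c))"
    if "a \<in> I" "b \<in> I" "c \<in> I" "R a b" "R b c" for a b c
    using assms(4) chain_arr[OF assms(1)] chain_src[OF assms(1) that] chain_cmp[OF assms(1) that] that
    by simp
  ultimately show ?thesis using assms(2) chain_arr[OF assms(1)] unfolding chain_def
    by (intro conjI ballI impI) blast+
qed

context groupoid
begin

text \<open>An arrow against the order is the inverse of its reverse. The composition law for any
  triple of indices follows from the law for the sorted triple by cancelling.\<close>

lemma chain_symmetrize:
  assumes "chain A (\<le>) I f"
  shows "chain A everywhere I (\<lambda>a b. if a \<le> b then f a b else ginv A (f b a))"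
proof -
  note f = chainD[OF assms]
  have *: "f a b \<in> arr A" "src A (f a b) = tgt A (f b b)" "tgt A (f a b) = tgt A (f a a)"
    if "a \<in> I" "b \<in> I" "a \<le> b" for a b
  proof -
    show "f a b \<in> arr A" "src A (f a b) = tgt A (f b b)" using f(1)[of a b] f(3)[of a b b] that by auto
    have "src A (f a a) = tgt A (f a a)"
      using f(1)[of a a] f(2)[of a] src_idn[of "tgt A (f a a)"] tgt_obj that by simp
    then show "tgt A (f a b) = tgt A (f a a)" using f(3)[of a a b] that by simp
  qed
  define g where "g a b = (if a \<le> b then f a b else ginv A (f b a))" for a b
  have g1: "g a b \<in> arr A" "src A (g a b) = tgt A (f b b)" "tgt A (g a b) = tgt A (f a a)"
    if "a \<in> I" "b \<in> I" for a b
    using *[OF that] *[of b a] that ginv unfolding g_def by auto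
  have g2: "g a c = cmp A (g a b) (g b c)" if abc: "a \<in> I" "b \<in> I" "c \<in> I" for a b c
  proof -
    have idg: "g b b = idn A (tgt A (f b b))" if "b \<in> I" for b
      using f(2)[of b] that unfolding g_def by simp
    have inv: "cmp A (g a b) (g b a) = g a a" if "a \<in> I" "b \<in> I" for a b
    proof (cases "a = b")
      case True
      then show ?thesis using idg[of b] cmp_idn_left'[of "g b b"] g1[of b b] that by simp
    next
      case False
      then show ?thesis
        using idg that *[of a b] *[of b a] ginv[of "f a b"] ginv[of "f b a"]
        unfolding g_def by auto
    qed
    have pos: "g a c = cmp A (g a b) (g b c)" if "a \<in> I" "b \<in> I" "c \<in> I" "a \<le> b" "b \<le> c" for a b c
      using f(4)[of a b c] that unfolding g_def by auto
    \<comment> \<open>\<open>c1\<close> carries the law from \<open>(a, b, c)\<close> to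
      \<open>(b, a, c)\<close>, and \<open>c2\<close> to \<open>(a, c, b)\<close>. These two
      exchanges reach all six orders from the increasing one.\<close>
    have c1: "g b c = cmp A (g b a) (g a c)"
      if "a \<in> I" "b \<in> I" "c \<in> I" "g a c = cmp A (g a b) (g b c)" for a b c
    proof -
      have "cmp A (g b a) (g a c) = cmp A (cmp A (g b a) (g a b)) (g b c)"
        using cmp_assoc[of "g b a" "g a b" "g b c"] that g1 by simp
      also have "\<dots> = g b c"
        using inv[of b a] idg[of b] cmp_idn_left' that g1 by simp
      finally show ?thesis by simp
    qed
    have c2: "g a b = cmp A (g a c) (g c b)"
      if "a \<in> I" "b \<in> I" "c \<in> I" "g a c = cmp A (g a b) (g b c)" for a b c
    proof -
      have "cmp A (g a c) (g c b) = cmp A (g a b) (cmp A (g b c) (g c b))"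
        using cmp_assoc[of "g a b" "g b c" "g c b"] that g1 by simp
      also have "\<dots> = g a b"
        using inv[of b c] idg[of b] cmp_idn_right' that g1 by simp
      finally show ?thesis by simp
    qed
    consider "a \<le> b" "b \<le> c" | "a \<le> c" "c \<le> b" | "b \<le> a" "a \<le> c" | "b \<le> c" "c \<le> a"
      | "c \<le> a" "a \<le> b" | "c \<le> b" "b \<le> a" by linarith
    then show ?thesis
    proof cases
      case 1 then show ?thesis using pos abc by blast
    next
      case 2
      then show ?thesis using c2[of a c b] pos[of a c b] abc by blast
    next
      case 3
      then show ?thesis using c1[of b a c] pos[of b a c] abc by blast
    next
      case 4
      then show ?thesis using c1[of b a c] c2[of b a c] pos[of b c a] c2[of b c a] abc by blast
    next
      case 5
      then show ?thesis using c2[of a c b] c1[of c a b] pos[of c a b] abc by blast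
    next
      case 6
      then show ?thesis using c1[of b a c] c2[of b a c] c1[of c b a] pos[of c b a] c2[of b c a] abc by blast
    qed
  qed
  have "chain A everywhere I g"
    unfolding chain_def
  proof (intro conjI ballI impI)
    fix a assume "a \<in> I"
    then show "g a a = idn A (tgt A (g a a))" using f(2)[of a] unfolding g_def by simp
  next
    fix a b c assume abc: "a \<in> I" "b \<in> I" "c \<in> I"
    show "src A (g a b) = tgt A (g b c)" using g1 abc by simp
    show "g a c = cmp A (g a b) (g b c)" using g2 abc by blast
  qed (use g1 in blast)
  then show ?thesis unfolding g_def .
qed

text \<open>The composites telescope: \<open>s b\<close> cancels against its inverse. A common
  target is the only relation between the arrows \<open>s a\<close>.\<close>

lemma chain_of_cocone:
  assumes "\<And>a. a \<in> I \<Longrightarrow> s a \<in> arr A" "\<And>a. a \<in> I \<Longrightarrow> tgt A (s a) = t"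
  shows "chain A everywhere I (\<lambda>a b. cmp A (ginv A (s a)) (s b))"
proof -
  have *: "cmp A (ginv A (s a)) (s b) \<in> arr A" "src A (cmp A (ginv A (s a)) (s b)) = src A (s b)"
    "tgt A (cmp A (ginv A (s a)) (s b)) = src A (s a)"
    if "a \<in> I" "b \<in> I" for a b
    using that assms ginv cmp_arr src_cmp tgt_cmp by simp_all
  have "cmp A (ginv A (s a)) (s c) = cmp A (cmp A (ginv A (s a)) (s b)) (cmp A (ginv A (s b)) (s c))"
    if "a \<in> I" "b \<in> I" "c \<in> I" for a b c
    using that assms ginv * cmp_assoc[of "ginv A (s a)" "s b" "cmp A (ginv A (s b)) (s c)"]
      cmp_ginv_cancel[of "s b" "s c"] by simp
  moreover have "cmp A (ginv A (s a)) (s a) = idn A (tgt A (cmp A (ginv A (s a)) (s a)))" if "a \<in> I" for a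
    using ginv assms that tgt_idn src_obj by simp
  ultimately show ?thesis using * unfolding chain_def by (simp (no_asm_simp) only: simp_thms) metis
qed

text \<open>The uniqueness half: a total chain carries no more information than its arrows into one
  index \<open>k\<close>, and is rebuilt from them as in \<open>chain_of_cocone\<close>.\<close>

lemma chain_total_eq_cocone:
  assumes "chain A everywhere I f" "k \<in> I" "a \<in> I" "b \<in> I"
  shows "f a b = cmp A (ginv A (f k a)) (f k b)"
  using ginv_cmp_cancel[of "f k a" "f a b"] chain_arr[OF assms(1), of k a] chain_arr[OF assms(1), of a b]
    chain_src[OF assms(1), of k a b] chain_cmp[OF assms(1), of k a b] assms(2-) by simp

end

section \<open>Grids of squares\<close>

text \<open>Exchanges the two directions, so that a result singling out one of them also yields its
  mirror image.\<close>

definition transpose :: "('o, 'h, 'v, 'c) dcat \<Rightarrow> ('o, 'v, 'h, 'c) dcat" where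
  "transpose G = \<lparr>hor = ver G, ver = hor G, sqh = sqv G, sqv = sqh G\<rparr>"

lemma transpose_simps [simp]:
  "hor (transpose G) = ver G" "ver (transpose G) = hor G"
  "sqh (transpose G) = sqv G" "sqv (transpose G) = sqh G"
  by (simp_all add: transpose_def)

context double_category
begin

lemma double_category_transpose: "double_category (transpose G)"
  by (rule double_category.intro; unfold transpose_simps arr_sqv obj_ver)
    (simp_all add: category_hor category_ver category_sqh category_sqv obj_ver obj_sqh obj_sqv
      src_src tgt_tgt src_tgt tgt_src srch_idnv tgth_idnv srcv_idnh tgtv_idnh idn_idn
      srcv_cmph tgtv_cmph srch_cmpv tgth_cmpv idnv_cmph idnh_cmpv interchange)

sublocale hor: category "hor G" by (rule category_hor)
sublocale ver: category "ver G" by (rule category_ver)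
sublocale sqh: category "sqh G" by (rule category_sqh)
sublocale sqv: category "sqv G" by (rule category_sqv)

lemma boundary_arr:
  assumes "\<alpha> \<in> squares G"
  shows "src (sqh G) \<alpha> \<in> arr (ver G)" "tgt (sqh G) \<alpha> \<in> arr (ver G)"
    "src (sqv G) \<alpha> \<in> arr (hor G)" "tgt (sqv G) \<alpha> \<in> arr (hor G)"
  using assms sqh.src_obj sqh.tgt_obj sqv.src_obj sqv.tgt_obj by (simp_all add: obj_sqh obj_sqv arr_sqv)

lemma idnv_square: "f \<in> arr (hor G) \<Longrightarrow> idn (sqv G) f \<in> squares G"
  using sqv.idn_arr[of f] by (simp add: obj_sqv arr_sqv)

lemma idnh_square: "u \<in> arr (ver G) \<Longrightarrow> idn (sqh G) u \<in> squares G"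
  using sqh.idn_arr[of u] by (simp add: obj_sqh)

text \<open>Inverses of edges come from squares: a right inverse of the identity square on
  \<open>f\<close> has a right inverse of \<open>f\<close> as its boundary edge.\<close>

lemma double_groupoid_if_right_inverses:
  assumes "\<And>\<alpha>. \<alpha> \<in> squares G \<Longrightarrow>
      \<exists>\<beta>\<in>squares G. tgt (sqh G) \<beta> = src (sqh G) \<alpha> \<and> cmp (sqh G) \<alpha> \<beta> = idn (sqh G) (tgt (sqh G) \<alpha>)"
    and "\<And>\<alpha>. \<alpha> \<in> squares G \<Longrightarrow>
      \<exists>\<beta>\<in>squares G. tgt (sqv G) \<beta> = src (sqv G) \<alpha> \<and> cmp (sqv G) \<alpha> \<beta> = idn (sqv G) (tgt (sqv G) \<alpha>)"
  shows "double_groupoid G"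
proof (intro double_groupoid.intro double_groupoid_axioms.intro)
  show "double_category G" by (rule double_category_axioms)
  \<comment> \<open>Stated for an arbitrary double category with fresh types, so that its instance
    at the transpose handles the vertical edges.\<close>
  have aux: "groupoid (hor G)" if "double_category G" and inv:
    "\<And>\<alpha>. \<alpha> \<in> squares G \<Longrightarrow>
      \<exists>\<beta>\<in>squares G. tgt (sqh G) \<beta> = src (sqh G) \<alpha> \<and> cmp (sqh G) \<alpha> \<beta> = idn (sqh G) (tgt (sqh G) \<alpha>)"
    for G :: "('x, 'y, 'z, 'w) dcat"
  proof -
    interpret D: double_category G by fact
    show ?thesis
    proof (rule D.hor.groupoid_if_right_inverses)
      fix f assume f: "f \<in> arr (hor G)"
      obtain \<beta> where \<beta>: "\<beta> \<in> squares G" "tgt (sqh G) \<beta> = src (sqh G) (idn (sqv G) f)"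
        "cmp (sqh G) (idn (sqv G) f) \<beta> = idn (sqh G) (tgt (sqh G) (idn (sqv G) f))"
        using inv D.idnv_square[OF f] by blast
      have "src (hor G) f \<in> obj (hor G)" "tgt (hor G) f \<in> obj (hor G)"
        using f D.hor.src_obj D.hor.tgt_obj by auto
      then have o: "src (hor G) f \<in> obj (ver G)" "tgt (hor G) f \<in> obj (ver G)"
        by (simp_all add: D.obj_ver)
      have "tgt (hor G) (tgt (sqv G) \<beta>) = src (hor G) f"
        using D.tgt_tgt[OF \<beta>(1)] \<beta>(2) D.srch_idnv[OF f] D.ver.tgt_idn o by simp
      moreover have "cmp (hor G) f (tgt (sqv G) \<beta>) = idn (hor G) (tgt (hor G) f)"
        using D.tgtv_cmph[OF D.idnv_square[OF f] \<beta>(1)] \<beta> D.tgth_idnv[OF f] D.sqv.tgt_idn[of f]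
          D.tgtv_idnh[of "idn (ver G) (tgt (hor G) f)"] o D.ver.idn_arr D.ver.tgt_idn f
        by (simp add: D.obj_sqv)
      ultimately show "\<exists>g\<in>arr (hor G). tgt (hor G) g = src (hor G) f \<and>
          cmp (hor G) f g = idn (hor G) (tgt (hor G) f)"
        using D.boundary_arr[OF \<beta>(1)] by blast
    qed
  qed
  show "groupoid (hor G)" using aux[OF double_category_axioms] assms(1) by blast
  show "groupoid (ver G)"
    using aux[OF double_category_transpose] assms(2) by (simp add: arr_sqv)
  show "groupoid (sqh G)" using sqh.groupoid_if_right_inverses assms(1) by blast
  show "groupoid (sqv G)" using sqv.groupoid_if_right_inverses assms(2) by (simp add: arr_sqv)
qed

end

text \<open>Only squares are recorded. Edges and vertices reappear as boundaries of the squares with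
  \<open>a = b\<close> or \<open>c = d\<close>, which the chain laws force to be identities.\<close>

definition grid :: "('o, 'h, 'v, 'c) dcat \<Rightarrow> (nat \<Rightarrow> nat \<Rightarrow> bool) \<Rightarrow> (nat \<Rightarrow> nat \<Rightarrow> bool) \<Rightarrow>
    nat set \<Rightarrow> nat set \<Rightarrow> (nat \<Rightarrow> nat \<Rightarrow> nat \<Rightarrow> nat \<Rightarrow> 'c) \<Rightarrow> bool" where
  "grid G R Q I J F \<longleftrightarrow>
     (\<forall>c\<in>J. \<forall>d\<in>J. Q c d \<longrightarrow> chain (sqh G) R I (\<lambda>a b. F a b c d)) \<and>
     (\<forall>a\<in>I. \<forall>b\<in>I. R a b \<longrightarrow> chain (sqv G) Q J (F a b))"

lemma gridD:
  assumes "grid G R Q I J F"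
  shows grid_chain_h: "\<lbrakk>c \<in> J; d \<in> J; Q c d\<rbrakk> \<Longrightarrow> chain (sqh G) R I (\<lambda>a b. F a b c d)"
    and grid_chain_v: "\<lbrakk>a \<in> I; b \<in> I; R a b\<rbrakk> \<Longrightarrow> chain (sqv G) Q J (F a b)"
  using assms unfolding grid_def by auto

lemma grid_transpose:
  assumes "grid G R Q I J F"
  shows "grid (transpose G) Q R J I (\<lambda>c d a b. F a b c d)"
  using assms unfolding grid_def by simp

text \<open>The index maps may collapse indices: this is how degenerate faces of horns are made out
  of a single square.\<close>

lemma grid_pullback:
  assumes "grid G R Q I J F" "x \<in> I' \<rightarrow> I" "y \<in> J' \<rightarrow> J"
    "\<And>a b. \<lbrakk>a \<in> I'; b \<in> I'; R' a b\<rbrakk> \<Longrightarrow> R (x a) (x b)"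
    "\<And>a b. \<lbrakk>a \<in> J'; b \<in> J'; Q' a b\<rbrakk> \<Longrightarrow> Q (y a) (y b)"
  shows "grid G R' Q' I' J' (\<lambda>a b c d. F (x a) (x b) (y c) (y d))"
proof -
  have x: "x a \<in> I" if "a \<in> I'" for a using assms(2) that by auto
  have y: "y a \<in> J" if "a \<in> J'" for a using assms(3) that by auto
  show ?thesis
    unfolding grid_def
  proof (intro conjI ballI impI)
    fix c d assume "c \<in> J'" "d \<in> J'" "Q' c d"
    then show "chain (sqh G) R' I' (\<lambda>a b. F (x a) (x b) (y c) (y d))"
      using chain_pullback[OF grid_chain_h[OF assms(1) y y assms(5)] assms(2,4)] by blast
  next
    fix a b assume "a \<in> I'" "b \<in> I'" "R' a b"
    then show "chain (sqv G) Q' J' (\<lambda>c d. F (x a) (x b) (y c) (y d))"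
      using chain_pullback[OF grid_chain_v[OF assms(1) x x assms(4)] assms(3,5)] by blast
  qed
qed

context double_category
begin

lemma grid_square:
  assumes "grid G R Q I J F" "a \<in> I" "b \<in> I" "c \<in> J" "d \<in> J" "R a b" "Q c d"
  shows "F a b c d \<in> squares G"
  using chain_arr[OF grid_chain_h[OF assms(1)]] assms by blast

lemma chain_tgt:
  assumes "category A" "chain A R I f" "a \<in> I" "b \<in> I" "R a b" "R a a"
  shows "tgt A (f a b) = tgt A (f a a)"
proof -
  have "src A (f a a) = tgt A (f a a)"
    using chain_arr[OF assms(2,3,3,6)] chain_idn[OF assms(2,3,6)]
      category.src_idn[OF assms(1)] category.tgt_obj[OF assms(1)] by metis
  then show ?thesis using chain_src[OF assms(2,3,3,4,6,5)] by simp
qed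

lemma grid_tgt:
  assumes "grid G R Q I J F" "a \<in> I" "b \<in> I" "c \<in> J" "d \<in> J" "R a b" "Q c d"
  shows "R a a \<Longrightarrow> tgt (sqh G) (F a b c d) = tgt (sqh G) (F a a c d)"
    and "Q c c \<Longrightarrow> tgt (sqv G) (F a b c d) = tgt (sqv G) (F a b c c)"
  using chain_tgt[OF category_sqh grid_chain_h[OF assms(1)]]
    chain_tgt[OF category_sqv grid_chain_v[OF assms(1)]] assms by blast+

end

section \<open>Inversion in one direction respects the structure of the other direction\<close>

context double_groupoid
begin

sublocale hor: groupoid "hor G" by (rule groupoid_hor)
sublocale ver: groupoid "ver G" by (rule groupoid_ver)
sublocale sqh: groupoid "sqh G" by (rule groupoid_sqh)
sublocale sqv: groupoid "sqv G" by (rule groupoid_sqv)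

lemma double_groupoid_transpose: "double_groupoid (transpose G)"
  using double_category_transpose groupoid_hor groupoid_ver groupoid_sqh groupoid_sqv
  by (simp add: double_groupoid_def double_groupoid_axioms_def)

text \<open>The boundary map is functorial: applied to the composite of \<open>\<alpha>\<close> and
  its inverse it gives an identity edge, and inverses in \<open>hor G\<close> are unique.\<close>

lemma srcv_ginvh: "\<alpha> \<in> squares G \<Longrightarrow> src (sqv G) (ginv (sqh G) \<alpha>) = ginv (hor G) (src (sqv G) \<alpha>)"
  using srcv_cmph[of \<alpha> "ginv (sqh G) \<alpha>"] sqh.ginv[of \<alpha>] boundary_arr[of \<alpha>]
    boundary_arr[of "ginv (sqh G) \<alpha>"] tgt_src[of "ginv (sqh G) \<alpha>"] tgt_src[of \<alpha>]
    src_src[of \<alpha>] srcv_idnh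
  by (intro hor.ginv_unique) auto

lemma tgtv_ginvh: "\<alpha> \<in> squares G \<Longrightarrow> tgt (sqv G) (ginv (sqh G) \<alpha>) = ginv (hor G) (tgt (sqv G) \<alpha>)"
  using tgtv_cmph[of \<alpha> "ginv (sqh G) \<alpha>"] sqh.ginv[of \<alpha>] boundary_arr[of \<alpha>]
    boundary_arr[of "ginv (sqh G) \<alpha>"] tgt_tgt tgtv_idnh src_tgt
  by (intro hor.ginv_unique) auto

lemma ginvh_idnv: "f \<in> arr (hor G) \<Longrightarrow> ginv (sqh G) (idn (sqv G) f) = idn (sqv G) (ginv (hor G) f)"
  using idnv_cmph[of f "ginv (hor G) f"] hor.ginv[of f] idnv_square idn_idn hor.tgt_obj hor.src_obj
    tgth_idnv srch_idnv
  by (intro sqh.ginv_unique[symmetric]) auto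

text \<open>By interchange, composing \<open>cmp (sqv G) \<alpha> \<beta>\<close> with the
  right-hand side stacks two horizontal identity squares, which is again an identity square.\<close>

lemma ginvh_cmpv:
  assumes "\<alpha> \<in> squares G" "\<beta> \<in> squares G" "src (sqv G) \<alpha> = tgt (sqv G) \<beta>"
  shows "ginv (sqh G) (cmp (sqv G) \<alpha> \<beta>) = cmp (sqv G) (ginv (sqh G) \<alpha>) (ginv (sqh G) \<beta>)"
proof (rule sqh.ginv_unique[symmetric])
  note i = sqh.ginv[OF assms(1)] sqh.ginv[OF assms(2)]
  have e: "src (sqv G) (ginv (sqh G) \<alpha>) = tgt (sqv G) (ginv (sqh G) \<beta>)"
    using assms srcv_ginvh tgtv_ginvh by simp
  note a = arr_sqv boundary_arr[OF assms(1)] boundary_arr[OF assms(2)]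
  show "cmp (sqv G) \<alpha> \<beta> \<in> squares G" "cmp (sqv G) (ginv (sqh G) \<alpha>) (ginv (sqh G) \<beta>) \<in> squares G"
    using sqv.cmp_arr assms i e by (simp_all add: arr_sqv)
  show "tgt (sqh G) (cmp (sqv G) (ginv (sqh G) \<alpha>) (ginv (sqh G) \<beta>)) = src (sqh G) (cmp (sqv G) \<alpha> \<beta>)"
    using assms i e srch_cmpv tgth_cmpv by simp
  have "src (ver G) (tgt (sqh G) \<alpha>) = tgt (ver G) (tgt (sqh G) \<beta>)"
    using assms tgt_src[of \<alpha>] tgt_tgt[of \<beta>] by simp
  then show "cmp (sqh G) (cmp (sqv G) \<alpha> \<beta>) (cmp (sqv G) (ginv (sqh G) \<alpha>) (ginv (sqh G) \<beta>)) =
    idn (sqh G) (tgt (sqh G) (cmp (sqv G) \<alpha> \<beta>))"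
    using interchange[of \<alpha> "ginv (sqh G) \<alpha>" \<beta> "ginv (sqh G) \<beta>"] assms i e tgth_cmpv idnh_cmpv a
    by simp
qed

lemma chain_ginvh:
  assumes "chain (sqv G) Q J f"
  shows "chain (sqv G) Q J (\<lambda>c d. ginv (sqh G) (f c d))"
proof (rule chain_map[OF assms _ _ _ category_sqv])
  fix a assume "a \<in> obj (sqv G)"
  then show "ginv (sqh G) (idn (sqv G) a) = idn (sqv G) (tgt (sqv G) (ginv (sqh G) (idn (sqv G) a)))"
    using hor.ginv by (simp add: obj_sqv ginvh_idnv sqv.tgt_idn)
qed (auto simp: arr_sqv sqh.ginv srcv_ginvh tgtv_ginvh ginvh_cmpv)

text \<open>Along the columns this is \<open>chain_symmetrize\<close>; the rows stay functorial
  because horizontal inversion commutes with vertical composition.\<close>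

lemma grid_symmetrize_h:
  assumes "grid G (\<le>) Q I J F"
  shows "grid G everywhere Q I J (\<lambda>a b c d. if a \<le> b then F a b c d else ginv (sqh G) (F b a c d))"
  unfolding grid_def
proof (intro conjI ballI impI)
  fix c d assume "c \<in> J" "d \<in> J" "Q c d"
  then show "chain (sqh G) everywhere I (\<lambda>a b. if a \<le> b then F a b c d else ginv (sqh G) (F b a c d))"
    using sqh.chain_symmetrize[OF grid_chain_h[OF assms]] by blast
next
  fix a b assume "a \<in> I" "b \<in> I"
  then show "chain (sqv G) Q J (\<lambda>c d. if a \<le> b then F a b c d else ginv (sqh G) (F b a c d))"
    using grid_chain_v[OF assms, of a b] chain_ginvh[OF grid_chain_v[OF assms, of b a]] by (cases "a \<le> b") auto
qed

end

text \<open>If both pairs are out of order, the square is inverted horizontally and then vertically.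
  Squares in order are kept, which later makes the extension restrict to the given grids.\<close>

definition symmetrize where
  "symmetrize G F = (\<lambda>a b c d.
     let F' = \<lambda>c d. if a \<le> b then F a b c d else ginv (sqh G) (F b a c d)
     in if c \<le> d then F' c d else ginv (sqv G) (F' d c))"

context double_groupoid
begin

interpretation tr: double_groupoid "transpose G" by (rule double_groupoid_transpose)

lemma grid_symmetrize:
  assumes "grid G (\<le>) (\<le>) I J F"
  shows "grid G everywhere everywhere I J (symmetrize G F)"
  using tr.grid_symmetrize_h[OF grid_transpose[OF grid_symmetrize_h[OF assms]]]
  unfolding grid_def symmetrize_def transpose_simps Let_def by blast

text \<open>\<open>S a c\<close> stands for the square spanned by a fixed base point and \<open>(a, c)\<close>, and \<open>h a\<close> and \<open>u c\<close> for its
  edges through the base point.\<close>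

lemma total_grid_of_squares:
  assumes "\<And>a c. \<lbrakk>a \<in> I; c \<in> J\<rbrakk> \<Longrightarrow> S a c \<in> squares G"
    and "\<And>a c. \<lbrakk>a \<in> I; c \<in> J\<rbrakk> \<Longrightarrow> tgt (sqv G) (S a c) = h a"
    and "\<And>a c. \<lbrakk>a \<in> I; c \<in> J\<rbrakk> \<Longrightarrow> tgt (sqh G) (S a c) = u c"
  defines "E \<equiv> \<lambda>c a b. cmp (sqh G) (ginv (sqh G) (S a c)) (S b c)"
  shows "grid G everywhere everywhere I J (\<lambda>a b c d. cmp (sqv G) (ginv (sqv G) (E c a b)) (E d a b))"
proof -
  have E: "chain (sqh G) everywhere I (E c)" if "c \<in> J" for c
    unfolding E_def using that assms(1,3) by (intro sqh.chain_of_cocone[where t = "u c"]) auto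
  \<comment> \<open>This edge does not depend on \<open>c\<close>: for fixed \<open>a\<close> and
    \<open>b\<close> the squares \<open>E c a b\<close> have a common vertical target, so the cocone
    construction applies a second time, vertically.\<close>
  have tE: "tgt (sqv G) (E c a b) = cmp (hor G) (ginv (hor G) (h a)) (h b)"
    if "a \<in> I" "b \<in> I" "c \<in> J" for a b c
    unfolding E_def using that assms(1-3) sqh.ginv[OF assms(1)] by (simp add: tgtv_cmph tgtv_ginvh)
  have 1: "chain (sqv G) everywhere J (\<lambda>c d. cmp (sqv G) (ginv (sqv G) (E c a b)) (E d a b))"
    if "a \<in> I" "b \<in> I" for a b
    using that tE chain_arr[OF E] by (intro sqv.chain_of_cocone) (auto simp: arr_sqv)
  have 2: "chain (sqh G) everywhere I (\<lambda>a b. cmp (sqv G) (ginv (sqv G) (E c a b)) (E d a b))"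
    if cd: "c \<in> J" "d \<in> J" for c d
    unfolding chain_def
  proof (intro conjI ballI impI)
    \<comment> \<open>Vertical inversion preserves horizontal chains, so the new row is a vertical
      composite of two horizontal chains; interchange makes it a chain again.\<close>
    have E': "chain (sqh G) everywhere I (\<lambda>a b. ginv (sqv G) (E c a b))"
      using tr.chain_ginvh[of everywhere I "E c"] E[OF cd(1)] by simp
    have e: "src (sqv G) (ginv (sqv G) (E c a b)) = tgt (sqv G) (E d a b)" if "a \<in> I" "b \<in> I" for a b
      using that cd tE chain_arr[OF E] by (simp add: sqv.ginv arr_sqv)
    have arr: "E d a b \<in> squares G" "ginv (sqv G) (E c a b) \<in> squares G" if "a \<in> I" "b \<in> I" for a b
      using chain_arr[OF E[OF cd(2)]] chain_arr[OF E'] that by auto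
    fix a b assume ab: "a \<in> I" "b \<in> I"
    show "cmp (sqv G) (ginv (sqv G) (E c a b)) (E d a b) \<in> squares G"
      using sqv.cmp_arr arr e ab by (simp add: arr_sqv)
    show "cmp (sqv G) (ginv (sqv G) (E c a a)) (E d a a) =
        idn (sqh G) (tgt (sqh G) (cmp (sqv G) (ginv (sqv G) (E c a a)) (E d a a)))"
    proof -
      define w w' where w: "w = tgt (sqh G) (ginv (sqv G) (E c a a))" "w' = tgt (sqh G) (E d a a)"
      have "src (ver G) w = tgt (ver G) w'"
        using arr e ab tgt_src[of "ginv (sqv G) (E c a a)"] tgt_tgt[of "E d a a"] unfolding w by simp
      moreover have "w \<in> arr (ver G)" "w' \<in> arr (ver G)" using boundary_arr arr ab unfolding w by auto
      moreover have "ginv (sqv G) (E c a a) = idn (sqh G) w" "E d a a = idn (sqh G) w'"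
        unfolding w using chain_idn[OF E' ab(1)] chain_idn[OF E[OF cd(2)] ab(1)] by blast+
      ultimately show ?thesis
        using idnh_cmpv[of w w'] ver.cmp_arr[of w w'] sqh.tgt_idn[of "cmp (ver G) w w'"]
        by (simp add: obj_sqh)
    qed
    fix b' assume b': "b' \<in> I"
    have 3: "src (sqh G) (E d a b) = tgt (sqh G) (E d b b')" "E d a b' = cmp (sqh G) (E d a b) (E d b b')"
      "src (sqh G) (ginv (sqv G) (E c a b)) = tgt (sqh G) (ginv (sqv G) (E c b b'))"
      "ginv (sqv G) (E c a b') = cmp (sqh G) (ginv (sqv G) (E c a b)) (ginv (sqv G) (E c b b'))"
      using chain_src[OF E[OF cd(2)] ab b'] chain_cmp[OF E[OF cd(2)] ab b']
        chain_src[OF E' ab b'] chain_cmp[OF E' ab b'] by blast+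
    show "src (sqh G) (cmp (sqv G) (ginv (sqv G) (E c a b)) (E d a b)) =
        tgt (sqh G) (cmp (sqv G) (ginv (sqv G) (E c b b')) (E d b b'))"
      using 3 arr e ab b' by (simp add: srch_cmpv tgth_cmpv)
    show "cmp (sqv G) (ginv (sqv G) (E c a b')) (E d a b') =
        cmp (sqh G) (cmp (sqv G) (ginv (sqv G) (E c a b)) (E d a b))
          (cmp (sqv G) (ginv (sqv G) (E c b b')) (E d b b'))"
      unfolding 3(2,4) using 3 arr e ab b' by (intro interchange) auto
  qed
  show ?thesis unfolding grid_def using 1 2 by simp
qed

end

section \<open>Extending grids in double groupoids\<close>

text \<open>\<open>I x\<close> and \<open>J x\<close> are the columns and rows of the face
  \<open>x\<close>. Agreement is demanded for ordered pairs only, since the other values of the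
  functions are arbitrary.\<close>

definition grid_family ::
  "('o, 'h, 'v, 'c) dcat \<Rightarrow> 'x set \<Rightarrow> ('x \<Rightarrow> nat set) \<Rightarrow> ('x \<Rightarrow> nat set) \<Rightarrow>
    ('x \<Rightarrow> nat \<Rightarrow> nat \<Rightarrow> nat \<Rightarrow> nat \<Rightarrow> 'c) \<Rightarrow> bool" where
  "grid_family G X I J F \<longleftrightarrow>
     (\<forall>x\<in>X. grid G (\<le>) (\<le>) (I x) (J x) (F x)) \<and>
     (\<forall>x\<in>X. \<forall>y\<in>X. \<forall>a\<in>I x \<inter> I y. \<forall>b\<in>I x \<inter> I y. \<forall>c\<in>J x \<inter> J y. \<forall>d\<in>J x \<inter> J y.
        a \<le> b \<longrightarrow> c \<le> d \<longrightarrow> F x a b c d = F y a b c d)"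

text \<open>The common form of all extension problems for the nerve. The type of face labels is left
  open because a bihorn has two kinds of faces, labelled by a sum type.\<close>

definition fillable ::
  "('o, 'h, 'v, 'c) dcat \<Rightarrow> nat \<Rightarrow> nat \<Rightarrow> 'x set \<Rightarrow> ('x \<Rightarrow> nat set) \<Rightarrow> ('x \<Rightarrow> nat set) \<Rightarrow> bool" where
  "fillable G p q X I J \<longleftrightarrow>
     (\<forall>F. grid_family G X I J F \<longrightarrow>
        (\<exists>F'. grid G (\<le>) (\<le>) {..p} {..q} F' \<and>
          (\<forall>x\<in>X. \<forall>a\<in>I x. \<forall>b\<in>I x. \<forall>c\<in>J x. \<forall>d\<in>J x.
             a \<le> b \<longrightarrow> c \<le> d \<longrightarrow> F' a b c d = F x a b c d)))"

lemma fillableE: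
  assumes "fillable G p q X I J" "grid_family G X I J F"
  obtains F' where "grid G (\<le>) (\<le>) {..p} {..q} F'"
    "\<And>x a b c d. \<lbrakk>x \<in> X; a \<in> I x; b \<in> I x; c \<in> J x; d \<in> J x; a \<le> b; c \<le> d\<rbrakk> \<Longrightarrow> F' a b c d = F x a b c d"
proof -
  have "\<exists>F'. grid G (\<le>) (\<le>) {..p} {..q} F' \<and>
      (\<forall>x\<in>X. \<forall>a\<in>I x. \<forall>b\<in>I x. \<forall>c\<in>J x. \<forall>d\<in>J x.
         a \<le> b \<longrightarrow> c \<le> d \<longrightarrow> F' a b c d = F x a b c d)"
    using assms unfolding fillable_def by (elim allE impE)
  then show thesis using that by (elim exE conjE) metis
qed

lemma fillable_transpose:
  assumes "fillable G p q X I J"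
  shows "fillable (transpose G) q p X J I"
  unfolding fillable_def
proof (intro allI impI)
  fix F assume F: "grid_family (transpose G) X J I F"
  have "grid_family G X I J (\<lambda>x a b c d. F x c d a b)"
    using F unfolding grid_family_def grid_def transpose_simps by blast
  then obtain F' where F': "grid G (\<le>) (\<le>) {..p} {..q} F'"
    "\<forall>x\<in>X. \<forall>a\<in>I x. \<forall>b\<in>I x. \<forall>c\<in>J x. \<forall>d\<in>J x.
       a \<le> b \<longrightarrow> c \<le> d \<longrightarrow> F' a b c d = F x c d a b"
    using assms unfolding fillable_def by blast
  then show "\<exists>F'. grid (transpose G) (\<le>) (\<le>) {..q} {..p} F' \<and>
      (\<forall>x\<in>X. \<forall>a\<in>J x. \<forall>b\<in>J x. \<forall>c\<in>I x. \<forall>d\<in>I x.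
         a \<le> b \<longrightarrow> c \<le> d \<longrightarrow> F' a b c d = F x a b c d)"
    using grid_transpose[OF F'(1)] by (intro exI[of _ "\<lambda>c d a b. F' a b c d"]) blast
qed

context double_groupoid
begin

text \<open>The filling condition prescribes a source and a target, the base point two targets.
  Filling with the inverse of \<open>h\<close> and inverting the square horizontally turns one into
  the other.\<close>

lemma filling_tgt:
  assumes "filling_condition G" "h \<in> arr (hor G)" "u \<in> arr (ver G)" "tgt (hor G) h = tgt (ver G) u"
  shows "\<exists>\<alpha>\<in>squares G. tgt (sqv G) \<alpha> = h \<and> tgt (sqh G) \<alpha> = u"
proof -
  obtain \<alpha> where \<alpha>: "\<alpha> \<in> squares G" "src (sqh G) \<alpha> = u" "tgt (sqv G) \<alpha> = ginv (hor G) h"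
    using assms hor.ginv[OF assms(2)] unfolding filling_condition_def by metis
  then have "tgt (sqv G) (ginv (sqh G) \<alpha>) = h" "tgt (sqh G) (ginv (sqh G) \<alpha>) = u"
    using tgtv_ginvh hor.ginv_ginv[OF assms(2)] sqh.ginv by auto
  then show ?thesis using sqh.ginv(1)[OF \<alpha>(1)] by blast
qed

text \<open>A total grid is composed of the squares spanned by \<open>(k, l)\<close> and their
  inverses. Every face contains \<open>(k, l)\<close>, so those squares that are given are
  consistent, and the others can be chosen one by one after the edges \<open>h\<close> and
  \<open>u\<close>.\<close>

theorem fillable_if_common_base:
  assumes fill: "filling_condition G" and ne: "X \<noteq> {}"
    and I: "\<And>x. x \<in> X \<Longrightarrow> k \<in> I x" and J: "\<And>x. x \<in> X \<Longrightarrow> l \<in> J x"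
  shows "fillable G p q X I J"
  unfolding fillable_def
proof (intro allI impI)
  fix F assume F: "grid_family G X I J F"
  \<comment> \<open>The square at columns \<open>k, a\<close> and rows \<open>l, c\<close> may be
    out of order, where \<open>F x\<close> means nothing.\<close>
  define T where "T x = symmetrize G (F x)" for x
  have T: "grid G everywhere everywhere (I x) (J x) (T x)" if "x \<in> X" for x
    unfolding T_def using grid_symmetrize F that unfolding grid_family_def by blast
  have agree: "T x a b c d = T y a b c d"
    if "x \<in> X" "y \<in> X" "{a, b} \<subseteq> I x \<inter> I y" "{c, d} \<subseteq> J x \<inter> J y" for x y a b c d
  proof -
    have "F x a' b' c' d' = F y a' b' c' d'"
      if "{a', b'} \<subseteq> {a, b}" "{c', d'} \<subseteq> {c, d}" "a' \<le> b'" "c' \<le> d'" for a' b' c' d'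
      using F that \<open>x \<in> X\<close> \<open>y \<in> X\<close> \<open>{a, b} \<subseteq> _\<close> \<open>{c, d} \<subseteq> _\<close>
      unfolding grid_family_def by (meson insert_subset subset_trans)
    then show ?thesis unfolding T_def symmetrize_def by simp
  qed
  \<comment> \<open>Some face is required to locate the base vertex \<open>pt\<close> in
    \<open>G\<close>; even the default edges chosen below have to end there.\<close>
  obtain x0 where x0: "x0 \<in> X" using ne by blast
  define corner where "corner = T x0 k k l l"
  have sq: "T x a b c d \<in> squares G"
    and th: "tgt (sqh G) (T x a b c d) = tgt (sqh G) (T x a a c d)"
    and tv: "tgt (sqv G) (T x a b c d) = tgt (sqv G) (T x a b c c)"
    if "x \<in> X" "a \<in> I x" "b \<in> I x" "c \<in> J x" "d \<in> J x" for x a b c d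
    using grid_square[OF T] grid_tgt[OF T] that by blast+
  have corner: "corner \<in> squares G" unfolding corner_def using sq x0 I J by simp
  have corner': "T x k k l l = corner" if "x \<in> X" for x
    unfolding corner_def using agree[of x x0 k k l l] I J x0 that by simp
  define pt where "pt = tgt (hor G) (tgt (sqv G) corner)"
  have pt: "pt \<in> obj (hor G)" "pt = tgt (ver G) (tgt (sqh G) corner)"
    unfolding pt_def using tgt_tgt[OF corner] boundary_arr[OF corner] hor.tgt_obj by blast+
  have th': "tgt (hor G) (tgt (sqv G) (T x k a l c)) = pt"
    and tv': "tgt (ver G) (tgt (sqh G) (T x k a l c)) = pt"
    if "x \<in> X" "a \<in> I x" "c \<in> J x" for x a c
  proof -
    show "tgt (ver G) (tgt (sqh G) (T x k a l c)) = pt"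
      using th[OF that(1) I that(2) J that(3)] tv[OF that(1) I I J that(3)] that
        tgt_tgt[OF sq[OF that(1) I I J that(3)]] corner'[OF that(1)] by (simp add: pt_def)
    then show "tgt (hor G) (tgt (sqv G) (T x k a l c)) = pt"
      using tgt_tgt[OF sq[OF that(1) I that(2) J that(3)]] that by simp
  qed
  \<comment> \<open>A column met by some face inherits its edge to the base point, the same from
    every such face. For a column in no face any edge into \<open>pt\<close> would do; the identity
    is taken.\<close>
  have "\<exists>h\<in>arr (hor G). tgt (hor G) h = pt \<and> (\<forall>x\<in>X. a \<in> I x \<longrightarrow> tgt (sqv G) (T x k a l l) = h)" for a
  proof (cases "\<exists>x\<in>X. a \<in> I x")
    case True
    then obtain x where x: "x \<in> X" "a \<in> I x" by blast
    have "T y k a l l = T x k a l l" if "y \<in> X" "a \<in> I y" for y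
      using agree[of y x k a l l] that x I J by simp
    then have "\<forall>y\<in>X. a \<in> I y \<longrightarrow> tgt (sqv G) (T y k a l l) = tgt (sqv G) (T x k a l l)" by metis
    then show ?thesis
      using th'[OF x J] boundary_arr(4)[OF sq[OF x(1) I x(2) J J]] x(1) by blast
  next
    case False
    then show ?thesis using hor.idn_arr hor.tgt_idn pt by blast
  qed
  then obtain h where h: "\<And>a. h a \<in> arr (hor G)" "\<And>a. tgt (hor G) (h a) = pt"
    "\<And>a x. x \<in> X \<Longrightarrow> a \<in> I x \<Longrightarrow> tgt (sqv G) (T x k a l l) = h a" by metis
  have "\<exists>u\<in>arr (ver G). tgt (ver G) u = pt \<and> (\<forall>x\<in>X. c \<in> J x \<longrightarrow> tgt (sqh G) (T x k k l c) = u)" for c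
  proof (cases "\<exists>x\<in>X. c \<in> J x")
    case True
    then obtain x where x: "x \<in> X" "c \<in> J x" by blast
    have "T y k k l c = T x k k l c" if "y \<in> X" "c \<in> J y" for y
      using agree[of y x k k l c] that x I J by simp
    then have "\<forall>y\<in>X. c \<in> J y \<longrightarrow> tgt (sqh G) (T y k k l c) = tgt (sqh G) (T x k k l c)" by metis
    then show ?thesis
      using tv'[OF x(1) I x(2)] boundary_arr(2)[OF sq[OF x(1) I I J x(2)]] x(1) by blast
  next
    case False
    then show ?thesis using ver.idn_arr ver.tgt_idn pt by (metis obj_ver)
  qed
  then obtain u where u: "\<And>a. u a \<in> arr (ver G)" "\<And>a. tgt (ver G) (u a) = pt"
    "\<And>c x. x \<in> X \<Longrightarrow> c \<in> J x \<Longrightarrow> tgt (sqh G) (T x k k l c) = u c" by metis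
  \<comment> \<open>Column \<open>a\<close> and row \<open>c\<close> may both occur in faces without
    occurring in the same one. Then the two edges are prescribed but no square is, and the filling
    condition supplies it.\<close>
  have "\<exists>S\<in>squares G. tgt (sqv G) S = h a \<and> tgt (sqh G) S = u c \<and>
      (\<forall>x\<in>X. a \<in> I x \<longrightarrow> c \<in> J x \<longrightarrow> T x k a l c = S)" for a c
  proof (cases "\<exists>x\<in>X. a \<in> I x \<and> c \<in> J x")
    case True
    then obtain x where x: "x \<in> X" "a \<in> I x" "c \<in> J x" by blast
    have "T y k a l c = T x k a l c" if "y \<in> X" "a \<in> I y" "c \<in> J y" for y
      using agree[of y x k a l c] that x I J by simp
    moreover have "tgt (sqv G) (T x k a l c) = h a" "tgt (sqh G) (T x k a l c) = u c"
      using th[of x k a l c] tv[of x k a l c] x h(3) u(3) I J by auto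
    ultimately show ?thesis using sq[OF x(1) I x(2) J x(3)] x(1) by blast
  next
    case False
    then show ?thesis using filling_tgt[OF fill h(1) u(1)] h(2) u(2) by metis
  qed
  then obtain S where S: "\<And>a c. S a c \<in> squares G" "\<And>a c. tgt (sqv G) (S a c) = h a"
    "\<And>a c. tgt (sqh G) (S a c) = u c"
    "\<And>a c x. x \<in> X \<Longrightarrow> a \<in> I x \<Longrightarrow> c \<in> J x \<Longrightarrow> T x k a l c = S a c" by metis
  define E where "E c a b = cmp (sqh G) (ginv (sqh G) (S a c)) (S b c)" for c a b
  define F' where "F' a b c d = cmp (sqv G) (ginv (sqv G) (E c a b)) (E d a b)" for a b c d
  have "grid G everywhere everywhere {..p} {..q} F'"
    using total_grid_of_squares[of "{..p}" "{..q}" S h u] S(1-3) unfolding F'_def E_def by simp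
  then have "grid G (\<le>) (\<le>) {..p} {..q} F'"
    using grid_pullback[of G everywhere everywhere "{..p}" "{..q}" F' id "{..p}" id "{..q}" "(\<le>)" "(\<le>)"]
    by simp
  moreover have "F' a b c d = F x a b c d"
    if x: "x \<in> X" "a \<in> I x" "b \<in> I x" "c \<in> J x" "d \<in> J x" "a \<le> b" "c \<le> d" for x a b c d
  proof -
    \<comment> \<open>Both sides are determined by the squares at the base point: first in the row
      strip from \<open>l\<close> to \<open>c\<close>, then vertically.\<close>
    have E: "T x a b l c = E c a b" if "c \<in> J x" for c
      using sqh.chain_total_eq_cocone[OF grid_chain_h[OF T[OF x(1)] J[OF x(1)] that] I[OF x(1)] x(2,3)]
        S(4) x that unfolding E_def by simp
    have "F x a b c d = T x a b c d" using x unfolding T_def symmetrize_def by simp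
    also have "\<dots> = F' a b c d"
      using sqv.chain_total_eq_cocone[OF grid_chain_v[OF T[OF x(1)] x(2,3)] J[OF x(1)] x(4,5)]
        E x unfolding F'_def by simp
    finally show ?thesis by simp
  qed
  ultimately show "\<exists>F'. grid G (\<le>) (\<le>) {..p} {..q} F' \<and>
      (\<forall>x\<in>X. \<forall>a\<in>I x. \<forall>b\<in>I x. \<forall>c\<in>J x. \<forall>d\<in>J x.
         a \<le> b \<longrightarrow> c \<le> d \<longrightarrow> F' a b c d = F x a b c d)" by blast
qed

end

section \<open>Inverses and fillers from extensions of grids\<close>

text \<open>The functor on \<open>[1]\<close> that picks \<open>f\<close>. Index 0 is the target
  because the arrow of \<open>[1]\<close> runs from 1 to 0.\<close>

definition arrow_chain :: "('o, 'm) cat \<Rightarrow> 'm \<Rightarrow> nat \<Rightarrow> nat \<Rightarrow> 'm" where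
  "arrow_chain A f a b = (if a = b then idn A (if a = 0 then tgt A f else src A f) else f)"

lemma (in category) chain_arrow_chain:
  assumes "f \<in> arr A"
  shows "chain A (\<le>) {..1} (arrow_chain A f)"
  unfolding chain_def
proof (intro conjI ballI impI)
  fix a b c :: nat assume "a \<in> {..1}" "b \<in> {..1}" "c \<in> {..1}" "a \<le> b" "b \<le> c"
  then have "(a = b \<and> b = c) \<or> (a = 0 \<and> b = 0 \<and> c = 1) \<or> (a = 0 \<and> b = 1 \<and> c = 1)" by auto
  then consider "a = b" "b = c" | "a = 0" "b = 0" "c = 1" | "a = 0" "b = 1" "c = 1" by blast
  then show "src A (arrow_chain A f a b) = tgt A (arrow_chain A f b c)"
    "arrow_chain A f a c = cmp A (arrow_chain A f a b) (arrow_chain A f b c)"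
    using assms cmp_idn_left'[of "idn A (tgt A f)" "tgt A f"] cmp_idn_left'[of "idn A (src A f)" "src A f"]
    by (cases; simp add: arrow_chain_def src_obj tgt_obj src_idn tgt_idn idn_arr cmp_idn_left cmp_idn_right)+
qed (use assms src_obj tgt_obj tgt_idn idn_arr in \<open>auto simp: arrow_chain_def\<close>)

definition square_grid :: "('o, 'h, 'v, 'c) dcat \<Rightarrow> 'c \<Rightarrow> nat \<Rightarrow> nat \<Rightarrow> nat \<Rightarrow> nat \<Rightarrow> 'c" where
  "square_grid G \<alpha> a b = arrow_chain (sqv G) (arrow_chain (sqh G) \<alpha> a b)"

context double_category
begin

lemma chain_idnv:
  assumes "chain (hor G) R I f"
  shows "chain (sqh G) R I (\<lambda>a b. idn (sqv G) (f a b))"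
proof (rule chain_map[OF assms _ _ _ category_hor])
  fix a assume "a \<in> obj (hor G)"
  then show "idn (sqv G) (idn (hor G) a) =
      idn (sqh G) (tgt (sqh G) (idn (sqv G) (idn (hor G) a)))"
    using ver.idn_arr[of a] by (simp flip: idn_idn add: obj_ver sqh.tgt_idn obj_sqh)
qed (auto simp: idnv_square srch_idnv tgth_idnv idnv_cmph)

lemma chain_srcv_tgtv:
  assumes "chain (sqh G) R I f"
  shows "chain (hor G) R I (\<lambda>a b. src (sqv G) (f a b))"
    and "chain (hor G) R I (\<lambda>a b. tgt (sqv G) (f a b))"
proof -
  show "chain (hor G) R I (\<lambda>a b. src (sqv G) (f a b))"
  proof (rule chain_map[OF assms _ _ _ category_sqh])
    fix g h assume "g \<in> squares G" "h \<in> squares G" "src (sqh G) g = tgt (sqh G) h"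
    then show "src (hor G) (src (sqv G) g) = tgt (hor G) (src (sqv G) h) \<and>
        src (sqv G) (cmp (sqh G) g h) = cmp (hor G) (src (sqv G) g) (src (sqv G) h)"
      using src_src[of g] tgt_src[of h] srcv_cmph by simp
  next
    fix a assume "a \<in> obj (sqh G)"
    then show "src (sqv G) (idn (sqh G) a) = idn (hor G) (tgt (hor G) (src (sqv G) (idn (sqh G) a)))"
      using hor.tgt_idn ver.src_obj by (simp add: obj_sqh srcv_idnh obj_ver)
  qed (rule boundary_arr)
  show "chain (hor G) R I (\<lambda>a b. tgt (sqv G) (f a b))"
  proof (rule chain_map[OF assms _ _ _ category_sqh])
    fix g h assume "g \<in> squares G" "h \<in> squares G" "src (sqh G) g = tgt (sqh G) h"
    then show "src (hor G) (tgt (sqv G) g) = tgt (hor G) (tgt (sqv G) h) \<and>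
        tgt (sqv G) (cmp (sqh G) g h) = cmp (hor G) (tgt (sqv G) g) (tgt (sqv G) h)"
      using src_tgt[of g] tgt_tgt[of h] tgtv_cmph by simp
  next
    fix a assume "a \<in> obj (sqh G)"
    then show "tgt (sqv G) (idn (sqh G) a) = idn (hor G) (tgt (hor G) (tgt (sqv G) (idn (sqh G) a)))"
      using hor.tgt_idn ver.tgt_obj by (simp add: obj_sqh tgtv_idnh obj_ver)
  qed (rule boundary_arr)
qed

text \<open>Vertically this is \<open>chain_arrow_chain\<close>. Horizontally, a row pair
  \<open>c = d\<close> consists of identity squares on a boundary chain of \<open>\<alpha>\<close>,
  functorial because \<open>idn (sqv G)\<close> is.\<close>

lemma grid_square_grid:
  assumes "\<alpha> \<in> squares G"
  shows "grid G (\<le>) (\<le>) {..1} {..1} (square_grid G \<alpha>)"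
  unfolding grid_def
proof (intro conjI ballI impI)
  note h = sqh.chain_arrow_chain[OF assms]
  fix c d :: nat assume cd: "c \<in> {..1}" "d \<in> {..1}" "c \<le> d"
  show "chain (sqh G) (\<le>) {..1} (\<lambda>a b. square_grid G \<alpha> a b c d)"
    using h chain_idnv[OF chain_srcv_tgtv(1)[OF h]] chain_idnv[OF chain_srcv_tgtv(2)[OF h]]
    unfolding square_grid_def arrow_chain_def[of "sqv G"] by (cases "c = d"; cases "c = 0") simp_all
next
  fix a b :: nat assume "a \<in> {..1}" "b \<in> {..1}" "a \<le> b"
  then show "chain (sqv G) (\<le>) {..1} (square_grid G \<alpha> a b)"
    unfolding square_grid_def
    using sqv.chain_arrow_chain chain_arr[OF sqh.chain_arrow_chain[OF assms]] by (simp add: arr_sqv)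
qed

text \<open>The grid is constant in the rows. For \<open>a = b\<close> this rests on
  \<open>idn_idn\<close>, the coincidence of the two degenerate squares on a vertex.\<close>

lemma square_grid_idnv:
  assumes "f \<in> arr (hor G)" "c \<le> 1" "d \<le> 1"
  shows "square_grid G (idn (sqv G) f) a b c d = idn (sqv G) (arrow_chain (hor G) f a b)"
  using assms hor.src_obj[of f] hor.tgt_obj[of f] ver.idn_arr sqv.src_idn sqv.tgt_idn hor.idn_arr
  by (auto simp: square_grid_def arrow_chain_def srch_idnv tgth_idnv srcv_idnh tgtv_idnh idn_idn
      obj_sqv obj_ver ver.src_idn ver.tgt_idn)

lemma square_grid_top:
  assumes "\<alpha> \<in> squares G"
  shows "square_grid G \<alpha> a b 0 0 = idn (sqv G) (arrow_chain (hor G) (tgt (sqv G) \<alpha>) a b)"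
  using assms boundary_arr[OF assms] src_tgt[OF assms] tgt_tgt[OF assms]
  by (auto simp: square_grid_def arrow_chain_def tgtv_idnh)

text \<open>In the horn with missing face 0, columns \<open>0, 1\<close> carry
  \<open>\<alpha>\<close> and columns \<open>0, 2\<close> an identity; the cell with columns
  \<open>1, 2\<close> of the extension is then a right inverse.\<close>

lemma right_inverse_h:
  assumes "fillable G 2 1 ({..2} - {0}) (\<lambda>i. {..2} - {i}) (\<lambda>_. {..1})" and \<alpha>: "\<alpha> \<in> squares G"
  shows "\<exists>\<beta>\<in>squares G. tgt (sqh G) \<beta> = src (sqh G) \<alpha> \<and>
    cmp (sqh G) \<alpha> \<beta> = idn (sqh G) (tgt (sqh G) \<alpha>)"
proof -
  define u where "u = tgt (sqh G) \<alpha>"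
  have u: "u \<in> arr (ver G)" unfolding u_def using boundary_arr \<alpha> by simp
  \<comment> \<open>\<open>min a 1\<close> identifies each of the column sets \<open>{0, 2}\<close>
    and \<open>{0, 1}\<close> with \<open>{0, 1}\<close>.\<close>
  define F where "F i a b c d =
    (if i = 1 then square_grid G (idn (sqh G) u) (min a 1) (min b 1) c d
     else square_grid G \<alpha> (min a 1) (min b 1) c d)" for i a b c d :: nat
  have "grid_family G ({..2} - {0}) (\<lambda>i. {..2} - {i}) (\<lambda>_. {..1}) F"
    unfolding grid_family_def
  proof (intro conjI ballI impI)
    fix i :: nat
    assume "i \<in> {..2} - {0}"
    show "grid G (\<le>) (\<le>) ({..2} - {i}) {..1} (F i)"
      unfolding F_def
      using grid_pullback[OF grid_square_grid[OF \<alpha>], of "\<lambda>a. min a 1" "{..2} - {i}" "\<lambda>c. c" "{..1}" "(\<le>)" "(\<le>)"]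
        grid_pullback[OF grid_square_grid[OF idnh_square[OF u]], of "\<lambda>a. min a 1" "{..2} - {i}" "\<lambda>c. c" "{..1}" "(\<le>)" "(\<le>)"]
      by (cases "i = 1") simp_all
  next
    fix x y a b c d :: nat
    assume xy: "x \<in> {..2} - {0}" "y \<in> {..2} - {0}"
      and ab: "a \<in> ({..2} - {x}) \<inter> ({..2} - {y})" "b \<in> ({..2} - {x}) \<inter> ({..2} - {y})"
    have 0: "square_grid G (idn (sqh G) u) 0 0 c d = square_grid G \<alpha> 0 0 c d"
      using sqh.tgt_idn[of u] u by (simp add: square_grid_def arrow_chain_def obj_sqh u_def)
    show "F x a b c d = F y a b c d"
    proof (cases "x = y")
      case False
      then have "a = 0" "b = 0" using xy ab by auto
      then show ?thesis using 0 by (simp add: F_def)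
    qed simp
  qed
  from fillableE[OF assms(1) this] obtain F' where F': "grid G (\<le>) (\<le>) {..2} {..1} F'"
    and ext: "\<And>i a b c d. \<lbrakk>i \<in> {..2} - {0}; a \<in> {..2} - {i}; b \<in> {..2} - {i}; c \<in> {..1}; d \<in> {..1};
      a \<le> b; c \<le> d\<rbrakk> \<Longrightarrow> F' a b c d = F i a b c d" by blast
  have "F' 0 1 0 1 = \<alpha>" "F' 0 2 0 1 = idn (sqh G) u"
    using ext[of 2 0 1 0 1] ext[of 1 0 2 0 1]
    by (simp_all add: F_def square_grid_def arrow_chain_def)
  moreover have "src (sqh G) (F' 0 1 0 1) = tgt (sqh G) (F' 1 2 0 1)"
    "F' 0 2 0 1 = cmp (sqh G) (F' 0 1 0 1) (F' 1 2 0 1)"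
    using chain_src[OF grid_chain_h[OF F', of 0 1], of 0 1 2]
      chain_cmp[OF grid_chain_h[OF F', of 0 1], of 0 1 2] by simp_all
  moreover have "F' 1 2 0 1 \<in> squares G" using grid_square[OF F'] by simp
  ultimately show ?thesis unfolding u_def by (metis (no_types))
qed

text \<open>The bihorn through the base point \<open>(1, 0)\<close> consists of column 1 and row 0.
  As index 0 is the target, these are the horizontal source and the vertical target of the missing
  square.\<close>

lemma filling_if_fillable_bihorn:
  assumes "fillable G 1 1 (({..1} - {1}) <+> ({..1} - {0}))
    (case_sum (\<lambda>i. {..1} - {i}) (\<lambda>_. {..1})) (case_sum (\<lambda>_. {..1}) (\<lambda>j. {..1} - {j}))"
  shows "filling_condition G"
  unfolding filling_condition_def
proof (intro ballI impI)
  fix g u assume g: "g \<in> arr (hor G)" and u: "u \<in> arr (ver G)" and gu: "src (hor G) g = tgt (ver G) u"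
  let ?X = "({..1} - {1}) <+> ({..1} - {0}) :: (nat + nat) set"
  let ?I = "case_sum (\<lambda>i. {..1} - {i}) (\<lambda>_. {..1}) :: nat + nat \<Rightarrow> nat set"
  let ?J = "case_sum (\<lambda>_. {..1}) (\<lambda>j. {..1} - {j}) :: nat + nat \<Rightarrow> nat set"
  define F :: "nat + nat \<Rightarrow> _" where
    "F = case_sum (\<lambda>_. square_grid G (idn (sqh G) u)) (\<lambda>_. square_grid G (idn (sqv G) g))"
  have X: "?X = {Inl 0, Inr 1}" by auto
  have I: "?I (Inl 0) = {1}" "?J (Inl 0) = {..1}" "?I (Inr 1) = {..1}" "?J (Inr 1) = {0}" by auto
  have agree: "square_grid G (idn (sqh G) u) 1 1 0 0 = square_grid G (idn (sqv G) g) 1 1 0 0"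
    unfolding square_grid_top[OF idnv_square[OF g]] square_grid_top[OF idnh_square[OF u]]
    using u g gu sqv.tgt_idn[of g] hor.src_idn ver.tgt_obj[OF u]
    by (simp add: arrow_chain_def tgtv_idnh obj_sqv obj_ver)
  have "grid_family G ?X ?I ?J F"
    unfolding grid_family_def
  proof (intro conjI ballI impI)
    fix x assume "x \<in> ?X"
    then show "grid G (\<le>) (\<le>) (?I x) (?J x) (F x)"
      using grid_pullback[OF grid_square_grid[OF idnh_square[OF u]], of "\<lambda>a. a" "?I x" "\<lambda>c. c" "?J x" "(\<le>)" "(\<le>)"]
        grid_pullback[OF grid_square_grid[OF idnv_square[OF g]], of "\<lambda>a. a" "?I x" "\<lambda>c. c" "?J x" "(\<le>)" "(\<le>)"]
      by (cases x) (auto simp: F_def)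
  next
    fix x y a b c d
    assume xy: "x \<in> ?X" "y \<in> ?X"
      and ab: "a \<in> ?I x \<inter> ?I y" "b \<in> ?I x \<inter> ?I y" "c \<in> ?J x \<inter> ?J y" "d \<in> ?J x \<inter> ?J y"
    show "F x a b c d = F y a b c d"
    proof (cases "x = y")
      case False
      then have "(x = Inl 0 \<and> y = Inr 1) \<or> (x = Inr 1 \<and> y = Inl 0)" using xy X by blast
      moreover from this have "a = 1" "b = 1" "c = 0" "d = 0" using ab by auto
      ultimately show ?thesis using agree by (auto simp: F_def)
    qed simp
  qed
  from fillableE[OF assms this] obtain F' where F': "grid G (\<le>) (\<le>) {..1} {..1} F'"
    and ext: "\<And>x a b c d. \<lbrakk>x \<in> ?X; a \<in> ?I x; b \<in> ?I x; c \<in> ?J x; d \<in> ?J x; a \<le> b; c \<le> d\<rbrakk>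
      \<Longrightarrow> F' a b c d = F x a b c d" by blast
  have "F' 1 1 0 1 = idn (sqh G) u"
    using ext[of "Inl 0" 1 1 0 1] X u
    by (simp add: F_def arrow_chain_def square_grid_def sqh.src_idn obj_sqh)
  moreover have "F' 0 1 0 0 = idn (sqv G) g"
    using ext[of "Inr 1" 0 1 0 0] X g by (simp add: F_def square_grid_idnv) (simp add: arrow_chain_def)
  moreover have "src (sqh G) (F' 0 1 0 1) = tgt (sqh G) (F' 1 1 0 1)"
    "src (sqv G) (F' 0 1 0 0) = tgt (sqv G) (F' 0 1 0 1)"
    using chain_src[OF grid_chain_h[OF F', of 0 1], of 0 1 1]
      chain_src[OF grid_chain_v[OF F', of 0 1], of 0 0 1] by simp_all
  moreover have "F' 0 1 0 1 \<in> squares G" using grid_square[OF F'] by simp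
  ultimately show "\<exists>\<alpha>\<in>squares G. src (sqh G) \<alpha> = u \<and> tgt (sqv G) \<alpha> = g"
    using sqv.src_idn[of g] sqh.tgt_idn[of u] u g by (auto simp: obj_sqv obj_sqh)
qed

text \<open>The left inverse of the coface omitting \<open>i\<close>.\<close>

definition squash :: "nat \<Rightarrow> nat \<Rightarrow> nat" where
  "squash i a = (if i < a then a - 1 else a)"

text \<open>Each face of a diagonal 2-horn is a single square, and the two faces share only the
  vertex \<open>k\<close>; compatibility reduces to one equation between degenerate squares.\<close>

lemma fill_two_horn:
  assumes fill: "fillable G 2 2 ({..2} - {k}) (\<lambda>i. {..2} - {i}) (\<lambda>i. {..2} - {i})"
    and k: "k \<le> 2" and sq: "\<And>i. i \<in> {..2} - {k} \<Longrightarrow> A i \<in> squares G"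
    and corner: "\<forall>i\<in>{..2} - {k}. \<forall>j\<in>{..2} - {k}. i < j \<longrightarrow>
      square_grid G (A i) (squash i k) (squash i k) (squash i k) (squash i k) =
      square_grid G (A j) (squash j k) (squash j k) (squash j k) (squash j k)"
  obtains F' where "grid G (\<le>) (\<le>) {..2} {..2} F'"
    "\<And>i a b c d. \<lbrakk>i \<in> {..2} - {k}; {a, b, c, d} \<subseteq> {..2} - {i}; a \<le> b; c \<le> d\<rbrakk> \<Longrightarrow>
      F' a b c d = square_grid G (A i) (squash i a) (squash i b) (squash i c) (squash i d)"
proof -
  define F where "F i a b c d = square_grid G (A i) (squash i a) (squash i b) (squash i c) (squash i d)"
    for i a b c d
  have "grid_family G ({..2} - {k}) (\<lambda>i. {..2} - {i}) (\<lambda>i. {..2} - {i}) F"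
    unfolding grid_family_def
  proof (intro conjI ballI impI)
    fix i assume i: "i \<in> {..2} - {k}"
    show "grid G (\<le>) (\<le>) ({..2} - {i}) ({..2} - {i}) (F i)"
      unfolding F_def using i
      by (intro grid_pullback[OF grid_square_grid[OF sq]]) (auto simp: squash_def split: if_splits)
  next
    fix i j a b c d :: nat
    assume ij: "i \<in> {..2} - {k}" "j \<in> {..2} - {k}"
      and abcd: "a \<in> ({..2} - {i}) \<inter> ({..2} - {j})" "b \<in> ({..2} - {i}) \<inter> ({..2} - {j})"
      "c \<in> ({..2} - {i}) \<inter> ({..2} - {j})" "d \<in> ({..2} - {i}) \<inter> ({..2} - {j})"
    show "F i a b c d = F j a b c d"
    proof (cases "i = j")
      case False
      have "x = k" if "x \<le> 2" "x \<noteq> i" "x \<noteq> j" for x :: nat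
      proof -
        have "i \<le> 2" "j \<le> 2" "i \<noteq> k" "j \<noteq> k" using ij by auto
        then show ?thesis using k that False by linarith
      qed
      then have "a = k" "b = k" "c = k" "d = k" using abcd by auto
      then show ?thesis using corner[rule_format, of i j] corner[rule_format, of j i] ij False by (cases "i < j") (auto simp: F_def)
    qed simp
  qed
  from fillableE[OF fill this] obtain F' where "grid G (\<le>) (\<le>) {..2} {..2} F'"
    and ext: "\<And>i a b c d. \<lbrakk>i \<in> {..2} - {k}; a \<in> {..2} - {i}; b \<in> {..2} - {i}; c \<in> {..2} - {i};
      d \<in> {..2} - {i}; a \<le> b; c \<le> d\<rbrakk> \<Longrightarrow> F' a b c d = F i a b c d" by blast
  then show thesis using that[of F'] unfolding F_def by auto
qed

text \<open>Put \<open>u\<close>, thickened horizontally, on the vertices \<open>1, 2\<close> and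
  \<open>g\<close>, thickened vertically, on \<open>0, 1\<close>. The cell with columns
  \<open>0, 1\<close> and rows \<open>1, 2\<close> lies in neither face and has exactly the required
  boundary.\<close>

lemma filling_if_fillable_diag:
  assumes "fillable G 2 2 ({..2} - {1}) (\<lambda>i. {..2} - {i}) (\<lambda>i. {..2} - {i})"
  shows "filling_condition G"
  unfolding filling_condition_def
proof (intro ballI impI)
  fix g u assume g: "g \<in> arr (hor G)" and u: "u \<in> arr (ver G)" and gu: "src (hor G) g = tgt (ver G) u"
  define A where "A i = (if i = 0 then idn (sqh G) u else idn (sqv G) g)" for i :: nat
  have A: "A i \<in> squares G" for i using g u idnv_square idnh_square by (simp add: A_def)
  \<comment> \<open>The shared vertex 1 is index 0 (target) of the first square and index 1 (source)
    of the second, which is the hypothesis on \<open>g\<close> and \<open>u\<close>.\<close>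
  have "square_grid G (idn (sqh G) u) 0 0 0 0 = square_grid G (idn (sqv G) g) 1 1 1 1"
    using square_grid_top[OF idnh_square[OF u], of 0 0] square_grid_idnv[OF g, of 1 1 1 1]
      gu tgtv_idnh[OF u] hor.tgt_idn ver.tgt_obj[OF u] by (simp add: arrow_chain_def obj_ver)
  then have "\<forall>i\<in>{..2} - {1}. \<forall>j\<in>{..2} - {1}. i < j \<longrightarrow>
      square_grid G (A i) (squash i 1) (squash i 1) (squash i 1) (squash i 1) =
      square_grid G (A j) (squash j 1) (squash j 1) (squash j 1) (squash j 1)"
    by (auto simp: A_def squash_def)
  from fill_two_horn[OF assms one_le_numeral A this] obtain F where F: "grid G (\<le>) (\<le>) {..2} {..2} F"
    and ext: "\<And>i a b c d. \<lbrakk>i \<in> {..2} - {1}; {a, b, c, d} \<subseteq> {..2} - {i}; a \<le> b; c \<le> d\<rbrakk> \<Longrightarrow>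
      F a b c d = square_grid G (A i) (squash i a) (squash i b) (squash i c) (squash i d)"
    by blast
  have "F 1 2 1 2 = idn (sqh G) u" "F 0 1 0 1 = idn (sqv G) g"
    using ext[of 0 1 2 1 2] ext[of 2 0 1 0 1]
    by (simp_all add: A_def squash_def square_grid_def arrow_chain_def)
  moreover have "src (sqh G) (F 0 1 1 2) = tgt (sqh G) (F 1 2 1 2)"
    "src (sqv G) (F 0 1 0 1) = tgt (sqv G) (F 0 1 1 2)"
    using chain_src[OF grid_chain_h[OF F, of 1 2], of 0 1 2]
      chain_src[OF grid_chain_v[OF F, of 0 1], of 0 1 2] by simp_all
  moreover have "F 0 1 1 2 \<in> squares G" using grid_square[OF F] by simp
  ultimately show "\<exists>\<alpha>\<in>squares G. src (sqh G) \<alpha> = u \<and> tgt (sqv G) \<alpha> = g"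
    using sqv.src_idn[of g] sqh.tgt_idn[of u] u g by (auto simp: obj_sqv obj_sqh)
qed

text \<open>The horn \<open>\<Lambda>\<^sup>0[3]\<close> is chosen such that the cell with columns \<open>0, 1\<close> and rows \<open>2, 3\<close>, which lies in none
  of its faces, is the inverse: with rows \<open>1, 2\<close> the same columns give \<open>\<alpha>\<close>, with rows \<open>1, 3\<close> an identity.
  Its face \<open>0, 2, 3\<close> is not degenerate and is itself found by filling a horn.\<close>

lemma right_inverse_v_diag:
  assumes fill2: "fillable G 2 2 ({..2} - {0}) (\<lambda>i. {..2} - {i}) (\<lambda>i. {..2} - {i})"
    and fill3: "fillable G 3 3 ({..3} - {0}) (\<lambda>i. {..3} - {i}) (\<lambda>i. {..3} - {i})"
    and \<alpha>: "\<alpha> \<in> squares G"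
  shows "\<exists>\<beta>\<in>squares G. tgt (sqv G) \<beta> = src (sqv G) \<alpha> \<and>
    cmp (sqv G) \<alpha> \<beta> = idn (sqv G) (tgt (sqv G) \<alpha>)"
proof -
  define f where "f = tgt (sqv G) \<alpha>"
  have f: "f \<in> arr (hor G)" unfolding f_def using boundary_arr \<alpha> by simp
  \<comment> \<open>In row 0 only the edge \<open>f\<close> of \<open>\<alpha>\<close> is visible,
    so \<open>\<alpha>\<close> cannot be told there from the identity square on \<open>f\<close>.
    This glues faces carrying different squares.\<close>
  have top: "square_grid G \<alpha> a b 0 0 = square_grid G (idn (sqv G) f) a b c d" if "c \<le> 1" "d \<le> 1" for a b c d
    using square_grid_top[OF \<alpha>] square_grid_idnv[OF f that] by (simp add: f_def)
  define A where "A i = (if i = 1 then idn (sqv G) f else \<alpha>)" for i :: nat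
  have A: "A i \<in> squares G" for i using f \<alpha> idnv_square by (simp add: A_def)
  have "\<forall>i\<in>{..2} - {0}. \<forall>j\<in>{..2} - {0}. i < j \<longrightarrow>
      square_grid G (A i) (squash i 0) (squash i 0) (squash i 0) (squash i 0) =
      square_grid G (A j) (squash j 0) (squash j 0) (squash j 0) (squash j 0)"
    using top[of 0 0 0 0] by (auto simp: A_def squash_def)
  \<comment> \<open>Vertices \<open>0, 1\<close> carry \<open>\<alpha>\<close> and
    \<open>0, 2\<close> the identity on \<open>f\<close>. Cells of \<open>E\<close> outside these
    two faces remain unspecified.\<close>
  from fill_two_horn[OF fill2 zero_le A this] obtain E where E: "grid G (\<le>) (\<le>) {..2} {..2} E"
    and extE: "\<And>i a b c d. \<lbrakk>i \<in> {..2} - {0}; {a, b, c, d} \<subseteq> {..2} - {i}; a \<le> b; c \<le> d\<rbrakk> \<Longrightarrow>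
      E a b c d = square_grid G (A i) (squash i a) (squash i b) (squash i c) (squash i d)"
    by blast
  have Ea: "E a b c d = square_grid G \<alpha> a b c d" if "{a, b, c, d} \<subseteq> {0, 1}" "a \<le> b" "c \<le> d" for a b c d
    using extE[of 2 a b c d] that by (auto simp: A_def squash_def)
  have Ef: "E a b c d = square_grid G (idn (sqv G) f) (a div 2) (b div 2) (c div 2) (d div 2)"
    if "{a, b, c, d} \<subseteq> {0, 2}" "a \<le> b" "c \<le> d" for a b c d
    using extE[of 1 a b c d] that by (auto simp: A_def squash_def)
  \<comment> \<open>Face 1 is \<open>E\<close>, as \<open>a - 1\<close> maps \<open>0, 2, 3\<close>
    onto \<open>0, 1, 2\<close>. Face 3 is \<open>\<alpha>\<close> with columns \<open>1, 2\<close>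
    and rows \<open>0, 1\<close> merged, so that \<open>\<alpha>\<close> sits at columns
    \<open>0, 1\<close> and rows \<open>1, 2\<close>. Face 2 is constant in the rows.\<close>
  define F where "F i a b c d =
     (if i = 1 then E (a - 1) (b - 1) (c - 1) (d - 1)
      else if i = 2 then square_grid G (idn (sqv G) f) (min a 1) (min b 1) 0 0
      else square_grid G \<alpha> (min a 1) (min b 1) (c - 1) (d - 1))" for i a b c d :: nat
  have "grid_family G ({..3} - {0}) (\<lambda>i. {..3} - {i}) (\<lambda>i. {..3} - {i}) F"
    unfolding grid_family_def
  proof (intro conjI ballI impI)
    fix i :: nat assume "i \<in> {..3} - {0}"
    then consider "i = 1" | "i = 2" | "i = 3" by force
    then show "grid G (\<le>) (\<le>) ({..3} - {i}) ({..3} - {i}) (F i)"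
    proof cases
      case 1
      have "(\<lambda>a. a - 1) \<in> {..3} - {1} \<rightarrow> {..2 :: nat}" by auto
      with 1 show ?thesis
        using grid_pullback[OF E, of "\<lambda>a. a - 1" "{..3} - {1}" "\<lambda>a. a - 1" "{..3} - {1}" "(\<le>)" "(\<le>)"]
        unfolding F_def by (simp add: diff_le_mono)
    next
      case 2
      have "(\<lambda>a. min a 1) \<in> {..3} - {2} \<rightarrow> {..1 :: nat}" by auto
      with 2 show ?thesis
        using grid_pullback[OF grid_square_grid[OF idnv_square[OF f]],
            of "\<lambda>a. min a 1" "{..3} - {2}" "\<lambda>_. 0" "{..3} - {2}" "(\<le>)" "(\<le>)"]
        unfolding F_def by (simp add: min.coboundedI1)
    next
      case 3
      have "(\<lambda>a. min a 1) \<in> {..3} - {3} \<rightarrow> {..1 :: nat}" "(\<lambda>a. a - 1) \<in> {..3} - {3} \<rightarrow> {..1 :: nat}"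
        by auto
      with 3 show ?thesis
        using grid_pullback[OF grid_square_grid[OF \<alpha>],
            of "\<lambda>a. min a 1" "{..3} - {3}" "\<lambda>a. a - 1" "{..3} - {3}" "(\<le>)" "(\<le>)"]
        unfolding F_def by (simp add: min.coboundedI1 diff_le_mono)
    qed
  next
    \<comment> \<open>Faces meet in the vertices \<open>0, 3\<close>, \<open>0, 2\<close> or
      \<open>0, 1\<close>. The first two overlaps are the two prescribed faces of \<open>E\<close>;
      in the last, all rows of face 3 are collapsed to row 0 of \<open>\<alpha>\<close>.\<close>
    have 12: "F 1 a b c d = F 2 a b c d" if "{a, b, c, d} \<subseteq> {0, 3}" "a \<le> b" "c \<le> d" for a b c d
      using that Ef[of "a - 1" "b - 1" "c - 1" "d - 1"] top[of "c div 3" "d div 3" "min a 1" "min b 1"]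
        top[of 0 0 "min a 1" "min b 1"] by (auto simp: F_def)
    have 13: "F 1 a b c d = F 3 a b c d" if "{a, b, c, d} \<subseteq> {0, 2}" "a \<le> b" "c \<le> d" for a b c d
      using that Ea[of "a - 1" "b - 1" "c - 1" "d - 1"] by (auto simp: F_def)
    have 23: "F 2 a b c d = F 3 a b c d" if "{a, b, c, d} \<subseteq> {0, 1}" "a \<le> b" "c \<le> d" for a b c d
      using that top[of 0 0 "min a 1" "min b 1"] by (auto simp: F_def)
    fix i j a b c d :: nat
    assume ij: "i \<in> {..3} - {0}" "j \<in> {..3} - {0}"
      and abcd: "a \<in> ({..3} - {i}) \<inter> ({..3} - {j})" "b \<in> ({..3} - {i}) \<inter> ({..3} - {j})"
      "c \<in> ({..3} - {i}) \<inter> ({..3} - {j})" "d \<in> ({..3} - {i}) \<inter> ({..3} - {j})" "a \<le> b" "c \<le> d"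
    have *: "x = 0 \<or> x = 1 \<or> x = 2 \<or> x = 3" if "x \<le> 3" for x :: nat using that by linarith
    have sub: "{a, b, c, d} \<subseteq> {0, y}" if "{i, j} \<union> {0, y} = {0, 1, 2, 3}" for y
    proof -
      have "x \<in> {0, y}" if "x \<in> ({..3} - {i}) \<inter> ({..3} - {j})" for x
      proof -
        have "x \<in> {i, j} \<union> {0, y}" unfolding \<open>{i, j} \<union> {0, y} = _\<close> using that *[of x] by simp
        then show ?thesis using that by simp
      qed
      then show ?thesis using abcd(1-4) by simp
    qed
    have "i = j \<or> (i = 1 \<and> j = 2) \<or> (i = 1 \<and> j = 3) \<or> (i = 2 \<and> j = 3) \<or>
        (i = 2 \<and> j = 1) \<or> (i = 3 \<and> j = 1) \<or> (i = 3 \<and> j = 2)"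
      using ij *[of i] *[of j] by auto
    then show "F i a b c d = F j a b c d"
      using 12[OF sub[of 3] abcd(5,6)] 13[OF sub[of 2] abcd(5,6)] 23[OF sub[of 1] abcd(5,6)]
      by (elim disjE conjE; simp add: insert_commute)
  qed
  from fillableE[OF fill3 this] obtain F' where F': "grid G (\<le>) (\<le>) {..3} {..3} F'"
    and ext: "\<And>i a b c d. \<lbrakk>i \<in> {..3} - {0}; a \<in> {..3} - {i}; b \<in> {..3} - {i}; c \<in> {..3} - {i};
      d \<in> {..3} - {i}; a \<le> b; c \<le> d\<rbrakk> \<Longrightarrow> F' a b c d = F i a b c d" by blast
  have "F' 0 1 1 2 = \<alpha>"
    using ext[of 3 0 1 1 2] by (simp add: F_def square_grid_def arrow_chain_def)
  moreover have "F' 0 1 1 3 = idn (sqv G) f"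
    using ext[of 2 0 1 1 3] square_grid_idnv[OF f] by (simp add: F_def arrow_chain_def)
  moreover have "src (sqv G) (F' 0 1 1 2) = tgt (sqv G) (F' 0 1 2 3)"
    "F' 0 1 1 3 = cmp (sqv G) (F' 0 1 1 2) (F' 0 1 2 3)"
    using chain_src[OF grid_chain_v[OF F', of 0 1], of 1 2 3]
      chain_cmp[OF grid_chain_v[OF F', of 0 1], of 1 2 3] by simp_all
  moreover have "F' 0 1 2 3 \<in> squares G" using grid_square[OF F'] by simp
  ultimately show ?thesis unfolding f_def by (metis (no_types))
qed

end

section \<open>The equivalences at the level of grids\<close>

definition diag_fillable :: "('o, 'h, 'v, 'c) dcat \<Rightarrow> bool" where
  "diag_fillable G \<longleftrightarrow>
     (\<forall>n\<ge>1. \<forall>k\<le>n. fillable G n n ({..n} - {k}) (\<lambda>i. {..n} - {i}) (\<lambda>i. {..n} - {i}))"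

definition extension_fillable :: "('o, 'h, 'v, 'c) dcat \<Rightarrow> bool" where
  "extension_fillable G \<longleftrightarrow>
     (\<forall>n\<ge>1. \<forall>k\<le>n. \<forall>p. fillable G p n ({..n} - {k}) (\<lambda>_. {..p}) (\<lambda>i. {..n} - {i})) \<and>
     (\<forall>n\<ge>1. \<forall>k\<le>n. \<forall>q. fillable G n q ({..n} - {k}) (\<lambda>i. {..n} - {i}) (\<lambda>_. {..q})) \<and>
     (\<forall>p\<ge>1. \<forall>q\<ge>1. \<forall>k\<le>p. \<forall>l\<le>q. fillable G p q (({..p} - {k}) <+> ({..q} - {l}))
       (case_sum (\<lambda>i. {..p} - {i}) (\<lambda>_. {..p})) (case_sum (\<lambda>_. {..q}) (\<lambda>j. {..q} - {j})))"

lemma (in double_groupoid) diag_fillable_and_extension_fillable: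
  assumes "filling_condition G"
  shows "diag_fillable G" "extension_fillable G"
proof -
  have ne: "{..n} - {k} \<noteq> {}" if "n \<ge> 1" for n k :: nat
  proof -
    have "(if k = 0 then 1 else 0) \<in> {..n} - {k}" using that by auto
    then show ?thesis by blast
  qed
  show "diag_fillable G" unfolding diag_fillable_def
  proof (intro allI impI)
    fix n k :: nat assume "1 \<le> n" "k \<le> n"
    then show "fillable G n n ({..n} - {k}) (\<lambda>i. {..n} - {i}) (\<lambda>i. {..n} - {i})"
      using ne by (intro fillable_if_common_base[OF assms, of _ k _ k]) auto
  qed
  show "extension_fillable G" unfolding extension_fillable_def
  proof (intro conjI allI impI)
    fix n k p :: nat assume "1 \<le> n" "k \<le> n"
    then show "fillable G p n ({..n} - {k}) (\<lambda>_. {..p}) (\<lambda>i. {..n} - {i})"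
      "fillable G n p ({..n} - {k}) (\<lambda>i. {..n} - {i}) (\<lambda>_. {..p})"
      \<comment> \<open>In the direction that is not a horn every face is full, so index 0 serves as
        base; in the other one it is \<open>k\<close>.\<close>
      using ne by (intro fillable_if_common_base[OF assms, of _ 0 _ k]
          fillable_if_common_base[OF assms, of _ k _ 0]; auto)+
  next
    fix p q k l :: nat assume "1 \<le> p" "1 \<le> q" "k \<le> p" "l \<le> q"
    then show "fillable G p q (({..p} - {k}) <+> ({..q} - {l}))
       (case_sum (\<lambda>i. {..p} - {i}) (\<lambda>_. {..p})) (case_sum (\<lambda>_. {..q}) (\<lambda>j. {..q} - {j}))"
      using ne[of p k] by (intro fillable_if_common_base[OF assms, of _ k _ l]) auto
  qed
qed

context double_category
begin

interpretation tr: double_category "transpose G" by (rule double_category_transpose)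

text \<open>The diagonal problems are symmetric in the two directions, so the vertical argument in
  the transpose yields the horizontal inverses.\<close>

lemma double_groupoid_if_diag_fillable:
  assumes "diag_fillable G"
  shows "double_groupoid G \<and> filling_condition G"
proof -
  have d: "fillable G n n ({..n} - {k}) (\<lambda>i. {..n} - {i}) (\<lambda>i. {..n} - {i})" if "n \<ge> 1" "k \<le> n" for n k
    using assms that unfolding diag_fillable_def by blast
  show ?thesis
    using filling_if_fillable_diag[OF d] right_inverse_v_diag[OF d d]
      tr.right_inverse_v_diag[OF fillable_transpose[OF d] fillable_transpose[OF d]]
    by (intro conjI double_groupoid_if_right_inverses) (simp_all add: arr_sqv)
qed

text \<open>2-horns in one direction, of width 1 in the other, give the inverses; the smallest
  bihorn gives the filling condition.\<close>

lemma double_groupoid_if_extension_fillable: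
  assumes "extension_fillable G"
  shows "double_groupoid G \<and> filling_condition G"
proof -
  have h: "fillable G 2 1 ({..2} - {0}) (\<lambda>i. {..2} - {i}) (\<lambda>_. {..1})"
    and v: "fillable G 1 2 ({..2} - {0}) (\<lambda>_. {..1}) (\<lambda>i. {..2} - {i})"
    and b: "fillable G 1 1 (({..1} - {1}) <+> ({..1} - {0}))
       (case_sum (\<lambda>i. {..1} - {i}) (\<lambda>_. {..1})) (case_sum (\<lambda>_. {..1}) (\<lambda>j. {..1} - {j}))"
    using assms[unfolded extension_fillable_def, THEN conjunct2, THEN conjunct1, rule_format, of 2 0 1]
      assms[unfolded extension_fillable_def, THEN conjunct1, rule_format, of 2 0 1]
      assms[unfolded extension_fillable_def, THEN conjunct2, THEN conjunct2, rule_format, of 1 1 1 0]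
    by simp_all
  show ?thesis
    using filling_if_fillable_bihorn[OF b] right_inverse_h[OF h] tr.right_inverse_h[OF fillable_transpose[OF v]]
    by (intro conjI double_groupoid_if_right_inverses) (simp_all add: arr_sqv)
qed

lemma double_groupoid_filling_iff:
  "double_groupoid G \<and> filling_condition G \<longleftrightarrow> diag_fillable G"
  "double_groupoid G \<and> filling_condition G \<longleftrightarrow> extension_fillable G"
  using double_groupoid_if_diag_fillable double_groupoid_if_extension_fillable
    double_groupoid.diag_fillable_and_extension_fillable by blast+

end

section \<open>Extension of maps from generated subobjects\<close>

lemma ord_mapsD:
  assumes "\<alpha> \<in> ord_maps m n"
  shows ord_maps_le: "a \<le> m \<Longrightarrow> \<alpha> a \<le> n"
    and ord_maps_mono: "\<lbrakk>a \<le> b; b \<le> m\<rbrakk> \<Longrightarrow> \<alpha> a \<le> \<alpha> b"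
    and ord_maps_ext: "\<alpha> \<in> extensional {..m}"
  using assms unfolding ord_maps_def mono_on_def by (auto simp: PiE_def)

lemma ord_mapsI:
  assumes "\<And>a. a \<le> m \<Longrightarrow> \<alpha> a \<le> n" "\<And>a b. \<lbrakk>a \<le> b; b \<le> m\<rbrakk> \<Longrightarrow> \<alpha> a \<le> \<alpha> b"
    "\<alpha> \<in> extensional {..m}"
  shows "\<alpha> \<in> ord_maps m n"
  using assms unfolding ord_maps_def mono_on_def by (auto simp: PiE_def)

lemma ord_comp_apply: "a \<le> l \<Longrightarrow> ord_comp l \<alpha> \<beta> a = \<alpha> (\<beta> a)"
  by (simp add: ord_comp_def compose_def)

lemma ord_comp_extensional: "ord_comp l \<alpha> \<beta> \<in> extensional {..l}"
  by (simp add: ord_comp_def)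

lemma ord_comp_in: "\<alpha> \<in> ord_maps m n \<Longrightarrow> \<beta> \<in> ord_maps l m \<Longrightarrow> ord_comp l \<alpha> \<beta> \<in> ord_maps l n"
  by (rule ord_mapsI) (auto simp: ord_comp_apply ord_mapsD ord_comp_extensional)

lemma ord_id_in: "ord_id n \<in> ord_maps n n"
  by (rule ord_mapsI) (auto simp: ord_id_def)

lemma ord_id_apply: "a \<le> n \<Longrightarrow> ord_id n a = a"
  by (simp add: ord_id_def)

lemma ord_comp_eqI:
  assumes "\<And>a. a \<le> l \<Longrightarrow> \<alpha> (\<beta> a) = \<gamma> (\<delta> a)"
  shows "ord_comp l \<alpha> \<beta> = ord_comp l \<gamma> \<delta>"
  unfolding ord_comp_def compose_def using assms by (intro restrict_ext) auto

lemma ord_comp_id_right: "\<alpha> \<in> ord_maps m n \<Longrightarrow> ord_comp m \<alpha> (ord_id m) = \<alpha>"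
  by (rule extensionalityI[of _ "{..m}"]) (auto simp: ord_comp_apply ord_id_apply ord_maps_ext ord_comp_extensional)

lemma ord_comp_id_left: "\<alpha> \<in> ord_maps m n \<Longrightarrow> ord_comp m (ord_id n) \<alpha> = \<alpha>"
  by (rule extensionalityI[of _ "{..m}"])
    (auto simp: ord_comp_apply ord_id_apply ord_maps_ext ord_maps_le ord_comp_extensional)

lemma ord_comp_assoc:
  "\<beta> \<in> ord_maps l m \<Longrightarrow> \<gamma> \<in> ord_maps k l \<Longrightarrow>
    ord_comp k (ord_comp l \<alpha> \<beta>) \<gamma> = ord_comp k \<alpha> (ord_comp k \<beta> \<gamma>)"
  by (rule ord_comp_eqI) (auto simp: ord_comp_apply ord_maps_le)

lemma coface_in: "1 \<le> n \<Longrightarrow> coface n i \<in> ord_maps (n - 1) n"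
  by (rule ord_mapsI) (auto simp: coface_def)

lemma inj_on_coface: "inj_on (coface n i) {..n - 1}"
  by (rule inj_onI) (auto simp: coface_def split: if_splits)

lemma coface_image:
  assumes "1 \<le> n" "i \<le> n"
  shows "coface n i ` {..n - 1} = {..n} - {i}"
proof
  show "coface n i ` {..n - 1} \<subseteq> {..n} - {i}" using assms by (auto simp: coface_def)
  show "{..n} - {i} \<subseteq> coface n i ` {..n - 1}"
  proof
    fix a assume "a \<in> {..n} - {i}"
    then have "a = coface n i (if a < i then a else a - 1)" "(if a < i then a else a - 1) \<in> {..n - 1}"
      using assms by (auto simp: coface_def)
    then show "a \<in> coface n i ` {..n - 1}" by blast
  qed
qed

text \<open>A map from the subobject of a representable generated by a family of simplices amounts to a
  compatible family of simplices, and it extends to the representable iff the members of the family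
  are the restrictions of one simplex.\<close>

definition compatible ::
  "'x sset \<Rightarrow> 't set \<Rightarrow> ('t \<Rightarrow> nat) \<Rightarrow> ('t \<Rightarrow> nat \<Rightarrow> nat) \<Rightarrow> ('t \<Rightarrow> 'x) \<Rightarrow> bool" where
  "compatible K T P s y \<longleftrightarrow>
     (\<forall>t\<in>T. y t \<in> simplices K (P t)) \<and>
     (\<forall>t\<in>T. \<forall>t'\<in>T. \<forall>m. \<forall>\<alpha>\<in>ord_maps m (P t). \<forall>\<alpha>'\<in>ord_maps m (P t').
        ord_comp m (s t) \<alpha> = ord_comp m (s t') \<alpha>' \<longrightarrow> act K m (P t) \<alpha> (y t) = act K m (P t') \<alpha>' (y t'))"

lemma (in simplicial_set) extends_generated_iff:
  assumes s: "\<And>t. t \<in> T \<Longrightarrow> s t \<in> ord_maps (P t) n"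
  defines "H \<equiv> sset_generated (std_simplex n) ((\<lambda>t. (P t, s t)) ` T)"
  shows "(\<forall>f. simplicial_map H K f \<longrightarrow> (\<exists>g. simplicial_map (std_simplex n) K g \<and>
            (\<forall>m. \<forall>x\<in>simplices H m. g m x = f m x))) \<longleftrightarrow>
         (\<forall>y. compatible K T P s y \<longrightarrow> (\<exists>z\<in>simplices K n. \<forall>t\<in>T. act K (P t) n (s t) z = y t))"
    (is "?L \<longleftrightarrow> ?R")
proof
  have H: "simplices H m = {ord_comp m (s t) \<alpha> | t \<alpha>. t \<in> T \<and> \<alpha> \<in> ord_maps m (P t)}" for m
    unfolding H_def sset_generated_def std_simplex_def by auto
  have actH: "act H l m \<alpha> x = ord_comp l x \<alpha>" for l m \<alpha> x
    unfolding H_def sset_generated_def std_simplex_def by simp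
  have sH: "s t \<in> simplices H (P t)" if "t \<in> T" for t
    using that ord_comp_id_right[OF s[OF that]] ord_id_in[of "P t"] unfolding H by force
  { assume L: ?L
    show ?R
    proof (intro allI impI)
      fix y assume y: "compatible K T P s y"
      then have yK: "y t \<in> simplices K (P t)" if "t \<in> T" for t
        using that unfolding compatible_def by blast
      \<comment> \<open>A simplex may factor through several generators; compatibility makes the
        value independent of the chosen factorization.\<close>
      define f where "f m \<gamma> = (SOME x. \<exists>t \<alpha>. t \<in> T \<and> \<alpha> \<in> ord_maps m (P t) \<and>
        \<gamma> = ord_comp m (s t) \<alpha> \<and> x = act K m (P t) \<alpha> (y t))" for m \<gamma>
      have f: "f m (ord_comp m (s t) \<alpha>) = act K m (P t) \<alpha> (y t)"
        if "t \<in> T" "\<alpha> \<in> ord_maps m (P t)" for m t \<alpha>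
        unfolding f_def
      proof (rule some_equality)
        fix x assume "\<exists>t' \<alpha>'. t' \<in> T \<and> \<alpha>' \<in> ord_maps m (P t') \<and>
          ord_comp m (s t) \<alpha> = ord_comp m (s t') \<alpha>' \<and> x = act K m (P t') \<alpha>' (y t')"
        then show "x = act K m (P t) \<alpha> (y t)" using y that unfolding compatible_def by metis
      qed (use that in blast)
      have "simplicial_map H K f"
        unfolding simplicial_map_def
      proof (intro conjI allI ballI)
        fix m \<gamma> assume "\<gamma> \<in> simplices H m"
        then obtain t \<alpha> where "t \<in> T" "\<alpha> \<in> ord_maps m (P t)" "\<gamma> = ord_comp m (s t) \<alpha>" unfolding H by blast
        then show "f m \<gamma> \<in> simplices K m" using f act_closed yK by simp
      next
        fix l m \<beta> \<gamma> assume \<beta>: "\<beta> \<in> ord_maps l m" and "\<gamma> \<in> simplices H m"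
        then obtain t \<alpha> where *: "t \<in> T" "\<alpha> \<in> ord_maps m (P t)" "\<gamma> = ord_comp m (s t) \<alpha>" unfolding H by blast
        show "f l (act H l m \<beta> \<gamma>) = act K l m \<beta> (f m \<gamma>)"
          using * \<beta> yK f ord_comp_in[OF *(2) \<beta>] act_comp by (simp add: actH ord_comp_assoc)
      qed
      with L obtain g where g: "simplicial_map (std_simplex n) K g" "\<forall>m. \<forall>x\<in>simplices H m. g m x = f m x"
        by blast
      show "\<exists>z\<in>simplices K n. \<forall>t\<in>T. act K (P t) n (s t) z = y t"
      proof (intro bexI ballI)
        \<comment> \<open>Yoneda: a map out of the representable is its value at the
          identity.\<close>
        show "g n (ord_id n) \<in> simplices K n"
          using g(1) ord_id_in unfolding simplicial_map_def std_simplex_def by simp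
        fix t assume t: "t \<in> T"
        have "act K (P t) n (s t) (g n (ord_id n)) = g (P t) (ord_comp (P t) (ord_id n) (s t))"
          using g(1) ord_id_in s[OF t] unfolding simplicial_map_def std_simplex_def by simp
        also have "\<dots> = f (P t) (s t)" using g(2) sH[OF t] ord_comp_id_left[OF s[OF t]] by simp
        also have "\<dots> = y t"
          using f[OF t ord_id_in] ord_comp_id_right[OF s[OF t]] act_id[OF yK[OF t]] by simp
        finally show "act K (P t) n (s t) (g n (ord_id n)) = y t" .
      qed
    qed
  }
  { assume R: ?R
    show ?L
    proof (intro allI impI)
      fix f assume f: "simplicial_map H K f"
      have f': "act K m (P t) \<alpha> (f (P t) (s t)) = f m (ord_comp m (s t) \<alpha>)"
        if "t \<in> T" "\<alpha> \<in> ord_maps m (P t)" for m t \<alpha>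
      proof -
        have "f m (act H m (P t) \<alpha> (s t)) = act K m (P t) \<alpha> (f (P t) (s t))"
          using f sH[OF that(1)] that(2) unfolding simplicial_map_def by blast
        then show ?thesis by (simp add: actH)
      qed
      have "f (P t) (s t) \<in> simplices K (P t)" if "t \<in> T" for t
        using f sH[OF that] unfolding simplicial_map_def by blast
      then have "compatible K T P s (\<lambda>t. f (P t) (s t))"
        unfolding compatible_def using f' by simp
      with R obtain z where z: "z \<in> simplices K n" "\<forall>t\<in>T. act K (P t) n (s t) z = f (P t) (s t)" by blast
      have "simplicial_map (std_simplex n) K (\<lambda>m \<alpha>. act K m n \<alpha> z)"
        unfolding simplicial_map_def std_simplex_def using z act_closed act_comp by simp
      moreover have "act K m n x z = f m x" if x: "x \<in> simplices H m" for m x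
      proof -
        obtain t \<alpha> where *: "t \<in> T" "\<alpha> \<in> ord_maps m (P t)" "x = ord_comp m (s t) \<alpha>" using x unfolding H by blast
        then show ?thesis using act_comp[OF s[OF *(1)] *(2) z(1)] z(2) f' by simp
      qed
      ultimately show "\<exists>g. simplicial_map (std_simplex n) K g \<and> (\<forall>m. \<forall>x\<in>simplices H m. g m x = f m x)"
        by (intro exI[of _ "\<lambda>m \<alpha>. act K m n \<alpha> z"]) blast
    qed
  }
qed

lemma (in simplicial_set) kan_complex_iff:
  "kan_complex K \<longleftrightarrow> (\<forall>n\<ge>1. \<forall>k\<le>n. \<forall>y. compatible K ({..n} - {k}) (\<lambda>_. n - 1) (coface n) y \<longrightarrow>
     (\<exists>z\<in>simplices K n. \<forall>i\<in>{..n} - {k}. act K (n - 1) n (coface n i) z = y i))"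
proof -
  have horn: "horn n k = sset_generated (std_simplex n) ((\<lambda>i. (n - 1, coface n i)) ` ({..n} - {k}))" for n k
    unfolding horn_def by (rule arg_cong[of _ _ "sset_generated _"]) auto
  have "kan_complex K \<longleftrightarrow> (\<forall>n\<ge>1. \<forall>k\<le>n. \<forall>f. simplicial_map (horn n k) K f \<longrightarrow>
      (\<exists>g. simplicial_map (std_simplex n) K g \<and> (\<forall>m. \<forall>x\<in>simplices (horn n k) m. g m x = f m x)))"
    using simplicial_set_axioms unfolding kan_complex_def kan_complex_axioms_def by blast
  also have "\<dots> \<longleftrightarrow> (\<forall>n\<ge>1. \<forall>k\<le>n. \<forall>y. compatible K ({..n} - {k}) (\<lambda>_. n - 1) (coface n) y \<longrightarrow>
     (\<exists>z\<in>simplices K n. \<forall>i\<in>{..n} - {k}. act K (n - 1) n (coface n i) z = y i))"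
    unfolding horn by (simp only: extends_generated_iff[OF coface_in] cong: imp_cong)
  finally show ?thesis .
qed

definition bicompatible :: "'x bisset \<Rightarrow> 't set \<Rightarrow> ('t \<Rightarrow> nat) \<Rightarrow> ('t \<Rightarrow> nat) \<Rightarrow>
    ('t \<Rightarrow> nat \<Rightarrow> nat) \<Rightarrow> ('t \<Rightarrow> nat \<Rightarrow> nat) \<Rightarrow> ('t \<Rightarrow> 'x) \<Rightarrow> bool" where
  "bicompatible K T P Q s r y \<longleftrightarrow>
     (\<forall>t\<in>T. y t \<in> bisimplices K (P t) (Q t)) \<and>
     (\<forall>t\<in>T. \<forall>t'\<in>T. \<forall>m n. \<forall>\<alpha>\<in>ord_maps m (P t). \<forall>\<alpha>'\<in>ord_maps m (P t').
        \<forall>\<beta>\<in>ord_maps n (Q t). \<forall>\<beta>'\<in>ord_maps n (Q t').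
        ord_comp m (s t) \<alpha> = ord_comp m (s t') \<alpha>' \<longrightarrow> ord_comp n (r t) \<beta> = ord_comp n (r t') \<beta>' \<longrightarrow>
        biact K m (P t) n (Q t) \<alpha> \<beta> (y t) = biact K m (P t') n (Q t') \<alpha>' \<beta>' (y t'))"

lemma (in bisimplicial_set) extends_generated_iff:
  assumes s: "\<And>t. t \<in> T \<Longrightarrow> s t \<in> ord_maps (P t) p" and r: "\<And>t. t \<in> T \<Longrightarrow> r t \<in> ord_maps (Q t) q"
  defines "H \<equiv> bisset_generated (std_bisimplex p q) ((\<lambda>t. (P t, Q t, s t, r t)) ` T)"
  shows "(\<forall>f. bisimplicial_map H K f \<longrightarrow> (\<exists>g. bisimplicial_map (std_bisimplex p q) K g \<and>
            (\<forall>m n. \<forall>x\<in>bisimplices H m n. g m n x = f m n x))) \<longleftrightarrow>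
         (\<forall>y. bicompatible K T P Q s r y \<longrightarrow>
            (\<exists>z\<in>bisimplices K p q. \<forall>t\<in>T. biact K (P t) p (Q t) q (s t) (r t) z = y t))"
    (is "?L \<longleftrightarrow> ?R")
proof
  have H: "bisimplices H m n = {(ord_comp m (s t) \<alpha>, ord_comp n (r t) \<beta>) | t \<alpha> \<beta>.
      t \<in> T \<and> \<alpha> \<in> ord_maps m (P t) \<and> \<beta> \<in> ord_maps n (Q t)}" for m n
    unfolding H_def bisset_generated_def std_bisimplex_def by (fastforce simp: image_iff)
  have actH: "biact H k m l n \<alpha> \<beta> (x, x') = (ord_comp k x \<alpha>, ord_comp l x' \<beta>)" for k l m n \<alpha> \<beta> x x'
    unfolding H_def bisset_generated_def std_bisimplex_def by simp
  have sH: "(s t, r t) \<in> bisimplices H (P t) (Q t)" if "t \<in> T" for t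
    using that ord_comp_id_right[OF s[OF that]] ord_id_in[of "P t"]
      ord_comp_id_right[OF r[OF that]] ord_id_in[of "Q t"] unfolding H by force
  { assume L: ?L
    show ?R
    proof (intro allI impI)
      fix y assume y: "bicompatible K T P Q s r y"
      then have yK: "y t \<in> bisimplices K (P t) (Q t)" if "t \<in> T" for t
        using that unfolding bicompatible_def by blast
      define f where "f m n \<gamma> = (SOME x. \<exists>t \<alpha> \<beta>. t \<in> T \<and> \<alpha> \<in> ord_maps m (P t) \<and> \<beta> \<in> ord_maps n (Q t) \<and>
        \<gamma> = (ord_comp m (s t) \<alpha>, ord_comp n (r t) \<beta>) \<and> x = biact K m (P t) n (Q t) \<alpha> \<beta> (y t))" for m n \<gamma>
      have f: "f m n (ord_comp m (s t) \<alpha>, ord_comp n (r t) \<beta>) = biact K m (P t) n (Q t) \<alpha> \<beta> (y t)"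
        if "t \<in> T" "\<alpha> \<in> ord_maps m (P t)" "\<beta> \<in> ord_maps n (Q t)" for m n t \<alpha> \<beta>
        unfolding f_def
      proof (rule some_equality)
        fix x assume "\<exists>t' \<alpha>' \<beta>'. t' \<in> T \<and> \<alpha>' \<in> ord_maps m (P t') \<and> \<beta>' \<in> ord_maps n (Q t') \<and>
          (ord_comp m (s t) \<alpha>, ord_comp n (r t) \<beta>) = (ord_comp m (s t') \<alpha>', ord_comp n (r t') \<beta>') \<and>
          x = biact K m (P t') n (Q t') \<alpha>' \<beta>' (y t')"
        then show "x = biact K m (P t) n (Q t) \<alpha> \<beta> (y t)" using y that unfolding bicompatible_def by (metis prod.inject)
      qed (use that in blast)
      have "bisimplicial_map H K f"
        unfolding bisimplicial_map_def
      proof (intro conjI allI ballI)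
        fix m n \<gamma> assume "\<gamma> \<in> bisimplices H m n"
        then obtain t \<alpha> \<beta> where "t \<in> T" "\<alpha> \<in> ord_maps m (P t)" "\<beta> \<in> ord_maps n (Q t)"
          "\<gamma> = (ord_comp m (s t) \<alpha>, ord_comp n (r t) \<beta>)" unfolding H by blast
        then show "f m n \<gamma> \<in> bisimplices K m n" using f biact_closed yK by simp
      next
        fix k m l n \<alpha>' \<beta>' \<gamma>
        assume a: "\<alpha>' \<in> ord_maps k m" "\<beta>' \<in> ord_maps l n" and "\<gamma> \<in> bisimplices H m n"
        then obtain t \<alpha> \<beta> where *: "t \<in> T" "\<alpha> \<in> ord_maps m (P t)" "\<beta> \<in> ord_maps n (Q t)"
          "\<gamma> = (ord_comp m (s t) \<alpha>, ord_comp n (r t) \<beta>)" unfolding H by blast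
        show "f k l (biact H k m l n \<alpha>' \<beta>' \<gamma>) = biact K k m l n \<alpha>' \<beta>' (f m n \<gamma>)"
          using * a yK f ord_comp_in[OF *(2) a(1)] ord_comp_in[OF *(3) a(2)] biact_comp
          by (simp add: actH ord_comp_assoc)
      qed
      with L obtain g where g: "bisimplicial_map (std_bisimplex p q) K g"
        "\<forall>m n. \<forall>x\<in>bisimplices H m n. g m n x = f m n x"
        by blast
      show "\<exists>z\<in>bisimplices K p q. \<forall>t\<in>T. biact K (P t) p (Q t) q (s t) (r t) z = y t"
      proof (intro bexI ballI)
        show "g p q (ord_id p, ord_id q) \<in> bisimplices K p q"
          using g(1) ord_id_in unfolding bisimplicial_map_def std_bisimplex_def by simp
        fix t assume t: "t \<in> T"
        have "biact K (P t) p (Q t) q (s t) (r t) (g p q (ord_id p, ord_id q)) =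
            g (P t) (Q t) (ord_comp (P t) (ord_id p) (s t), ord_comp (Q t) (ord_id q) (r t))"
          using g(1) ord_id_in s[OF t] r[OF t] unfolding bisimplicial_map_def std_bisimplex_def by simp
        also have "\<dots> = f (P t) (Q t) (s t, r t)"
          using g(2) sH[OF t] ord_comp_id_left[OF s[OF t]] ord_comp_id_left[OF r[OF t]] by simp
        also have "\<dots> = y t"
          using f[OF t ord_id_in ord_id_in] ord_comp_id_right[OF s[OF t]] ord_comp_id_right[OF r[OF t]]
            biact_id[OF yK[OF t]] by simp
        finally show "biact K (P t) p (Q t) q (s t) (r t) (g p q (ord_id p, ord_id q)) = y t" .
      qed
    qed
  }
  { assume R: ?R
    show ?L
    proof (intro allI impI)
      fix f assume f: "bisimplicial_map H K f"
      have f': "biact K m (P t) n (Q t) \<alpha> \<beta> (f (P t) (Q t) (s t, r t)) =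
          f m n (ord_comp m (s t) \<alpha>, ord_comp n (r t) \<beta>)"
        if "t \<in> T" "\<alpha> \<in> ord_maps m (P t)" "\<beta> \<in> ord_maps n (Q t)" for m n t \<alpha> \<beta>
      proof -
        have "f m n (biact H m (P t) n (Q t) \<alpha> \<beta> (s t, r t)) = biact K m (P t) n (Q t) \<alpha> \<beta> (f (P t) (Q t) (s t, r t))"
          using f sH[OF that(1)] that(2,3) unfolding bisimplicial_map_def by blast
        then show ?thesis by (simp add: actH)
      qed
      have "f (P t) (Q t) (s t, r t) \<in> bisimplices K (P t) (Q t)" if "t \<in> T" for t
        using f sH[OF that] unfolding bisimplicial_map_def by blast
      then have "bicompatible K T P Q s r (\<lambda>t. f (P t) (Q t) (s t, r t))"
        unfolding bicompatible_def using f' by simp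
      with R obtain z where z: "z \<in> bisimplices K p q"
        "\<forall>t\<in>T. biact K (P t) p (Q t) q (s t) (r t) z = f (P t) (Q t) (s t, r t)" by blast
      have "bisimplicial_map (std_bisimplex p q) K (\<lambda>m n (\<alpha>, \<beta>). biact K m p n q \<alpha> \<beta> z)"
        unfolding bisimplicial_map_def std_bisimplex_def using z biact_closed biact_comp by auto
      moreover have "(case x of (\<alpha>, \<beta>) \<Rightarrow> biact K m p n q \<alpha> \<beta> z) = f m n x"
        if x: "x \<in> bisimplices H m n" for m n x
      proof -
        obtain t \<alpha> \<beta> where *: "t \<in> T" "\<alpha> \<in> ord_maps m (P t)" "\<beta> \<in> ord_maps n (Q t)"
          "x = (ord_comp m (s t) \<alpha>, ord_comp n (r t) \<beta>)" using x unfolding H by blast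
        then show ?thesis
          using biact_comp[OF s[OF *(1)] r[OF *(1)] *(2,3) z(1)] z(2) f' by simp
      qed
      ultimately show "\<exists>g. bisimplicial_map (std_bisimplex p q) K g \<and>
          (\<forall>m n. \<forall>x\<in>bisimplices H m n. g m n x = f m n x)"
        by (intro exI[of _ "\<lambda>m n (\<alpha>, \<beta>). biact K m p n q \<alpha> \<beta> z"]) blast
    qed
  }
qed

lemma (in bisimplicial_set) simplicial_sets:
  "simplicial_set (fix_first K p)" "simplicial_set (fix_second K q)" "simplicial_set (diag K)"
  using biact_closed biact_id biact_comp[OF ord_id_in _ ord_id_in] biact_comp[OF _ ord_id_in _ ord_id_in]
    biact_comp ord_comp_id_left[OF ord_id_in] ord_id_in
  by (unfold_locales; simp add: fix_first_def fix_second_def diag_def)+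

section \<open>The double nerve in terms of grids\<close>

text \<open>An arrow \<open>(b, a)\<close> of the ordinal category runs down from \<open>b\<close>
  to \<open>a\<close>; the swap lets grids list the smaller index first.\<close>

definition cells where
  "cells X a b c d = on_sq X ((b, a), (d, c))"

text \<open>Edges and vertices are recovered as targets of degenerate squares. Restricting produces
  the \<open>undefined\<close> values that double functors have outside the carriers.\<close>

definition dfun_of_grid where
  "dfun_of_grid G p q F =
     (let D = cat_tensor (ord_cat p) (ord_cat q) in
      \<lparr>on_obj = restrict (\<lambda>(a, c). tgt (hor G) (tgt (sqv G) (F a a c c))) (obj (hor D)),
       on_hor = restrict (\<lambda>((b, a), c). tgt (sqv G) (F a b c c)) (arr (hor D)),
       on_ver = restrict (\<lambda>(a, (d, c)). tgt (sqh G) (F a a c d)) (arr (ver D)),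
       on_sq = restrict (\<lambda>((b, a), (d, c)). F a b c d) (squares D)\<rparr>)"

lemmas tensor_simps = cat_tensor_def ord_cat_def

lemma nerve_simps:
  "bisimplices (double_nerve G) p q = double_functors (cat_tensor (ord_cat p) (ord_cat q)) G"
  "biact (double_nerve G) m p n q \<alpha> \<beta> X =
     dfun_compose (cat_tensor (ord_cat m) (ord_cat n)) X (ord_tensor \<alpha> \<beta>)"
  by (simp_all add: double_nerve_def)

lemma cells_dfun_of_grid:
  "\<lbrakk>a \<le> b; b \<le> p; c \<le> d; d \<le> q\<rbrakk> \<Longrightarrow> cells (dfun_of_grid G p q F) a b c d = F a b c d"
  by (simp add: cells_def dfun_of_grid_def tensor_simps)

lemma dfun_of_grid_cong:
  assumes "\<And>a b c d. \<lbrakk>a \<le> b; b \<le> p; c \<le> d; d \<le> q\<rbrakk> \<Longrightarrow> F a b c d = F' a b c d"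
  shows "dfun_of_grid G p q F = dfun_of_grid G p q F'"
  unfolding dfun_of_grid_def Let_def using assms
  by (auto simp: tensor_simps intro!: restrict_ext)

lemma cells_biact:
  "\<lbrakk>a \<le> b; b \<le> m; c \<le> d; d \<le> n\<rbrakk> \<Longrightarrow>
     cells (biact (double_nerve G) m p n q \<alpha> \<beta> X) a b c d = cells X (\<alpha> a) (\<alpha> b) (\<beta> c) (\<beta> d)"
  by (simp add: nerve_simps dfun_compose_def cells_def compose_def ord_tensor_def tensor_simps)

lemma is_functorD:
  assumes "is_functor A B F0 F1"
  shows "a \<in> obj A \<Longrightarrow> F0 a \<in> obj B"
    and "f \<in> arr A \<Longrightarrow> F1 f \<in> arr B"
    and "f \<in> arr A \<Longrightarrow> src B (F1 f) = F0 (src A f)"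
    and "f \<in> arr A \<Longrightarrow> tgt B (F1 f) = F0 (tgt A f)"
    and "a \<in> obj A \<Longrightarrow> F1 (idn A a) = idn B (F0 a)"
    and "\<lbrakk>f \<in> arr A; g \<in> arr A; src A f = tgt A g\<rbrakk> \<Longrightarrow> F1 (cmp A f g) = cmp B (F1 f) (F1 g)"
  using assms unfolding is_functor_def by blast+

context double_category
begin

text \<open>A double functor is determined by its squares, since an edge is the target of the image
  of the identity square on it.\<close>

lemma grid_of_bisimplex:
  assumes "X \<in> bisimplices (double_nerve G) p q"
  shows "grid G (\<le>) (\<le>) {..p} {..q} (cells X)"
    and "X = dfun_of_grid G p q (cells X)"
proof -
  let ?D = "cat_tensor (ord_cat p) (ord_cat q)"
  have X: "is_functor (hor ?D) (hor G) (on_obj X) (on_hor X)"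
    "is_functor (sqh ?D) (sqh G) (on_ver X) (on_sq X)"
    "is_functor (sqv ?D) (sqv G) (on_hor X) (on_sq X)"
    and ext: "on_obj X \<in> extensional (obj (hor ?D))" "on_hor X \<in> extensional (arr (hor ?D))"
     "on_ver X \<in> extensional (arr (ver ?D))" "on_sq X \<in> extensional (squares ?D)"
    using assms unfolding nerve_simps double_functors_def by blast+
  have sq: "cells X a b c d \<in> squares G" "src (sqh G) (cells X a b c d) = on_ver X (b, (d, c))"
      "tgt (sqh G) (cells X a b c d) = on_ver X (a, (d, c))"
      "src (sqv G) (cells X a b c d) = on_hor X ((b, a), d)"
      "tgt (sqv G) (cells X a b c d) = on_hor X ((b, a), c)"
    if "a \<le> b" "b \<le> p" "c \<le> d" "d \<le> q" for a b c d
    using is_functorD(2-4)[OF X(2), of "((b, a), (d, c))"] is_functorD(3,4)[OF X(3), of "((b, a), (d, c))"] that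
    by (simp_all add: cells_def tensor_simps)
  have idh: "cells X a a c d = idn (sqh G) (on_ver X (a, (d, c)))" if "a \<le> p" "c \<le> d" "d \<le> q" for a c d
    using is_functorD(5)[OF X(2), of "(a, (d, c))"] that by (simp add: cells_def tensor_simps)
  have idv: "cells X a b c c = idn (sqv G) (on_hor X ((b, a), c))" if "a \<le> b" "b \<le> p" "c \<le> q" for a b c
    using is_functorD(5)[OF X(3), of "((b, a), c)"] that by (simp add: cells_def tensor_simps)
  have cmph: "cells X a e c d = cmp (sqh G) (cells X a b c d) (cells X b e c d)"
    if "a \<le> b" "b \<le> e" "e \<le> p" "c \<le> d" "d \<le> q" for a b c d e
    using is_functorD(6)[OF X(2), of "((b, a), (d, c))" "((e, b), (d, c))"] that
    by (simp add: cells_def tensor_simps)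
  have cmpv: "cells X a b c e = cmp (sqv G) (cells X a b c d) (cells X a b d e)"
    if "a \<le> b" "b \<le> p" "c \<le> d" "d \<le> e" "e \<le> q" for a b c d e
    using is_functorD(6)[OF X(3), of "((b, a), (d, c))" "((b, a), (e, d))"] that
    by (simp add: cells_def tensor_simps)
  show "grid G (\<le>) (\<le>) {..p} {..q} (cells X)"
    unfolding grid_def chain_def
  proof (intro conjI ballI impI)
    fix c d a b e assume abc: "c \<in> {..q}" "d \<in> {..q}" "c \<le> d" "a \<in> {..p}" "b \<in> {..p}" "e \<in> {..p}" "a \<le> b" "b \<le> e"
    show "src (sqh G) (cells X a b c d) = tgt (sqh G) (cells X b e c d)"
      using sq[of a b c d] sq[of b e c d] abc by simp
    show "cells X a e c d = cmp (sqh G) (cells X a b c d) (cells X b e c d)"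
      using cmph[of a b e c d] abc by simp
  next
    fix a b c d e assume abc: "a \<in> {..p}" "b \<in> {..p}" "a \<le> b" "c \<in> {..q}" "d \<in> {..q}" "e \<in> {..q}" "c \<le> d" "d \<le> e"
    show "src (sqv G) (cells X a b c d) = tgt (sqv G) (cells X a b d e)"
      using sq[of a b c d] sq[of a b d e] abc by simp
    show "cells X a b c e = cmp (sqv G) (cells X a b c d) (cells X a b d e)"
      using cmpv[of a b c d e] abc by simp
  next
    fix a c d assume "c \<in> {..q}" "d \<in> {..q}" "c \<le> d" "a \<in> {..p}"
    then show "cells X a a c d = idn (sqh G) (tgt (sqh G) (cells X a a c d))"
      using idh[of a c d] sq(3)[of a a c d] by simp
  next
    fix a b c assume "a \<in> {..p}" "b \<in> {..p}" "a \<le> b" "c \<in> {..q}"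
    then show "cells X a b c c = idn (sqv G) (tgt (sqv G) (cells X a b c c))"
      using idv[of a b c] sq(5)[of a b c c] by simp
  qed (simp_all add: sq(1) arr_sqv)
  have obj: "on_obj X (a, c) = tgt (hor G) (on_hor X ((a, a), c))" if "a \<le> p" "c \<le> q" for a c
    using is_functorD(4)[OF X(1), of "((a, a), c)"] that by (simp add: tensor_simps)
  show "X = dfun_of_grid G p q (cells X)"
  proof (rule dfun.equality)
    show "on_obj X = on_obj (dfun_of_grid G p q (cells X))"
      unfolding dfun_of_grid_def Let_def
      by (rule extensionalityI[OF ext(1)]) (auto simp: sq obj tensor_simps)
    show "on_hor X = on_hor (dfun_of_grid G p q (cells X))"
      unfolding dfun_of_grid_def Let_def
      by (rule extensionalityI[OF ext(2)]) (auto simp: sq tensor_simps)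
    show "on_ver X = on_ver (dfun_of_grid G p q (cells X))"
      unfolding dfun_of_grid_def Let_def
      by (rule extensionalityI[OF ext(3)]) (auto simp: sq tensor_simps)
    show "on_sq X = on_sq (dfun_of_grid G p q (cells X))"
      unfolding dfun_of_grid_def Let_def
      by (rule extensionalityI[OF ext(4)]) (auto simp: cells_def tensor_simps)
  qed simp
qed

text \<open>Each of the four category structures of \<open>[p] \<otimes> [q]\<close> is a disjoint
  union, indexed by \<open>J\<close>, of copies of an ordinal category. With the naming functions
  \<open>ob\<close> and \<open>ar\<close> left open, one proof covers all four functors.\<close>

lemma functor_of_chains:
  assumes A: "category A" and f: "\<And>c. c \<in> J \<Longrightarrow> chain A (\<le>) {..p} (\<lambda>a b. f a b c)"
    and F0: "\<And>a c. \<lbrakk>a \<le> p; c \<in> J\<rbrakk> \<Longrightarrow> F0 (ob a c) = tgt A (f a a c)"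
    and F1: "\<And>a b c. \<lbrakk>a \<le> b; b \<le> p; c \<in> J\<rbrakk> \<Longrightarrow> F1 (ar a b c) = f a b c"
    and D: "obj D = {ob a c |a c. a \<le> p \<and> c \<in> J}" "arr D = {ar a b c |a b c. a \<le> b \<and> b \<le> p \<and> c \<in> J}"
      "\<And>a b c. src D (ar a b c) = ob b c" "\<And>a b c. tgt D (ar a b c) = ob a c"
      "\<And>a c. idn D (ob a c) = ar a a c"
      "\<And>a b e c. cmp D (ar a b c) (ar b e c) = ar a e c"
      "\<And>a b c d. ob a c = ob b d \<Longrightarrow> a = b \<and> c = d"
  shows "is_functor D A F0 F1"
proof -
  interpret A: category A by fact
  have arr: "f a b c \<in> arr A" and src: "src A (f a b c) = tgt A (f b b c)"
    and tgt: "tgt A (f a b c) = tgt A (f a a c)"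
    if "a \<le> b" "b \<le> p" "c \<in> J" for a b c
    using that chain_arr[OF f, of c a b] chain_src[OF f, of c a b b] chain_tgt[OF A f, of c a b] by auto
  have idn: "f a a c = idn A (tgt A (f a a c))" if "a \<le> p" "c \<in> J" for a c
    by (rule chain_idn[OF f]) (use that in auto)
  show ?thesis
    unfolding is_functor_def
  proof (intro conjI ballI impI)
    fix x assume "x \<in> obj D"
    then obtain a c where x: "x = ob a c" "a \<le> p" "c \<in> J" using D(1) by auto
    then show "F0 x \<in> obj A" using F0 arr A.tgt_obj by simp
    show "F1 (idn D x) = idn A (F0 x)" using x F0 F1 D(5) idn[of a c] by simp
  next
    fix x assume "x \<in> arr D"
    then obtain a b c where x: "x = ar a b c" "a \<le> b" "b \<le> p" "c \<in> J" using D(2) by auto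
    then show "F1 x \<in> arr A" "src A (F1 x) = F0 (src D x)" "tgt A (F1 x) = F0 (tgt D x)"
      using arr[of a b c] src[of a b c] tgt[of a b c] F0 F1 D(3,4) by simp_all
    fix y assume y: "y \<in> arr D" "src D x = tgt D y"
    then obtain b' e c' where y': "y = ar b' e c'" "b' \<le> e" "e \<le> p" using D(2) by auto
    then have "b' = b" "c' = c" using y(2) x(1) D(3,4) D(7)[of b c b' c'] by auto
    then show "F1 (cmp D x y) = cmp A (F1 x) (F1 y)"
      using x y' F1 D(6) chain_cmp[OF f, of c a b e] by simp
  qed
qed

lemma bisimplex_of_grid:
  assumes F: "grid G (\<le>) (\<le>) {..p} {..q} F"
  shows "dfun_of_grid G p q F \<in> bisimplices (double_nerve G) p q"
proof -
  interpret tr: double_category "transpose G" by (rule double_category_transpose)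
  note h = grid_chain_h[OF F] and v = grid_chain_v[OF F]
  let ?D = "cat_tensor (ord_cat p) (ord_cat q)" and ?X = "dfun_of_grid G p q F"
  have obj: "on_obj ?X (a, c) = tgt (hor G) (tgt (sqv G) (F a a c c))" if "a \<le> p" "c \<le> q" for a c
    using that by (simp add: dfun_of_grid_def tensor_simps)
  \<comment> \<open>Vertices were defined through horizontal edges; the functor on vertical edges
    reads them off the other boundary.\<close>
  have obj': "on_obj ?X (a, c) = tgt (ver G) (tgt (sqh G) (F a a c c))" if "a \<le> p" "c \<le> q" for a c
    using obj[OF that] tgt_tgt[OF grid_square[OF F, of a a c c]] that by simp
  have hor: "on_hor ?X ((b, a), c) = tgt (sqv G) (F a b c c)" if "a \<le> b" "b \<le> p" "c \<le> q" for a b c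
    using that by (simp add: dfun_of_grid_def tensor_simps)
  have ver: "on_ver ?X (a, (d, c)) = tgt (sqh G) (F a a c d)" if "a \<le> p" "c \<le> d" "d \<le> q" for a c d
    using that by (simp add: dfun_of_grid_def tensor_simps)
  have cell: "on_sq ?X ((b, a), (d, c)) = F a b c d" if "a \<le> b" "b \<le> p" "c \<le> d" "d \<le> q" for a b c d
    using that by (simp add: dfun_of_grid_def tensor_simps)
  have "is_functor (hor ?D) (hor G) (on_obj ?X) (on_hor ?X)"
  proof (rule functor_of_chains[where J = "{..q}" and p = p and ob = Pair and ar = "\<lambda>a b c. ((b, a), c)"
        and f = "\<lambda>a b c. tgt (sqv G) (F a b c c)", OF category_hor])
    fix c assume "c \<in> {..q}"
    then show "chain (hor G) (\<le>) {..p} (\<lambda>a b. tgt (sqv G) (F a b c c))"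
      using chain_srcv_tgtv(2)[OF h[of c c]] by simp
  qed (auto simp: obj hor tensor_simps)
  moreover have "is_functor (ver ?D) (ver G) (on_obj ?X) (on_ver ?X)"
  proof (rule functor_of_chains[where J = "{..p}" and p = q and ob = "\<lambda>c a. (a, c)"
        and ar = "\<lambda>c d a. (a, (d, c))" and f = "\<lambda>c d a. tgt (sqh G) (F a a c d)", OF category_ver])
    fix a assume "a \<in> {..p}"
    then show "chain (ver G) (\<le>) {..q} (\<lambda>c d. tgt (sqh G) (F a a c d))"
      using tr.chain_srcv_tgtv(2)[of "(\<le>)" "{..q}" "F a a"] v[of a a] by simp
  qed (auto simp: obj' ver tensor_simps)
  moreover have "is_functor (sqh ?D) (sqh G) (on_ver ?X) (on_sq ?X)"
  proof (rule functor_of_chains[where J = "{(d, c). c \<le> d \<and> d \<le> q}" and p = p and ob = Pair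
        and ar = "\<lambda>a b u. ((b, a), u)" and f = "\<lambda>a b u. F a b (snd u) (fst u)", OF category_sqh])
    fix u assume "u \<in> {(d, c). c \<le> d \<and> d \<le> q}"
    then show "chain (sqh G) (\<le>) {..p} (\<lambda>a b. F a b (snd u) (fst u))" using h[of "snd u" "fst u"] by auto
  qed (auto simp: ver cell tensor_simps)
  moreover have "is_functor (sqv ?D) (sqv G) (on_hor ?X) (on_sq ?X)"
  proof (rule functor_of_chains[where J = "{(b, a). a \<le> b \<and> b \<le> p}" and p = q and ob = "\<lambda>c u. (u, c)"
        and ar = "\<lambda>c d u. (u, (d, c))" and f = "\<lambda>c d u. F (snd u) (fst u) c d", OF category_sqv])
    fix u assume "u \<in> {(b, a). a \<le> b \<and> b \<le> p}"
    then show "chain (sqv G) (\<le>) {..q} (\<lambda>c d. F (snd u) (fst u) c d)" using v[of "snd u" "fst u"] by auto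
  qed (auto simp: hor cell tensor_simps)
  ultimately show ?thesis
    unfolding nerve_simps double_functors_def by (simp add: dfun_of_grid_def Let_def)
qed

lemma nerve_eqI:
  assumes "X \<in> bisimplices (double_nerve G) p q" "Y \<in> bisimplices (double_nerve G) p q"
    and "\<And>a b c d. \<lbrakk>a \<le> b; b \<le> p; c \<le> d; d \<le> q\<rbrakk> \<Longrightarrow> cells X a b c d = cells Y a b c d"
  shows "X = Y"
  using grid_of_bisimplex(2)[OF assms(1)] grid_of_bisimplex(2)[OF assms(2)]
    dfun_of_grid_cong[of p q "cells X" "cells Y" G] assms(3) by simp

lemma biact_dfun_of_grid:
  assumes "\<alpha> \<in> ord_maps m p" "\<beta> \<in> ord_maps n q"
  shows "biact (double_nerve G) m p n q \<alpha> \<beta> (dfun_of_grid G p q F) =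
    dfun_of_grid G m n (\<lambda>a b c d. F (\<alpha> a) (\<alpha> b) (\<beta> c) (\<beta> d))"
proof -
  have le: "\<alpha> a \<le> \<alpha> b \<and> \<alpha> b \<le> p" if "a \<le> b" "b \<le> m" for a b
    using ord_maps_mono[OF assms(1) that] ord_maps_le[OF assms(1) that(2)] by simp
  have le': "\<beta> a \<le> \<beta> b \<and> \<beta> b \<le> q" if "a \<le> b" "b \<le> n" for a b
    using ord_maps_mono[OF assms(2) that] ord_maps_le[OF assms(2) that(2)] by simp
  show ?thesis
    unfolding nerve_simps dfun_compose_def dfun_of_grid_def Let_def compose_def ord_tensor_def
    using le le' ord_maps_le[OF assms(1)] ord_maps_le[OF assms(2)]
    by (auto simp: tensor_simps intro!: restrict_ext)
qed

text \<open>Operators act on grids by substituting indices, so the laws reduce to equalities of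
  index maps on the relevant range.\<close>

lemma bisimplicial_set_double_nerve: "bisimplicial_set (double_nerve G)"
proof
  fix m p n q \<alpha> \<beta> X
  assume \<alpha>: "\<alpha> \<in> ord_maps m p" and \<beta>: "\<beta> \<in> ord_maps n q" and X: "X \<in> bisimplices (double_nerve G) p q"
  have "\<alpha> \<in> {..m} \<rightarrow> {..p}" "\<beta> \<in> {..n} \<rightarrow> {..q}" using ord_maps_le[OF \<alpha>] ord_maps_le[OF \<beta>] by auto
  then have "grid G (\<le>) (\<le>) {..m} {..n} (\<lambda>a b c d. cells X (\<alpha> a) (\<alpha> b) (\<beta> c) (\<beta> d))"
    using ord_maps_mono[OF \<alpha>] ord_maps_mono[OF \<beta>]
    by (intro grid_pullback[OF grid_of_bisimplex(1)[OF X]]) auto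
  then show closed: "biact (double_nerve G) m p n q \<alpha> \<beta> X \<in> bisimplices (double_nerve G) m n"
    using bisimplex_of_grid biact_dfun_of_grid[OF \<alpha> \<beta>, of "cells X"] grid_of_bisimplex(2)[OF X] by simp
  fix k l \<alpha>' \<beta>' assume \<alpha>': "\<alpha>' \<in> ord_maps k m" and \<beta>': "\<beta>' \<in> ord_maps l n"
  have "biact (double_nerve G) k p l q (ord_comp k \<alpha> \<alpha>') (ord_comp l \<beta> \<beta>') (dfun_of_grid G p q (cells X)) =
      biact (double_nerve G) k m l n \<alpha>' \<beta>' (biact (double_nerve G) m p n q \<alpha> \<beta> (dfun_of_grid G p q (cells X)))"
    using \<alpha> \<beta> \<alpha>' \<beta>' ord_comp_in[OF \<alpha> \<alpha>'] ord_comp_in[OF \<beta> \<beta>']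
    by (simp add: biact_dfun_of_grid) (rule dfun_of_grid_cong, simp add: ord_comp_apply)
  then show "biact (double_nerve G) k p l q (ord_comp k \<alpha> \<alpha>') (ord_comp l \<beta> \<beta>') X =
      biact (double_nerve G) k m l n \<alpha>' \<beta>' (biact (double_nerve G) m p n q \<alpha> \<beta> X)"
    using grid_of_bisimplex(2)[OF X] by simp
next
  fix p q X
  assume X: "X \<in> bisimplices (double_nerve G) p q"
  have "biact (double_nerve G) p p q q (ord_id p) (ord_id q) (dfun_of_grid G p q (cells X)) =
      dfun_of_grid G p q (cells X)"
    by (simp add: biact_dfun_of_grid ord_id_in) (rule dfun_of_grid_cong, simp add: ord_id_apply)
  then show "biact (double_nerve G) p p q q (ord_id p) (ord_id q) X = X"
    using grid_of_bisimplex(2)[OF X] by simp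
qed

end

text \<open>Compatibility of faces tested square by square, without operators: the meeting point of
  the notions for \<open>K\<^sub>p\<^sub>,\<^sub>*\<close>,
  \<open>K\<^sub>*\<^sub>,\<^sub>q\<close>, bisimplices and the diagonal.\<close>

definition cells_compatible where
  "cells_compatible G T P Q s r y \<longleftrightarrow>
     (\<forall>t\<in>T. y t \<in> bisimplices (double_nerve G) (P t) (Q t)) \<and>
     (\<forall>t\<in>T. \<forall>t'\<in>T. \<forall>a b c d a' b' c' d'.
        a \<le> b \<longrightarrow> b \<le> P t \<longrightarrow> c \<le> d \<longrightarrow> d \<le> Q t \<longrightarrow> a' \<le> b' \<longrightarrow> b' \<le> P t' \<longrightarrow> c' \<le> d' \<longrightarrow> d' \<le> Q t' \<longrightarrow>
        s t a = s t' a' \<longrightarrow> s t b = s t' b' \<longrightarrow> r t c = r t' c' \<longrightarrow> r t d = r t' d' \<longrightarrow>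
        cells (y t) a b c d = cells (y t') a' b' c' d')"

lemma cells_compatibleD:
  assumes "cells_compatible G T P Q s r y"
  shows "t \<in> T \<Longrightarrow> y t \<in> bisimplices (double_nerve G) (P t) (Q t)"
    and "\<lbrakk>t \<in> T; t' \<in> T; a \<le> b; b \<le> P t; c \<le> d; d \<le> Q t; a' \<le> b'; b' \<le> P t'; c' \<le> d'; d' \<le> Q t';
        s t a = s t' a'; s t b = s t' b'; r t c = r t' c'; r t d = r t' d'\<rbrakk> \<Longrightarrow>
        cells (y t) a b c d = cells (y t') a' b' c' d'"
  using assms unfolding cells_compatible_def by blast+

lemma inj_ord_map_le_iff:
  assumes "\<alpha> \<in> ord_maps m n" "inj_on \<alpha> {..m}" "a \<le> m" "b \<le> m"
  shows "\<alpha> a \<le> \<alpha> b \<longleftrightarrow> a \<le> b"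
  using ord_maps_mono[OF assms(1), of a b] ord_maps_mono[OF assms(1), of b a] inj_onD[OF assms(2), of a b] assms(3,4)
  by (cases "a \<le> b") auto

context double_category
begin

text \<open>As \<open>s t\<close> and \<open>r t\<close> are injective and monotone, a face is the
  same as a grid on the rectangle of its vertices, and squares common to two faces are those over
  the intersection of their rectangles.\<close>

lemma nerve_extension_iff_fillable:
  assumes s: "\<And>t. t \<in> T \<Longrightarrow> s t \<in> ord_maps (P t) p" "\<And>t. t \<in> T \<Longrightarrow> inj_on (s t) {..P t}"
    and r: "\<And>t. t \<in> T \<Longrightarrow> r t \<in> ord_maps (Q t) q" "\<And>t. t \<in> T \<Longrightarrow> inj_on (r t) {..Q t}"
    and I: "\<And>t. t \<in> T \<Longrightarrow> s t ` {..P t} = I t" and J: "\<And>t. t \<in> T \<Longrightarrow> r t ` {..Q t} = J t"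
  shows "(\<forall>y. cells_compatible G T P Q s r y \<longrightarrow>
       (\<exists>z\<in>bisimplices (double_nerve G) p q. \<forall>t\<in>T. biact (double_nerve G) (P t) p (Q t) q (s t) (r t) z = y t))
    \<longleftrightarrow> fillable G p q T I J" (is "?L \<longleftrightarrow> ?R")
proof
  { assume L: ?L
    show ?R
      unfolding fillable_def
    proof (intro allI impI)
      fix F assume F: "grid_family G T I J F"
      define Y where "Y t a b c d = F t (s t a) (s t b) (r t c) (r t d)" for t a b c d
      define y where "y t = dfun_of_grid G (P t) (Q t) (Y t)" for t
      have y: "y t \<in> bisimplices (double_nerve G) (P t) (Q t)" if t: "t \<in> T" for t
      proof -
        have "grid G (\<le>) (\<le>) (I t) (J t) (F t)" using F t unfolding grid_family_def by blast
        moreover have "s t \<in> {..P t} \<rightarrow> I t" "r t \<in> {..Q t} \<rightarrow> J t" using I[OF t] J[OF t] by auto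
        ultimately have "grid G (\<le>) (\<le>) {..P t} {..Q t} (Y t)"
          unfolding Y_def by (rule grid_pullback) (use ord_maps_mono[OF s(1)[OF t]] ord_maps_mono[OF r(1)[OF t]] in auto)
        then show ?thesis unfolding y_def by (rule bisimplex_of_grid)
      qed
      have "cells_compatible G T P Q s r y"
        unfolding cells_compatible_def
      proof (intro conjI ballI allI impI)
        fix t t' a b c d a' b' c' d'
        assume t: "t \<in> T" "t' \<in> T" and le: "a \<le> b" "b \<le> P t" "c \<le> d" "d \<le> Q t"
          "a' \<le> b'" "b' \<le> P t'" "c' \<le> d'" "d' \<le> Q t'"
          and eq: "s t a = s t' a'" "s t b = s t' b'" "r t c = r t' c'" "r t d = r t' d'"
        have "s t a \<in> I t \<inter> I t'" "s t b \<in> I t \<inter> I t'"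
          using le eq imageI[of a "{..P t}" "s t"] imageI[of b "{..P t}" "s t"]
            imageI[of a' "{..P t'}" "s t'"] imageI[of b' "{..P t'}" "s t'"] I[OF t(1)] I[OF t(2)] by auto
        moreover have "r t c \<in> J t \<inter> J t'" "r t d \<in> J t \<inter> J t'"
          using le eq imageI[of c "{..Q t}" "r t"] imageI[of d "{..Q t}" "r t"]
            imageI[of c' "{..Q t'}" "r t'"] imageI[of d' "{..Q t'}" "r t'"] J[OF t(1)] J[OF t(2)] by auto
        moreover have "s t a \<le> s t b" "r t c \<le> r t d"
          using ord_maps_mono[OF s(1)[OF t(1)] le(1,2)] ord_maps_mono[OF r(1)[OF t(1)] le(3,4)] by auto
        ultimately have "F t (s t a) (s t b) (r t c) (r t d) = F t' (s t a) (s t b) (r t c) (r t d)"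
          using F t unfolding grid_family_def by blast
        then show "cells (y t) a b c d = cells (y t') a' b' c' d'"
          unfolding y_def using le eq by (simp add: cells_dfun_of_grid Y_def)
      qed (rule y)
      then obtain z where z: "z \<in> bisimplices (double_nerve G) p q"
        "\<forall>t\<in>T. biact (double_nerve G) (P t) p (Q t) q (s t) (r t) z = y t" using L by blast
      have "cells z a b c d = F t a b c d"
        if t: "t \<in> T" and in_IJ: "a \<in> I t" "b \<in> I t" "c \<in> J t" "d \<in> J t" and "a \<le> b" "c \<le> d" for t a b c d
      proof -
        obtain a' b' c' d' where *: "a = s t a'" "b = s t b'" "c = r t c'" "d = r t d'"
          "a' \<le> P t" "b' \<le> P t" "c' \<le> Q t" "d' \<le> Q t"
          using in_IJ unfolding I[OF t, symmetric] J[OF t, symmetric] by auto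
        then have "a' \<le> b'" "c' \<le> d'"
          using \<open>a \<le> b\<close> \<open>c \<le> d\<close> inj_ord_map_le_iff[OF s[OF t]] inj_ord_map_le_iff[OF r[OF t]] by auto
        then show ?thesis
          using * z(2) t cells_biact[of a' b' "P t" c' d' "Q t" G p q "s t" "r t" z]
          by (simp add: y_def cells_dfun_of_grid Y_def)
      qed
      then show "\<exists>F'. grid G (\<le>) (\<le>) {..p} {..q} F' \<and>
          (\<forall>x\<in>T. \<forall>a\<in>I x. \<forall>b\<in>I x. \<forall>c\<in>J x. \<forall>d\<in>J x.
             a \<le> b \<longrightarrow> c \<le> d \<longrightarrow> F' a b c d = F x a b c d)"
        using grid_of_bisimplex(1)[OF z(1)] by (intro exI[of _ "cells z"]) simp
    qed
  }
  { assume R: ?R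
    show ?L
    proof (intro allI impI)
      fix y assume y: "cells_compatible G T P Q s r y"
      note yN = cells_compatibleD(1)[OF y]
      define s' where "s' t = the_inv_into {..P t} (s t)" for t
      define r' where "r' t = the_inv_into {..Q t} (r t)" for t
      have s': "s' t (s t a) = a" if "t \<in> T" "a \<le> P t" for t a
        unfolding s'_def using the_inv_into_f_f[OF s(2)] that by simp
      have r': "r' t (r t a) = a" if "t \<in> T" "a \<le> Q t" for t a
        unfolding r'_def using the_inv_into_f_f[OF r(2)] that by simp
      have s'': "s t (s' t a) = a" "s' t a \<le> P t" if "t \<in> T" "a \<in> I t" for t a
        using that s' unfolding I[OF that(1), symmetric] by auto
      have r'': "r t (r' t a) = a" "r' t a \<le> Q t" if "t \<in> T" "a \<in> J t" for t a
        using that r' unfolding J[OF that(1), symmetric] by auto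
      have s'_le: "s' t a \<le> s' t b" if "t \<in> T" "a \<in> I t" "b \<in> I t" "a \<le> b" for t a b
        using s''[OF that(1,2)] s''[OF that(1,3)] that
          inj_ord_map_le_iff[OF s[OF that(1)], of "s' t a" "s' t b"] by simp
      have r'_le: "r' t a \<le> r' t b" if "t \<in> T" "a \<in> J t" "b \<in> J t" "a \<le> b" for t a b
        using r''[OF that(1,2)] r''[OF that(1,3)] that
          inj_ord_map_le_iff[OF r[OF that(1)], of "r' t a" "r' t b"] by simp
      define F where "F t a b c d = cells (y t) (s' t a) (s' t b) (r' t c) (r' t d)" for t a b c d
      have "grid_family G T I J F"
        unfolding grid_family_def
      proof (intro conjI ballI impI)
        fix t assume t: "t \<in> T"
        show "grid G (\<le>) (\<le>) (I t) (J t) (F t)"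
          unfolding F_def using s''[OF t] r''[OF t] s'_le[OF t] r'_le[OF t]
          by (intro grid_pullback[OF grid_of_bisimplex(1)[OF yN[OF t]]]) auto
      next
        fix t t' a b c d
        assume t: "t \<in> T" "t' \<in> T" and in_IJ: "a \<in> I t \<inter> I t'" "b \<in> I t \<inter> I t'" "c \<in> J t \<inter> J t'" "d \<in> J t \<inter> J t'"
          and le: "a \<le> b" "c \<le> d"
        show "F t a b c d = F t' a b c d"
          unfolding F_def
          by (rule cells_compatibleD(2)[OF y t]) (use t in_IJ le s'' r'' s'_le r'_le in auto)
      qed
      from fillableE[OF R this] obtain F' where F': "grid G (\<le>) (\<le>) {..p} {..q} F'"
        and ext: "\<And>x a b c d. \<lbrakk>x \<in> T; a \<in> I x; b \<in> I x; c \<in> J x; d \<in> J x; a \<le> b; c \<le> d\<rbrakk> \<Longrightarrow>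
          F' a b c d = F x a b c d" by blast
      show "\<exists>z\<in>bisimplices (double_nerve G) p q. \<forall>t\<in>T.
          biact (double_nerve G) (P t) p (Q t) q (s t) (r t) z = y t"
      proof (intro bexI ballI)
        show "dfun_of_grid G p q F' \<in> bisimplices (double_nerve G) p q" by (rule bisimplex_of_grid[OF F'])
        fix t assume t: "t \<in> T"
        have "biact (double_nerve G) (P t) p (Q t) q (s t) (r t) (dfun_of_grid G p q F') =
            dfun_of_grid G (P t) (Q t) (\<lambda>a b c d. F' (s t a) (s t b) (r t c) (r t d))"
          by (rule biact_dfun_of_grid[OF s(1)[OF t] r(1)[OF t]])
        also have "\<dots> = dfun_of_grid G (P t) (Q t) (cells (y t))"
        proof (rule dfun_of_grid_cong)
          fix a b c d assume le: "a \<le> b" "b \<le> P t" "c \<le> d" "d \<le> Q t"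
          have "F' (s t a) (s t b) (r t c) (r t d) = F t (s t a) (s t b) (r t c) (r t d)"
            using le ord_maps_mono[OF s(1)[OF t]] ord_maps_mono[OF r(1)[OF t]] I[OF t] J[OF t]
            by (intro ext[OF t]) auto
          then show "F' (s t a) (s t b) (r t c) (r t d) = cells (y t) a b c d"
            using s'[OF t] r'[OF t] le by (simp add: F_def)
        qed
        also have "\<dots> = y t" using grid_of_bisimplex(2)[OF yN[OF t]] by simp
        finally show "biact (double_nerve G) (P t) p (Q t) q (s t) (r t) (dfun_of_grid G p q F') = y t" .
      qed
    qed
  }
qed

end

section \<open>Horns in the double nerve\<close>

definition edge :: "nat \<Rightarrow> nat \<Rightarrow> nat \<Rightarrow> nat" where
  "edge a b = restrict (\<lambda>i. if i = 0 then a else b) {..1}"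

lemma edge_in: "a \<le> b \<Longrightarrow> b \<le> n \<Longrightarrow> edge a b \<in> ord_maps 1 n"
  by (rule ord_mapsI) (auto simp: edge_def)

lemma edge_simps: "edge a b 0 = a" "edge a b 1 = b" "edge a b (Suc 0) = b"
  by (simp_all add: edge_def)

lemma ord_comp_edge_eqI: "s a = s' a' \<Longrightarrow> s b = s' b' \<Longrightarrow>
    ord_comp 1 s (edge a b) = ord_comp 1 s' (edge a' b')"
  by (rule ord_comp_eqI) (simp add: edge_def)

text \<open>Simplices of the diagonal are compared only along pairs of equal operators, so two edges have to
  be put into one simplex.\<close>

lemma edges_factor:
  assumes "s \<in> ord_maps p n" "s' \<in> ord_maps p' n" "inj_on s' {..p'}"
    and "a \<le> b" "b \<le> p" "c \<le> d" "d \<le> p" "a' \<le> p'" "b' \<le> p'" "c' \<le> p'" "d' \<le> p'"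
    and "s a = s' a'" "s b = s' b'" "s c = s' c'" "s d = s' d'"
  obtains m \<alpha> \<alpha>' e f g h where "\<alpha> \<in> ord_maps m p" "\<alpha>' \<in> ord_maps m p'" "ord_comp m s \<alpha> = ord_comp m s' \<alpha>'"
    "e \<le> f" "f \<le> m" "g \<le> h" "h \<le> m" "\<alpha> e = a" "\<alpha> f = b" "\<alpha> g = c" "\<alpha> h = d"
    "\<alpha>' e = a'" "\<alpha>' f = b'" "\<alpha>' g = c'" "\<alpha>' h = d'"
proof -
  \<comment> \<open>The simplex spanned by the distinct vertices among the four, in increasing
    order, contains both edges.\<close>
  define L where "L = sorted_list_of_set {a, b, c, d}"
  have L: "set L = {a, b, c, d}" "sorted L" "L \<noteq> []"
  proof -
    have "finite {a, b, c, d}" by simp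
    then show "set L = {a, b, c, d}" "sorted L" unfolding L_def by (simp_all only: set_sorted_list_of_set sorted_sorted_list_of_set)
    then show "L \<noteq> []" by auto
  qed
  define m where "m = length L - 1"
  have len: "length L = Suc m" using L(3) by (simp add: m_def)
  have le_p: "x \<le> p" if "x \<in> set L" for x using that assms L(1) by auto
  \<comment> \<open>The same vertices seen from the second face. Injectivity of \<open>s'\<close>
    makes these the prescribed \<open>a'\<close>, \<open>b'\<close>, \<open>c'\<close>,
    \<open>d'\<close>, and since \<open>s'\<close> then reflects the order, the resulting map
    \<open>\<alpha>'\<close> is monotone.\<close>
  define pre where "pre x = (SOME y. y \<le> p' \<and> s x = s' y)" for x
  have pre: "pre x \<le> p' \<and> s x = s' (pre x)" if "x \<in> set L" for x
  proof -
    have "\<exists>y. y \<le> p' \<and> s x = s' y" using that assms L(1) by auto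
    then show ?thesis unfolding pre_def by (rule someI_ex)
  qed
  define \<alpha> where "\<alpha> = restrict (\<lambda>i. L ! i) {..m}"
  define \<alpha>' where "\<alpha>' = restrict (\<lambda>i. pre (L ! i)) {..m}"
  have nth: "L ! i \<in> set L" if "i \<le> m" for i using that len by simp
  have mono: "L ! i \<le> L ! j" if "i \<le> j" "j \<le> m" for i j using sorted_nth_mono[OF L(2)] that len by simp
  have \<alpha>: "\<alpha> \<in> ord_maps m p"
    by (rule ord_mapsI) (use nth le_p mono in \<open>auto simp: \<alpha>_def\<close>)
  have \<alpha>': "\<alpha>' \<in> ord_maps m p'"
  proof (rule ord_mapsI)
    fix i j assume ij: "i \<le> j" "j \<le> m"
    have "s (L ! i) \<le> s (L ! j)" using ord_maps_mono[OF assms(1) mono[OF ij] le_p[OF nth[OF ij(2)]]] .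
    then have "s' (pre (L ! i)) \<le> s' (pre (L ! j))" using pre nth ij by simp
    then show "\<alpha>' i \<le> \<alpha>' j"
      using inj_ord_map_le_iff[OF assms(2,3)] pre nth ij by (simp add: \<alpha>'_def)
  qed (use nth pre in \<open>auto simp: \<alpha>'_def\<close>)
  have eq: "ord_comp m s \<alpha> = ord_comp m s' \<alpha>'"
    by (rule ord_comp_eqI) (use nth pre in \<open>auto simp: \<alpha>_def \<alpha>'_def\<close>)
  have "\<exists>i\<le>m. L ! i = x" if "x \<in> set L" for x
    using that len by (metis in_set_conv_nth less_Suc_eq_le)
  then obtain idx where idx: "\<And>x. x \<in> set L \<Longrightarrow> idx x \<le> m \<and> L ! idx x = x" by metis
  have idx_mono: "idx x \<le> idx y" if "x \<in> set L" "y \<in> set L" "x \<le> y" for x y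
  proof (rule ccontr)
    assume "\<not> idx x \<le> idx y"
    then have "y \<le> x" using mono[of "idx y" "idx x"] idx[OF that(1)] idx[OF that(2)] by simp
    then show False using \<open>\<not> idx x \<le> idx y\<close> that by simp
  qed
  have pre_eq: "pre x = y" if "x \<in> set L" "y \<le> p'" "s x = s' y" for x y
    using pre[OF that(1)] that inj_onD[OF assms(3), of "pre x" y] by simp
  have mem: "a \<in> set L" "b \<in> set L" "c \<in> set L" "d \<in> set L" using L(1) by auto
  show thesis
    using that[OF \<alpha> \<alpha>' eq idx_mono[OF mem(1,2) assms(4)] _ idx_mono[OF mem(3,4) assms(6)]]
      idx[OF mem(1)] idx[OF mem(2)] idx[OF mem(3)] idx[OF mem(4)] assms
      pre_eq[OF mem(1)] pre_eq[OF mem(2)] pre_eq[OF mem(3)] pre_eq[OF mem(4)]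
    by (simp add: \<alpha>_def \<alpha>'_def)
qed

context double_category
begin

sublocale nerve: bisimplicial_set "double_nerve G" by (rule bisimplicial_set_double_nerve)

text \<open>Bisimplices of the nerve are equal as soon as their squares are, and every square of a
  restriction is a square of the original.\<close>

lemma biact_eq_if_cells_compatible:
  assumes y: "cells_compatible G T P Q s r y" and t: "t \<in> T" "t' \<in> T"
    and \<alpha>: "\<alpha> \<in> ord_maps m (P t)" "\<alpha>' \<in> ord_maps m (P t')" "ord_comp m (s t) \<alpha> = ord_comp m (s t') \<alpha>'"
    and \<beta>: "\<beta> \<in> ord_maps n (Q t)" "\<beta>' \<in> ord_maps n (Q t')" "ord_comp n (r t) \<beta> = ord_comp n (r t') \<beta>'"
  shows "biact (double_nerve G) m (P t) n (Q t) \<alpha> \<beta> (y t) = biact (double_nerve G) m (P t') n (Q t') \<alpha>' \<beta>' (y t')"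
proof (rule nerve_eqI)
  note yN = cells_compatibleD(1)[OF y]
  show "biact (double_nerve G) m (P t) n (Q t) \<alpha> \<beta> (y t) \<in> bisimplices (double_nerve G) m n"
    "biact (double_nerve G) m (P t') n (Q t') \<alpha>' \<beta>' (y t') \<in> bisimplices (double_nerve G) m n"
    using nerve.biact_closed \<alpha> \<beta> yN t by blast+
  fix a b c d assume le: "a \<le> b" "b \<le> m" "c \<le> d" "d \<le> n"
  have eq: "s t (\<alpha> i) = s t' (\<alpha>' i)" if "i \<le> m" for i using \<alpha>(3) ord_comp_apply[OF that] by metis
  have eq': "r t (\<beta> i) = r t' (\<beta>' i)" if "i \<le> n" for i using \<beta>(3) ord_comp_apply[OF that] by metis
  have "cells (y t) (\<alpha> a) (\<alpha> b) (\<beta> c) (\<beta> d) = cells (y t') (\<alpha>' a) (\<alpha>' b) (\<beta>' c) (\<beta>' d)"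
    using le by (intro cells_compatibleD(2)[OF y t] ord_maps_mono[OF \<alpha>(1)] ord_maps_mono[OF \<alpha>(2)]
      ord_maps_mono[OF \<beta>(1)] ord_maps_mono[OF \<beta>(2)] ord_maps_le[OF \<alpha>(1)] ord_maps_le[OF \<alpha>(2)]
      ord_maps_le[OF \<beta>(1)] ord_maps_le[OF \<beta>(2)] eq eq') auto
  then show "cells (biact (double_nerve G) m (P t) n (Q t) \<alpha> \<beta> (y t)) a b c d =
      cells (biact (double_nerve G) m (P t') n (Q t') \<alpha>' \<beta>' (y t')) a b c d"
    using le by (simp add: cells_biact)
qed

text \<open>A single square is itself a restriction, along an edge in each direction, so
  compatibility under all operators includes agreement of squares.\<close>

lemma bicompatible_iff:
  "bicompatible (double_nerve G) T P Q s r y \<longleftrightarrow> cells_compatible G T P Q s r y"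
proof
  assume y: "bicompatible (double_nerve G) T P Q s r y"
  show "cells_compatible G T P Q s r y"
    unfolding cells_compatible_def
  proof (intro conjI ballI allI impI)
    fix t t' a b c d a' b' c' d'
    assume t: "t \<in> T" "t' \<in> T" and le: "a \<le> b" "b \<le> P t" "c \<le> d" "d \<le> Q t"
      "a' \<le> b'" "b' \<le> P t'" "c' \<le> d'" "d' \<le> Q t'"
      and eq: "s t a = s t' a'" "s t b = s t' b'" "r t c = r t' c'" "r t d = r t' d'"
    have "biact (double_nerve G) 1 (P t) 1 (Q t) (edge a b) (edge c d) (y t) =
        biact (double_nerve G) 1 (P t') 1 (Q t') (edge a' b') (edge c' d') (y t')"
      using y t edge_in[OF le(1,2)] edge_in[OF le(3,4)] edge_in[OF le(5,6)] edge_in[OF le(7,8)]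
        ord_comp_edge_eqI[of "s t" a "s t'" a' b b', OF eq(1,2)] ord_comp_edge_eqI[of "r t" c "r t'" c' d d', OF eq(3,4)]
      unfolding bicompatible_def by blast
    then show "cells (y t) a b c d = cells (y t') a' b' c' d'"
      using cells_biact[of 0 1 1 0 1 1 G "P t" "Q t" "edge a b" "edge c d" "y t"]
        cells_biact[of 0 1 1 0 1 1 G "P t'" "Q t'" "edge a' b'" "edge c' d'" "y t'"]
      by (simp add: edge_simps)
  qed (use y in \<open>simp add: bicompatible_def\<close>)
next
  assume y: "cells_compatible G T P Q s r y"
  show "bicompatible (double_nerve G) T P Q s r y"
    unfolding bicompatible_def using biact_eq_if_cells_compatible[OF y] cells_compatibleD(1)[OF y] by blast
qed

lemma compatible_fix_first_iff:
  "compatible (fix_first (double_nerve G) p) T Q r y \<longleftrightarrow>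
    cells_compatible G T (\<lambda>_. p) Q (\<lambda>_. ord_id p) r y"
proof
  assume y: "compatible (fix_first (double_nerve G) p) T Q r y"
  show "cells_compatible G T (\<lambda>_. p) Q (\<lambda>_. ord_id p) r y"
    unfolding cells_compatible_def
  proof (intro conjI ballI allI impI)
    fix t t' a b c d a' b' c' d'
    assume t: "t \<in> T" "t' \<in> T" and le: "a \<le> b" "b \<le> p" "c \<le> d" "d \<le> Q t"
      "a' \<le> b'" "b' \<le> p" "c' \<le> d'" "d' \<le> Q t'"
      and eq: "ord_id p a = ord_id p a'" "ord_id p b = ord_id p b'" "r t c = r t' c'" "r t d = r t' d'"
    have "act (fix_first (double_nerve G) p) 1 (Q t) (edge c d) (y t) =
        act (fix_first (double_nerve G) p) 1 (Q t') (edge c' d') (y t')"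
      using y t edge_in[OF le(3,4)] edge_in[OF le(7,8)]
        ord_comp_edge_eqI[of "r t" c "r t'" c' d d', OF eq(3,4)]
      unfolding compatible_def by blast
    moreover have "a = a'" "b = b'" using eq le by (simp_all add: ord_id_apply)
    ultimately show "cells (y t) a b c d = cells (y t') a' b' c' d'"
      using cells_biact[of a b p 0 1 1 G p "Q t" "ord_id p" "edge c d" "y t"]
        cells_biact[of a b p 0 1 1 G p "Q t'" "ord_id p" "edge c' d'" "y t'"] le
      by (simp add: edge_simps fix_first_def ord_id_apply)
  qed (use y in \<open>simp add: compatible_def fix_first_def\<close>)
next
  assume y: "cells_compatible G T (\<lambda>_. p) Q (\<lambda>_. ord_id p) r y"
  show "compatible (fix_first (double_nerve G) p) T Q r y"
    unfolding compatible_def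
  proof (intro conjI ballI allI impI)
    fix t t' m \<beta> \<beta>' assume "t \<in> T" "t' \<in> T" "\<beta> \<in> ord_maps m (Q t)" "\<beta>' \<in> ord_maps m (Q t')"
      "ord_comp m (r t) \<beta> = ord_comp m (r t') \<beta>'"
    from biact_eq_if_cells_compatible[OF y this(1,2) ord_id_in ord_id_in refl this(3-5)]
    show "act (fix_first (double_nerve G) p) m (Q t) \<beta> (y t) =
        act (fix_first (double_nerve G) p) m (Q t') \<beta>' (y t')" by (simp add: fix_first_def)
  qed (simp add: fix_first_def cells_compatibleD(1)[OF y])
qed

lemma compatible_fix_second_iff:
  "compatible (fix_second (double_nerve G) q) T P s y \<longleftrightarrow>
    cells_compatible G T P (\<lambda>_. q) s (\<lambda>_. ord_id q) y"
proof
  assume y: "compatible (fix_second (double_nerve G) q) T P s y"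
  show "cells_compatible G T P (\<lambda>_. q) s (\<lambda>_. ord_id q) y"
    unfolding cells_compatible_def
  proof (intro conjI ballI allI impI)
    fix t t' a b c d a' b' c' d'
    assume t: "t \<in> T" "t' \<in> T" and le: "a \<le> b" "b \<le> P t" "c \<le> d" "d \<le> q"
      "a' \<le> b'" "b' \<le> P t'" "c' \<le> d'" "d' \<le> q"
      and eq: "s t a = s t' a'" "s t b = s t' b'" "ord_id q c = ord_id q c'" "ord_id q d = ord_id q d'"
    have "act (fix_second (double_nerve G) q) 1 (P t) (edge a b) (y t) =
        act (fix_second (double_nerve G) q) 1 (P t') (edge a' b') (y t')"
      using y t edge_in[OF le(1,2)] edge_in[OF le(5,6)]
        ord_comp_edge_eqI[of "s t" a "s t'" a' b b', OF eq(1,2)]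
      unfolding compatible_def by blast
    moreover have "c = c'" "d = d'" using eq le by (simp_all add: ord_id_apply)
    ultimately show "cells (y t) a b c d = cells (y t') a' b' c' d'"
      using cells_biact[of 0 1 1 c d q G "P t" q "edge a b" "ord_id q" "y t"]
        cells_biact[of 0 1 1 c d q G "P t'" q "edge a' b'" "ord_id q" "y t'"] le
      by (simp add: edge_simps fix_second_def ord_id_apply)
  qed (use y in \<open>simp add: compatible_def fix_second_def\<close>)
next
  assume y: "cells_compatible G T P (\<lambda>_. q) s (\<lambda>_. ord_id q) y"
  show "compatible (fix_second (double_nerve G) q) T P s y"
    unfolding compatible_def
  proof (intro conjI ballI allI impI)
    fix t t' m \<alpha> \<alpha>' assume "t \<in> T" "t' \<in> T" "\<alpha> \<in> ord_maps m (P t)" "\<alpha>' \<in> ord_maps m (P t')"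
      "ord_comp m (s t) \<alpha> = ord_comp m (s t') \<alpha>'"
    from biact_eq_if_cells_compatible[OF y this ord_id_in ord_id_in refl]
    show "act (fix_second (double_nerve G) q) m (P t) \<alpha> (y t) =
        act (fix_second (double_nerve G) q) m (P t') \<alpha>' (y t')" by (simp add: fix_second_def)
  qed (simp add: fix_second_def cells_compatibleD(1)[OF y])
qed

text \<open>Here only operators \<open>(\<alpha>, \<alpha>)\<close> are available, so the column
  pair and the row pair of a square must factor through one simplex.\<close>

lemma compatible_diag_iff:
  assumes s: "\<And>t. t \<in> T \<Longrightarrow> s t \<in> ord_maps (P t) n" "\<And>t. t \<in> T \<Longrightarrow> inj_on (s t) {..P t}"
  shows "compatible (diag (double_nerve G)) T P s y \<longleftrightarrow> cells_compatible G T P P s s y"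
proof
  assume y: "compatible (diag (double_nerve G)) T P s y"
  show "cells_compatible G T P P s s y"
    unfolding cells_compatible_def
  proof (intro conjI ballI allI impI)
    fix t t' a b c d a' b' c' d'
    assume t: "t \<in> T" "t' \<in> T" and le: "a \<le> b" "b \<le> P t" "c \<le> d" "d \<le> P t"
      "a' \<le> b'" "b' \<le> P t'" "c' \<le> d'" "d' \<le> P t'"
      and eq: "s t a = s t' a'" "s t b = s t' b'" "s t c = s t' c'" "s t d = s t' d'"
    obtain m \<alpha> \<alpha>' e f g h where *: "\<alpha> \<in> ord_maps m (P t)" "\<alpha>' \<in> ord_maps m (P t')"
      "ord_comp m (s t) \<alpha> = ord_comp m (s t') \<alpha>'" "e \<le> f" "f \<le> m" "g \<le> h" "h \<le> m"
      "\<alpha> e = a" "\<alpha> f = b" "\<alpha> g = c" "\<alpha> h = d" "\<alpha>' e = a'" "\<alpha>' f = b'" "\<alpha>' g = c'" "\<alpha>' h = d'"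
      using edges_factor[OF s(1)[OF t(1)] s(1)[OF t(2)] s(2)[OF t(2)] le(1-4) order_trans[OF le(5,6)] le(6)
          order_trans[OF le(7,8)] le(8) eq] .
    have "act (diag (double_nerve G)) m (P t) \<alpha> (y t) = act (diag (double_nerve G)) m (P t') \<alpha>' (y t')"
      using y t *(1-3) unfolding compatible_def by blast
    then show "cells (y t) a b c d = cells (y t') a' b' c' d'"
      using cells_biact[OF *(4-7), of G "P t" "P t" \<alpha> \<alpha> "y t"]
        cells_biact[OF *(4-7), of G "P t'" "P t'" \<alpha>' \<alpha>' "y t'"] *(8-)
      by (simp add: diag_def)
  qed (use y in \<open>simp add: compatible_def diag_def\<close>)
next
  assume y: "cells_compatible G T P P s s y"
  show "compatible (diag (double_nerve G)) T P s y"
    unfolding compatible_def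
  proof (intro conjI ballI allI impI)
    fix t t' m \<alpha> \<alpha>' assume "t \<in> T" "t' \<in> T" "\<alpha> \<in> ord_maps m (P t)" "\<alpha>' \<in> ord_maps m (P t')"
      "ord_comp m (s t) \<alpha> = ord_comp m (s t') \<alpha>'"
    from biact_eq_if_cells_compatible[OF y this this(3-5)]
    show "act (diag (double_nerve G)) m (P t) \<alpha> (y t) =
        act (diag (double_nerve G)) m (P t') \<alpha>' (y t')" by (simp add: diag_def)
  qed (simp add: diag_def cells_compatibleD(1)[OF y])
qed

lemma kan_diag_iff: "kan_complex (diag (double_nerve G)) \<longleftrightarrow> diag_fillable G"
proof -
  have "(\<forall>y. compatible (diag (double_nerve G)) ({..n} - {k}) (\<lambda>_. n - 1) (coface n) y \<longrightarrow>
      (\<exists>z\<in>simplices (diag (double_nerve G)) n. \<forall>i\<in>{..n} - {k}.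
        act (diag (double_nerve G)) (n - 1) n (coface n i) z = y i)) \<longleftrightarrow>
      fillable G n n ({..n} - {k}) (\<lambda>i. {..n} - {i}) (\<lambda>i. {..n} - {i})" if "1 \<le> n" for n k
    unfolding compatible_diag_iff[OF coface_in[OF that] inj_on_coface]
    using nerve_extension_iff_fillable[of "{..n} - {k}" "coface n" "\<lambda>_. n - 1" n "coface n" "\<lambda>_. n - 1" n
        "\<lambda>i. {..n} - {i}" "\<lambda>i. {..n} - {i}"] coface_in[OF that] inj_on_coface coface_image[OF that]
    by (simp add: diag_def)
  then show ?thesis
    unfolding simplicial_set.kan_complex_iff[OF nerve.simplicial_sets(3)] diag_fillable_def by (simp cong: imp_cong)
qed

lemma kan_fix_first_iff:
  "kan_complex (fix_first (double_nerve G) p) \<longleftrightarrow>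
    (\<forall>n\<ge>1. \<forall>k\<le>n. fillable G p n ({..n} - {k}) (\<lambda>_. {..p}) (\<lambda>i. {..n} - {i}))"
proof -
  have id: "ord_id p ` {..p} = {..p}" "inj_on (ord_id p) {..p}"
    by (auto simp: ord_id_def inj_on_def)
  have "(\<forall>y. compatible (fix_first (double_nerve G) p) ({..n} - {k}) (\<lambda>_. n - 1) (coface n) y \<longrightarrow>
      (\<exists>z\<in>simplices (fix_first (double_nerve G) p) n. \<forall>i\<in>{..n} - {k}.
        act (fix_first (double_nerve G) p) (n - 1) n (coface n i) z = y i)) \<longleftrightarrow>
      fillable G p n ({..n} - {k}) (\<lambda>_. {..p}) (\<lambda>i. {..n} - {i})" if "1 \<le> n" for n k
    unfolding compatible_fix_first_iff
    using nerve_extension_iff_fillable[of "{..n} - {k}" "\<lambda>_. ord_id p" "\<lambda>_. p" p "coface n" "\<lambda>_. n - 1" n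
        "\<lambda>_. {..p}" "\<lambda>i. {..n} - {i}"] coface_in[OF that] inj_on_coface coface_image[OF that] id ord_id_in
    by (simp add: fix_first_def)
  then show ?thesis
    unfolding simplicial_set.kan_complex_iff[OF nerve.simplicial_sets(1)] by (simp cong: imp_cong)
qed

lemma kan_fix_second_iff:
  "kan_complex (fix_second (double_nerve G) q) \<longleftrightarrow>
    (\<forall>n\<ge>1. \<forall>k\<le>n. fillable G n q ({..n} - {k}) (\<lambda>i. {..n} - {i}) (\<lambda>_. {..q}))"
proof -
  have id: "ord_id q ` {..q} = {..q}" "inj_on (ord_id q) {..q}"
    by (auto simp: ord_id_def inj_on_def)
  have "(\<forall>y. compatible (fix_second (double_nerve G) q) ({..n} - {k}) (\<lambda>_. n - 1) (coface n) y \<longrightarrow>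
      (\<exists>z\<in>simplices (fix_second (double_nerve G) q) n. \<forall>i\<in>{..n} - {k}.
        act (fix_second (double_nerve G) q) (n - 1) n (coface n i) z = y i)) \<longleftrightarrow>
      fillable G n q ({..n} - {k}) (\<lambda>i. {..n} - {i}) (\<lambda>_. {..q})" if "1 \<le> n" for n k
    unfolding compatible_fix_second_iff
    using nerve_extension_iff_fillable[of "{..n} - {k}" "coface n" "\<lambda>_. n - 1" n "\<lambda>_. ord_id q" "\<lambda>_. q" q
        "\<lambda>i. {..n} - {i}" "\<lambda>_. {..q}"] coface_in[OF that] inj_on_coface coface_image[OF that] id ord_id_in
    by (simp add: fix_second_def)
  then show ?thesis
    unfolding simplicial_set.kan_complex_iff[OF nerve.simplicial_sets(2)] by (simp cong: imp_cong)
qed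

lemma bihorn_extension_iff:
  assumes "1 \<le> p" "1 \<le> q"
  shows "(\<forall>f. bisimplicial_map (bihorn p q k l) (double_nerve G) f \<longrightarrow>
      (\<exists>g. bisimplicial_map (std_bisimplex p q) (double_nerve G) g \<and>
        (\<forall>m n. \<forall>x\<in>bisimplices (bihorn p q k l) m n. g m n x = f m n x))) \<longleftrightarrow>
    fillable G p q (({..p} - {k}) <+> ({..q} - {l}))
      (case_sum (\<lambda>i. {..p} - {i}) (\<lambda>_. {..p})) (case_sum (\<lambda>_. {..q}) (\<lambda>j. {..q} - {j}))"
proof -
  \<comment> \<open>\<open>Inl i\<close> labels the horizontal face omitting column
    \<open>i\<close>, and \<open>Inr j\<close> the vertical face omitting row \<open>j\<close>; each
    is full in the other direction.\<close>
  let ?T = "({..p} - {k}) <+> ({..q} - {l}) :: (nat + nat) set"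
  let ?P = "case_sum (\<lambda>_. p - 1) (\<lambda>_. p) :: nat + nat \<Rightarrow> nat"
  let ?Q = "case_sum (\<lambda>_. q) (\<lambda>_. q - 1) :: nat + nat \<Rightarrow> nat"
  let ?s = "case_sum (coface p) (\<lambda>_. ord_id p) :: nat + nat \<Rightarrow> nat \<Rightarrow> nat"
  let ?r = "case_sum (\<lambda>_. ord_id q) (coface q) :: nat + nat \<Rightarrow> nat \<Rightarrow> nat"
  have id: "ord_id n ` {..n} = {..n}" "inj_on (ord_id n) {..n}" for n
    by (auto simp: ord_id_def inj_on_def)
  have s: "?s t \<in> ord_maps (?P t) p" "inj_on (?s t) {..?P t}"
    and r: "?r t \<in> ord_maps (?Q t) q" "inj_on (?r t) {..?Q t}" for t
    using coface_in[OF assms(1)] coface_in[OF assms(2)] ord_id_in inj_on_coface id by (cases t; simp)+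
  have I: "?s t ` {..?P t} = case_sum (\<lambda>i. {..p} - {i}) (\<lambda>_. {..p}) t"
    and J: "?r t ` {..?Q t} = case_sum (\<lambda>_. {..q}) (\<lambda>j. {..q} - {j}) t" if t: "t \<in> ?T" for t
  proof -
    consider i where "t = Inl i" "i \<le> p" | j where "t = Inr j" "j \<le> q" using t by auto
    then show "?s t ` {..?P t} = case_sum (\<lambda>i. {..p} - {i}) (\<lambda>_. {..p}) t"
      "?r t ` {..?Q t} = case_sum (\<lambda>_. {..q}) (\<lambda>j. {..q} - {j}) t"
      by (cases; simp only: sum.case coface_image[OF assms(1)] coface_image[OF assms(2)] id)+
  qed
  have "bihorn p q k l = bisset_generated (std_bisimplex p q) ((\<lambda>t. (?P t, ?Q t, ?s t, ?r t)) ` ?T)"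
    unfolding bihorn_def Plus_def image_Un image_image sum.case
    by (rule arg_cong[of _ _ "bisset_generated _"]) (auto simp: image_def)
  then have "(\<forall>f. bisimplicial_map (bihorn p q k l) (double_nerve G) f \<longrightarrow>
      (\<exists>g. bisimplicial_map (std_bisimplex p q) (double_nerve G) g \<and>
        (\<forall>m n. \<forall>x\<in>bisimplices (bihorn p q k l) m n. g m n x = f m n x))) \<longleftrightarrow>
    (\<forall>y. bicompatible (double_nerve G) ?T ?P ?Q ?s ?r y \<longrightarrow>
      (\<exists>z\<in>bisimplices (double_nerve G) p q. \<forall>t\<in>?T.
        biact (double_nerve G) (?P t) p (?Q t) q (?s t) (?r t) z = y t))"
    using nerve.extends_generated_iff[of ?T ?s ?P p ?r ?Q q, OF s(1) r(1)] by (simp only:)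
  also have "\<dots> \<longleftrightarrow> fillable G p q ?T (case_sum (\<lambda>i. {..p} - {i}) (\<lambda>_. {..p}))
      (case_sum (\<lambda>_. {..q}) (\<lambda>j. {..q} - {j}))"
    unfolding bicompatible_iff by (rule nerve_extension_iff_fillable[OF s r I J])
  finally show ?thesis .
qed

lemma extension_condition_iff: "extension_condition (double_nerve G) \<longleftrightarrow> extension_fillable G"
proof -
  have "extension_condition (double_nerve G) \<longleftrightarrow>
      (\<forall>p. kan_complex (fix_first (double_nerve G) p)) \<and> (\<forall>q. kan_complex (fix_second (double_nerve G) q)) \<and>
      (\<forall>p\<ge>1. \<forall>q\<ge>1. \<forall>k\<le>p. \<forall>l\<le>q. \<forall>f. bisimplicial_map (bihorn p q k l) (double_nerve G) f \<longrightarrow>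
        (\<exists>g. bisimplicial_map (std_bisimplex p q) (double_nerve G) g \<and>
          (\<forall>m n. \<forall>x\<in>bisimplices (bihorn p q k l) m n. g m n x = f m n x)))"
    using nerve.bisimplicial_set_axioms
    unfolding extension_condition_def extension_condition_axioms_def by blast
  also have "\<dots> \<longleftrightarrow> extension_fillable G"
    unfolding extension_fillable_def kan_fix_first_iff kan_fix_second_iff
    using bihorn_extension_iff by (simp cong: imp_cong) blast
  finally show ?thesis .
qed

end

theorem theorem5p1:
  fixes G :: "('o, 'h, 'v, 'c) dcat"
  assumes "double_category G"
  shows "(double_groupoid G \<and> filling_condition G \<longleftrightarrow> extension_condition (double_nerve G)) \<and>
    (extension_condition (double_nerve G) \<longleftrightarrow> kan_complex (diag (double_nerve G)))"
  using double_category.double_groupoid_filling_iff[OF assms] double_category.kan_diag_iff[OF assms]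
    double_category.extension_condition_iff[OF assms] by simp

end
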